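(* Let $X$ be a Dieudonné complete Tychonoff space, and let $L(X)$ be the free locally convex space over $X$, regarded as an abelian topological group under addition. Then $L(X)$ is a reflexive group if and only if $X$ is discrete.
   Context: A Tychonoff space $X$ is Dieudonné complete if its universal uniformity $\mathcal{U}_X$ (the finest uniformity inducing the topology of $X$) is complete. Locally convex spaces are real and Hausdorff. The free locally convex space $L(X)$ on a Tychonoff space $X$ is a locally convex space $L(X)$ together with a continuous map $i: X\to L(X)$ such that for every continuous map $f$ from $X$ to a locally convex space $E$ there is a unique continuous linear operator $\bar f: L(X)\to E$ with $f=\bar f\circ i$. It always exists and is unique up to isomorphism; $i$ is a topological embedding and $i(X)$ is a Hamel basis of $L(X)$. For an abelian topological group $G$, a character of $G$ is a continuous homomorphism from $G$ into the unit circle group $\mathbb{S}=\{z\in\mathbb{C}: |z|=1\}$. The dual group $\widehat{G}$ is the group of all characters of $G$ under pointwise multiplication, and $G^\wedge$ denotes $\widehat{G}$ endowed with the compact-open topology. The canonical homomorphism is $\alpha_G: G\to G^{\wedge\wedge}$, $g\mapsto(\chi\mapsto\chi(g))$. The group $G$ is called reflexive if $\alpha_G$ is a topological isomorphism. *)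

theory Defs
  imports "HOL-Analysis.Analysis" "HOL-Analysis.Finite_Function_Topology" "HOL-Algebra.Group"
begin

section \<open>Uniformities and Dieudonne completeness\<close>

text \<open>A uniformity on a set \<^term>\<open>S\<close> is given by its filter of entourages. The conditions are those
  of the class \<^class>\<open>uniform_space\<close>, relativised to \<^term>\<open>S\<close>. In the order of filters,
  \<^term>\<open>U \<le> V\<close> says that \<^term>\<open>U\<close> has more entourages, i.e. that \<^term>\<open>U\<close> is finer.\<close>

definition is_uniformity_on :: "'a set \<Rightarrow> ('a \<times> 'a) filter \<Rightarrow> bool" where
  "is_uniformity_on S U \<longleftrightarrow>
     U \<le> principal (S \<times> S) \<and>
     (\<forall>E. eventually E U \<longrightarrow> (\<forall>x\<in>S. E (x, x))) \<and>
     (\<forall>E. eventually E U \<longrightarrow> eventually (\<lambda>(x, y). E (y, x)) U) \<and>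
     (\<forall>E. eventually E U \<longrightarrow>
        (\<exists>D. eventually D U \<and> (\<forall>x y z. D (x, y) \<longrightarrow> D (y, z) \<longrightarrow> E (x, z))))"

definition topology_of_uniformity :: "'a set \<Rightarrow> ('a \<times> 'a) filter \<Rightarrow> 'a topology" where
  "topology_of_uniformity S U =
     topology (\<lambda>W. W \<subseteq> S \<and> (\<forall>x\<in>W. eventually (\<lambda>(x', y). x' = x \<longrightarrow> y \<in> W) U))"

lemma openin_topology_of_uniformity:
  "openin (topology_of_uniformity S U) W \<longleftrightarrow>
     W \<subseteq> S \<and> (\<forall>x\<in>W. eventually (\<lambda>(x', y). x' = x \<longrightarrow> y \<in> W) U)"
proof -
  let ?P = "\<lambda>W. W \<subseteq> S \<and> (\<forall>x\<in>W. eventually (\<lambda>(x', y). x' = x \<longrightarrow> y \<in> W) U)"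
  have "istopology ?P"
    unfolding istopology_def
  proof (intro conjI allI impI)
    fix A B assume A: "?P A" and B: "?P B"
    show "A \<inter> B \<subseteq> S" using A by blast
    show "\<forall>x\<in>A \<inter> B. eventually (\<lambda>(x', y). x' = x \<longrightarrow> y \<in> A \<inter> B) U"
    proof
      fix x assume "x \<in> A \<inter> B"
      then have "eventually (\<lambda>(x', y). x' = x \<longrightarrow> y \<in> A) U"
        and "eventually (\<lambda>(x', y). x' = x \<longrightarrow> y \<in> B) U"
        using A B by auto
      then show "eventually (\<lambda>(x', y). x' = x \<longrightarrow> y \<in> A \<inter> B) U"
        by eventually_elim auto
    qed
  next
    fix K assume K: "\<forall>A\<in>K. ?P A"
    show "\<Union>K \<subseteq> S" using K by blast
    show "\<forall>x\<in>\<Union>K. eventually (\<lambda>(x', y). x' = x \<longrightarrow> y \<in> \<Union>K) U"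
    proof
      fix x assume "x \<in> \<Union>K"
      then obtain A where "A \<in> K" "x \<in> A" by blast
      then have "eventually (\<lambda>(x', y). x' = x \<longrightarrow> y \<in> A) U" using K by blast
      then show "eventually (\<lambda>(x', y). x' = x \<longrightarrow> y \<in> \<Union>K) U"
        by (rule eventually_mono) (use \<open>A \<in> K\<close> in auto)
    qed
  qed
  then show ?thesis
    unfolding topology_of_uniformity_def by (simp add: topology_inverse')
qed

definition is_universal_uniformity :: "'a topology \<Rightarrow> ('a \<times> 'a) filter \<Rightarrow> bool" where
  "is_universal_uniformity X U \<longleftrightarrow>
     is_uniformity_on (topspace X) U \<and> topology_of_uniformity (topspace X) U = X \<and>
     (\<forall>V. is_uniformity_on (topspace X) V \<and> topology_of_uniformity (topspace X) V = X \<longrightarrow> U \<le> V)"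

lemma is_universal_uniformity_unique:
  assumes "is_universal_uniformity X U" "is_universal_uniformity X V"
  shows "U = V"
  using assms unfolding is_universal_uniformity_def by (meson order_antisym)

definition complete_uniformity_on :: "'a set \<Rightarrow> ('a \<times> 'a) filter \<Rightarrow> bool" where
  "complete_uniformity_on S U \<longleftrightarrow>
     (\<forall>F. F \<le> principal S \<longrightarrow> F \<noteq> bot \<longrightarrow> F \<times>\<^sub>F F \<le> U \<longrightarrow>
        (\<exists>x\<in>S. F \<le> nhdsin (topology_of_uniformity S U) x))"

definition Dieudonne_complete :: "'a topology \<Rightarrow> bool" where
  "Dieudonne_complete X \<longleftrightarrow>
     (\<exists>U. is_universal_uniformity X U \<and> complete_uniformity_on (topspace X) U)"

definition Tychonoff_space :: "'a topology \<Rightarrow> bool" where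
  "Tychonoff_space X \<longleftrightarrow> completely_regular_space X \<and> Hausdorff_space X"

section \<open>Abelian topological groups and their duals\<close>

definition abelian_topological_group :: "'g monoid \<Rightarrow> 'g topology \<Rightarrow> bool" where
  "abelian_topological_group G T \<longleftrightarrow>
     comm_group G \<and> topspace T = carrier G \<and>
     continuous_map (prod_topology T T) T (\<lambda>(x, y). x \<otimes>\<^bsub>G\<^esub> y) \<and>
     continuous_map T T (\<lambda>x. inv\<^bsub>G\<^esub> x)"

definition circle_group :: "complex monoid" where
  "circle_group = \<lparr>carrier = sphere 0 1, monoid.mult = (*), one = 1\<rparr>"

abbreviation circle_topology :: "complex topology" where
  "circle_topology \<equiv> top_of_set (sphere 0 1)"

text \<open>Characters are made \<^const>\<open>extensional\<close> so that two of them are equal iff they agree on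
  the carrier.\<close>

definition characters :: "'g monoid \<Rightarrow> 'g topology \<Rightarrow> ('g \<Rightarrow> complex) set" where
  "characters G T =
     {\<phi> \<in> hom G circle_group \<inter> extensional (carrier G). continuous_map T circle_topology \<phi>}"

definition dual_group :: "'g monoid \<Rightarrow> 'g topology \<Rightarrow> ('g \<Rightarrow> complex) monoid" where
  "dual_group G T =
     \<lparr>carrier = characters G T,
      monoid.mult = (\<lambda>\<phi> \<psi>. \<lambda>x\<in>carrier G. \<phi> x * \<psi> x),
      one = (\<lambda>x\<in>carrier G. 1)\<rparr>"

definition dual_topology :: "'g monoid \<Rightarrow> 'g topology \<Rightarrow> ('g \<Rightarrow> complex) topology" where
  "dual_topology G T =
     topology_generated_by
       {{\<phi> \<in> characters G T. \<phi> ` K \<subseteq> V} | K V. compactin T K \<and> openin circle_topology V}"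

lemma topspace_dual_topology: "topspace (dual_topology G T) = characters G T"
proof -
  have "{\<phi> \<in> characters G T. \<phi> ` {} \<subseteq> {}} \<in>
      {{\<phi> \<in> characters G T. \<phi> ` K \<subseteq> V} | K V. compactin T K \<and> openin circle_topology V}"
    by blast
  then show ?thesis
    unfolding dual_topology_def topology_generated_by_topspace by auto
qed

definition bidual_group :: "'g monoid \<Rightarrow> 'g topology \<Rightarrow> (('g \<Rightarrow> complex) \<Rightarrow> complex) monoid" where
  "bidual_group G T = dual_group (dual_group G T) (dual_topology G T)"

definition bidual_topology :: "'g monoid \<Rightarrow> 'g topology \<Rightarrow> (('g \<Rightarrow> complex) \<Rightarrow> complex) topology" where
  "bidual_topology G T = dual_topology (dual_group G T) (dual_topology G T)"

definition canonical_hom :: "'g monoid \<Rightarrow> 'g topology \<Rightarrow> 'g \<Rightarrow> ('g \<Rightarrow> complex) \<Rightarrow> complex" where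
  "canonical_hom G T g = (\<lambda>\<phi>\<in>characters G T. \<phi> g)"

definition reflexive_group :: "'g monoid \<Rightarrow> 'g topology \<Rightarrow> bool" where
  "reflexive_group G T \<longleftrightarrow>
     abelian_topological_group G T \<and>
     canonical_hom G T \<in> iso G (bidual_group G T) \<and>
     homeomorphic_map T (bidual_topology G T) (canonical_hom G T)"

section \<open>Locally convex spaces\<close>

text \<open>The carrier of a locally convex space is \<^term>\<open>topspace T\<close>, a linear subspace of a type of class
  \<^class>\<open>real_vector\<close>. Spaces of all sizes up to that of the type are thus available in one
  type.\<close>

definition locally_convex_space :: "'v::real_vector topology \<Rightarrow> bool" where
  "locally_convex_space T \<longleftrightarrow>
     subspace (topspace T) \<and>
     continuous_map (prod_topology T T) T (\<lambda>(x, y). x + y) \<and>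
     continuous_map (prod_topology euclideanreal T) T (\<lambda>(c, x). c *\<^sub>R x) \<and>
     Hausdorff_space T \<and>
     neighbourhood_base_at 0 convex T"

definition additive_group :: "'v::real_vector topology \<Rightarrow> 'v monoid" where
  "additive_group T = \<lparr>carrier = topspace T, monoid.mult = (+), one = 0\<rparr>"

definition linear_on_set :: "'v::real_vector set \<Rightarrow> ('v \<Rightarrow> 'w::real_vector) \<Rightarrow> bool" where
  "linear_on_set S g \<longleftrightarrow>
     (\<forall>x\<in>S. \<forall>y\<in>S. g (x + y) = g x + g y) \<and> (\<forall>c. \<forall>x\<in>S. g (c *\<^sub>R x) = c *\<^sub>R g x)"

definition continuous_linear_maps ::
    "'v::real_vector topology \<Rightarrow> 'w::real_vector topology \<Rightarrow> ('v \<Rightarrow> 'w) set" where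
  "continuous_linear_maps L E =
     {g \<in> extensional (topspace L). continuous_map L E g \<and> linear_on_set (topspace L) g}"

section \<open>Free locally convex spaces\<close>

definition lcs_universal_property ::
    "'e::real_vector itself \<Rightarrow> 'a topology \<Rightarrow> 'v::real_vector topology \<Rightarrow> ('a \<Rightarrow> 'v) \<Rightarrow> bool" where
  "lcs_universal_property (_ :: 'e itself) X L i \<longleftrightarrow>
     (\<forall>(E :: 'e topology) f. locally_convex_space E \<and> continuous_map X E f \<longrightarrow>
        (\<exists>!g. g \<in> continuous_linear_maps L E \<and> (\<forall>x\<in>topspace X. g (i x) = f x)))"

text \<open>The universal property speaks of all locally convex spaces, but a definition in HOL cannot
  quantify over the types they live in. Two types suffice: the type of \<^term>\<open>L\<close> and the type of
  finitely supported functions on the type of \<^term>\<open>X\<close>. The theorem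
  \<open>free_lcs_universal_property\<close> below derives the universal property with respect to the
  locally convex spaces of every type.\<close>

definition free_lcs :: "'a topology \<Rightarrow> 'v::real_vector topology \<Rightarrow> ('a \<Rightarrow> 'v) \<Rightarrow> bool" where
  "free_lcs X L i \<longleftrightarrow>
     locally_convex_space L \<and> continuous_map X L i \<and>
     lcs_universal_property TYPE('v) X L i \<and>
     lcs_universal_property TYPE('a \<Rightarrow>\<^sub>0 real) X L i"

lemma abelian_topological_group_additive_group:
  assumes "locally_convex_space T"
  shows "abelian_topological_group (additive_group T) T"
proof -
  have sub: "subspace (topspace T)"
    and add: "continuous_map (prod_topology T T) T (\<lambda>(x, y). x + y)"
    and scale: "continuous_map (prod_topology euclideanreal T) T (\<lambda>(c, x). c *\<^sub>R x)"
    using assms unfolding locally_convex_space_def by auto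
  have cg: "comm_group (additive_group T)"
    by (rule comm_groupI)
      (auto simp: additive_group_def subspace_add[OF sub] subspace_0[OF sub] add_ac
        intro: bexI[OF _ subspace_neg[OF sub]])
  have inv: "inv\<^bsub>additive_group T\<^esub> x = - x" if "x \<in> topspace T" for x
    using that subspace_neg[OF sub that]
    by (intro comm_group.axioms(2)[OF cg, THEN group.inv_equality])
       (auto simp: additive_group_def)
  have "continuous_map T (prod_topology euclideanreal T) (\<lambda>x. (-1, x))"
    by (simp add: continuous_map_pairedI)
  from continuous_map_compose[OF this scale]
  have "continuous_map T T (\<lambda>x. - x)" by (simp add: o_def)
  then have "continuous_map T T (\<lambda>x. inv\<^bsub>additive_group T\<^esub> x)"
    by (rule continuous_map_eq) (simp add: inv)
  then show ?thesis
    using cg add by (simp add: abelian_topological_group_def additive_group_def)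
qed

lemma locally_convex_space_subtopology:
  assumes E: "locally_convex_space E" and W: "subspace W" "W \<subseteq> topspace E"
  shows "locally_convex_space (subtopology E W)"
proof -
  have add: "continuous_map (prod_topology E E) E (\<lambda>(x, y). x + y)"
    and scale: "continuous_map (prod_topology euclideanreal E) E (\<lambda>(c, x). c *\<^sub>R x)"
    and base: "neighbourhood_base_at 0 convex E"
    using E unfolding locally_convex_space_def by auto
  have ts: "topspace (subtopology E W) = W" using W(2) by (simp add: Int_absorb1)
  have "continuous_map (subtopology (prod_topology E E) (W \<times> W)) (subtopology E W) (\<lambda>(x, y). x + y)"
    using continuous_map_from_subtopology[OF add] W(1)
    by (auto simp: continuous_map_in_subtopology subspace_add)
  moreover have "continuous_map (subtopology (prod_topology euclideanreal E) (UNIV \<times> W))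
      (subtopology E W) (\<lambda>(c, x). c *\<^sub>R x)"
    using continuous_map_from_subtopology[OF scale] W(1)
    by (auto simp: continuous_map_in_subtopology subspace_scale)
  moreover have "neighbourhood_base_at 0 convex (subtopology E W)"
    unfolding neighbourhood_base_at_def
  proof (intro allI impI)
    fix S assume "openin (subtopology E W) S \<and> 0 \<in> S"
    then obtain S' where S': "openin E S'" "S = S' \<inter> W" "0 \<in> S'"
      by (auto simp: openin_subtopology)
    then obtain U V where UV: "openin E U" "convex V" "0 \<in> U" "U \<subseteq> V" "V \<subseteq> S'"
      using base unfolding neighbourhood_base_at_def by metis
    have "openin (subtopology E W) (U \<inter> W)"
      using UV(1) by (auto simp: openin_subtopology)
    moreover have "convex (V \<inter> W)"
      using UV(2) W(1) by (simp add: convex_Int subspace_imp_convex)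
    moreover have "0 \<in> U \<inter> W" "U \<inter> W \<subseteq> V \<inter> W" "V \<inter> W \<subseteq> S"
      using UV S' subspace_0[OF W(1)] by auto
    ultimately show "\<exists>U V. openin (subtopology E W) U \<and> convex V \<and> 0 \<in> U \<and> U \<subseteq> V \<and> V \<subseteq> S"
      by blast
  qed
  moreover have "Hausdorff_space (subtopology E W)"
    using E by (simp add: locally_convex_space_def Hausdorff_space_subtopology)
  moreover have "subtopology (prod_topology E E) (W \<times> W) =
      prod_topology (subtopology E W) (subtopology E W)"
    by (rule subtopology_Times)
  moreover have "subtopology (prod_topology euclideanreal E) (UNIV \<times> W) =
      prod_topology euclideanreal (subtopology E W)"
    by (simp only: subtopology_Times subtopology_UNIV)
  ultimately show ?thesis
    unfolding locally_convex_space_def ts using W(1) by simp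
qed

lemma locally_convex_space_transport:
  fixes s :: "'e::real_vector \<Rightarrow> 'w::real_vector"
  assumes E: "locally_convex_space E" and s: "linear s" "inj_on s (topspace E)"
  obtains E' where "locally_convex_space E'" "topspace E' = s ` topspace E"
    "continuous_map E E' s" "continuous_map E' E (inv_into (topspace E) s)"
proof -
  let ?W = "topspace E"
  define r where "r = inv_into ?W s"
  define E' where "E' = pullback_topology (s ` ?W) r E"
  have sub: "subspace ?W"
    and add: "continuous_map (prod_topology E E) E (\<lambda>(x, y). x + y)"
    and scale: "continuous_map (prod_topology euclideanreal E) E (\<lambda>(c, x). c *\<^sub>R x)"
    and haus: "Hausdorff_space E"
    and base: "neighbourhood_base_at 0 convex E"
    using E unfolding locally_convex_space_def by auto
  have rs: "r (s x) = x" if "x \<in> ?W" for x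
    using that s(2) by (simp add: r_def)
  have ts: "topspace E' = s ` ?W"
    by (auto simp: E'_def topspace_pullback_topology rs)
  have cs: "continuous_map E E' s"
    unfolding E'_def
  proof (rule continuous_map_pullback')
    show "continuous_map E E (r \<circ> s)"
      by (rule continuous_map_eq[OF continuous_map_id]) (simp add: rs)
    show "topspace E \<subseteq> s -` s ` topspace E" by auto
  qed
  have cr: "continuous_map E' E r"
    using continuous_map_pullback[OF continuous_map_id, of "s ` ?W" r E] by (simp add: E'_def)
  have hm: "homeomorphic_maps E E' s r"
    unfolding homeomorphic_maps_def using cs cr rs ts by auto
  have ssub: "subspace (topspace E')"
    unfolding ts using s(1) sub by (rule linear_subspace_image)
  have "continuous_map (prod_topology E' E') E' (s \<circ> (\<lambda>(x, y). x + y) \<circ> (\<lambda>(x, y). (r x, r y)))"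
    using cr by (intro continuous_map_compose[OF _ continuous_map_compose[OF add cs]])
      (auto simp: continuous_map_prod_top case_prod_unfold continuous_map_pairwise o_def
        intro: continuous_map_compose[OF continuous_map_fst cr, unfolded o_def]
          continuous_map_compose[OF continuous_map_snd cr, unfolded o_def])
  then have add': "continuous_map (prod_topology E' E') E' (\<lambda>(x, y). x + y)"
    by (rule continuous_map_eq) (auto simp: ts rs linear_add[OF s(1)])
  have "continuous_map (prod_topology euclideanreal E') E'
      (s \<circ> (\<lambda>(c, x). c *\<^sub>R x) \<circ> (\<lambda>(c, x). (c, r x)))"
    by (intro continuous_map_compose[OF _ continuous_map_compose[OF scale cs]])
      (auto simp: case_prod_unfold continuous_map_pairwise o_def continuous_map_fst
        intro: continuous_map_compose[OF continuous_map_snd cr, unfolded o_def])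
  then have scale': "continuous_map (prod_topology euclideanreal E') E' (\<lambda>(c, x). c *\<^sub>R x)"
    by (rule continuous_map_eq) (auto simp: ts rs linear_scale[OF s(1)])
  have base': "neighbourhood_base_at 0 convex E'"
    unfolding neighbourhood_base_at_def
  proof (intro allI impI)
    fix S assume S: "openin E' S \<and> 0 \<in> S"
    then obtain S' where S': "openin E S'" "S = r -` S' \<inter> s ` ?W"
      by (auto simp: E'_def openin_pullback_topology)
    have "r 0 = 0" using rs[OF subspace_0[OF sub]] linear_0[OF s(1)] by simp
    then have "0 \<in> S'" using S S'(2) by auto
    then obtain U V where UV: "openin E U" "convex V" "0 \<in> U" "U \<subseteq> V" "V \<subseteq> S'"
      using base S'(1) unfolding neighbourhood_base_at_def by metis
    have "openin E' (r -` U \<inter> s ` ?W)"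
      using UV(1) by (auto simp: E'_def openin_pullback_topology)
    moreover have "convex (s ` (V \<inter> ?W))"
      using UV(2) sub s(1) by (simp add: convex_linear_image convex_Int subspace_imp_convex)
    moreover have "0 \<in> r -` U \<inter> s ` ?W"
      using S S'(2) \<open>r 0 = 0\<close> UV(3) by auto
    moreover have "r -` U \<inter> s ` ?W \<subseteq> s ` (V \<inter> ?W)" "s ` (V \<inter> ?W) \<subseteq> S"
      using UV S' by (auto simp: rs)
    ultimately show "\<exists>U V. openin E' U \<and> convex V \<and> 0 \<in> U \<and> U \<subseteq> V \<and> V \<subseteq> S"
      by blast
  qed
  have "Hausdorff_space E'"
    using haus hm homeomorphic_Hausdorff_space homeomorphic_space_def by blast
  then have "locally_convex_space E'"
    using ssub add' scale' base' by (simp add: locally_convex_space_def)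
  then show thesis using that ts cs cr by (simp add: r_def)
qed

lemma linear_inj_into_poly_mapping:
  fixes B :: "'e::real_vector set" and c :: "'e \<Rightarrow> 'a"
  assumes B: "independent B" and c: "inj_on c B"
  obtains s :: "'e \<Rightarrow> ('a \<Rightarrow>\<^sub>0 real)" where "linear s" "inj_on s (span B)"
proof -
  define s :: "'e \<Rightarrow> ('a \<Rightarrow>\<^sub>0 real)" where "s = construct B (\<lambda>b. Poly_Mapping.single (c b) 1)"
  have lin: "linear s" unfolding s_def by (rule linear_construct[OF B])
  have scale: "Poly_Mapping.lookup (a *\<^sub>R p) k = a * Poly_Mapping.lookup p k"
    for a k and p :: "'a \<Rightarrow>\<^sub>0 real"
  proof -
    have "finite {i. a * Poly_Mapping.lookup p i \<noteq> 0}"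
      by (rule finite_subset[OF _ finite_lookup[of p]]) auto
    then show ?thesis by (simp add: scaleR_poly_mapping_def)
  qed
  have lk: "x \<in> span B \<and> Poly_Mapping.lookup (s x) (c b) = representation B x b"
    if x: "x \<in> span B" and b: "b \<in> B" for x b
    using x
  proof (induction rule: span_induct_alt)
    case base
    show ?case by (simp add: linear_0[OF lin] representation_zero span_zero)
  next
    case (step a y z)
    have "s y = Poly_Mapping.single (c y) 1"
      unfolding s_def using B step(1) by (rule construct_basis)
    then have "Poly_Mapping.lookup (s y) (c b) = (if y = b then 1 else 0)"
      using c step(1) b by (auto simp: lookup_single when_def inj_on_def)
    moreover have "representation B (a *\<^sub>R y + z) b =
        a * (if y = b then 1 else 0) + representation B z b"
      using B step
      by (subst representation_add)
        (auto simp: span_base span_scale representation_scale representation_basis)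
    ultimately show ?case using step
      by (simp add: linear_add[OF lin] linear_scale[OF lin] lookup_add scale
          span_add span_base span_scale)
  qed
  have "inj_on s (span B)"
  proof (rule inj_onI)
    fix x y assume xy: "x \<in> span B" "y \<in> span B" "s x = s y"
    have "representation B x = representation B y"
    proof
      fix b show "representation B x b = representation B y b"
        using lk[OF xy(1), of b] lk[OF xy(2), of b] xy(3)
        by (metis representation_ne_zero)
    qed
    then show "x = y"
      using representation_eqI B xy sum_nonzero_representation_eq by metis
  qed
  then show thesis using that lin by blast
qed

lemma linear_on_set_0:
  assumes "linear_on_set S g" "0 \<in> S"
  shows "g 0 = 0"
  using assms unfolding linear_on_set_def by (metis scale_zero_left)

theorem free_lcs_universal_property:
  fixes X :: "'a topology" and L :: "'v::real_vector topology"
  assumes "free_lcs X L i"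
  shows "lcs_universal_property TYPE('e::real_vector) X L i"
proof -
  have L: "locally_convex_space L" and i: "continuous_map X L i"
    and univ1: "lcs_universal_property TYPE('v) X L i"
    and univ2: "lcs_universal_property TYPE('a \<Rightarrow>\<^sub>0 real) X L i"
    using assms unfolding free_lcs_def by auto
  have Lsub: "subspace (topspace L)" using L by (simp add: locally_convex_space_def)
  show ?thesis
    unfolding lcs_universal_property_def
  proof (intro allI impI ex_ex1I)
    fix E :: "'e topology" and f
    assume Ef: "locally_convex_space E \<and> continuous_map X E f"
    then have Esub: "subspace (topspace E)" by (simp add: locally_convex_space_def)
    have fE: "f ` topspace X \<subseteq> topspace E"
      using Ef continuous_map_image_subset_topspace by blast
    obtain B where B: "B \<subseteq> f ` topspace X" "independent B" "f ` topspace X \<subseteq> span B"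
      using maximal_independent_subset by blast
    let ?W = "span B"
    have WE: "?W \<subseteq> topspace E" using B(1) fE Esub by (meson order_trans span_minimal)
    have "inj_on (inv_into (topspace X) f) B"
      by (rule inj_on_inv_into[OF B(1)])
    then obtain s :: "'e \<Rightarrow> ('a \<Rightarrow>\<^sub>0 real)" where s: "linear s" "inj_on s ?W"
      using linear_inj_into_poly_mapping[OF B(2)] by blast
    let ?EW = "subtopology E ?W"
    have tW: "topspace ?EW = ?W" using WE by (simp add: Int_absorb1)
    have EW: "locally_convex_space ?EW"
      using Ef WE by (intro locally_convex_space_subtopology) auto
    obtain E' where E': "locally_convex_space E'" "topspace E' = s ` ?W"
      "continuous_map ?EW E' s" "continuous_map E' ?EW (inv_into ?W s)"
      by (rule locally_convex_space_transport[OF EW s(1), unfolded tW, OF s(2)])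
    have fW: "continuous_map X ?EW f"
      using Ef B(3) by (auto simp: continuous_map_in_subtopology)
    have "continuous_map X E' (s \<circ> f)"
      using fW E'(3) by (rule continuous_map_compose)
    then obtain g where g: "continuous_map L E' g" "linear_on_set (topspace L) g"
      "\<forall>x\<in>topspace X. g (i x) = s (f x)"
      using univ2 E'(1) unfolding lcs_universal_property_def continuous_linear_maps_def
      by (metis (no_types, lifting) comp_apply mem_Collect_eq)
    define h where "h = restrict (inv_into ?W s \<circ> g) (topspace L)"
    have gW: "g y \<in> s ` ?W" if "y \<in> topspace L" for y
      using g(1) E'(2) that continuous_map_image_subset_topspace by blast
    have sh: "h y \<in> ?W" "s (h y) = g y" if "y \<in> topspace L" for y
      using gW[OF that] that by (auto simp: h_def inv_into_into f_inv_into_f)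
    have "linear_on_set (topspace L) h"
      unfolding linear_on_set_def
    proof (intro conjI ballI allI)
      fix x y assume xy: "x \<in> topspace L" "y \<in> topspace L"
      then have "x + y \<in> topspace L" by (simp add: Lsub subspace_add)
      then have "s (h (x + y)) = s (h x + h y)"
        using xy g(2) by (simp add: sh linear_add[OF s(1)] linear_on_set_def)
      then show "h (x + y) = h x + h y"
        using s(2) sh(1) xy \<open>x + y \<in> topspace L\<close> by (meson inj_onD span_add)
    next
      fix k :: real and x assume x: "x \<in> topspace L"
      then have "k *\<^sub>R x \<in> topspace L" by (simp add: Lsub subspace_scale)
      then have "s (h (k *\<^sub>R x)) = s (k *\<^sub>R h x)"
        using x g(2) by (simp add: sh linear_scale[OF s(1)] linear_on_set_def)
      then show "h (k *\<^sub>R x) = k *\<^sub>R h x"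
        using s(2) sh(1) x \<open>k *\<^sub>R x \<in> topspace L\<close> by (meson inj_onD span_scale)
    qed
    moreover have "continuous_map L E h"
    proof -
      have "continuous_map L ?EW (inv_into ?W s \<circ> g)"
        using g(1) E'(4) by (rule continuous_map_compose)
      then have "continuous_map L E (inv_into ?W s \<circ> g)"
        by (simp add: continuous_map_in_subtopology)
      then show ?thesis by (rule continuous_map_eq) (simp add: h_def)
    qed
    moreover have "h (i x) = f x" if x: "x \<in> topspace X" for x
    proof -
      have "i x \<in> topspace L" using i x continuous_map_image_subset_topspace by blast
      then show ?thesis using x g(3) B(3) s(2) by (auto simp: h_def inv_into_f_f)
    qed
    moreover have "h \<in> extensional (topspace L)" by (simp add: h_def)
    ultimately show "\<exists>g. g \<in> continuous_linear_maps L E \<and> (\<forall>x\<in>topspace X. g (i x) = f x)"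
      unfolding continuous_linear_maps_def by blast
  next
    fix E :: "'e topology" and f g1 g2
    assume Ef: "locally_convex_space E \<and> continuous_map X E f"
      and g1: "g1 \<in> continuous_linear_maps L E \<and> (\<forall>x\<in>topspace X. g1 (i x) = f x)"
      and g2: "g2 \<in> continuous_linear_maps L E \<and> (\<forall>x\<in>topspace X. g2 (i x) = f x)"
    have Esub: "subspace (topspace E)"
      and add: "continuous_map (prod_topology E E) E (\<lambda>(x, y). x + y)"
      and scale: "continuous_map (prod_topology euclideanreal E) E (\<lambda>(c, x). c *\<^sub>R x)"
      using Ef by (auto simp: locally_convex_space_def)
    have c12: "continuous_map L E g1" "continuous_map L E g2"
      and l12: "linear_on_set (topspace L) g1" "linear_on_set (topspace L) g2"
      using g1 g2 by (auto simp: continuous_linear_maps_def)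
    define d where "d = (\<lambda>y. g1 y + (-1) *\<^sub>R g2 y)"
    have "continuous_map L (prod_topology euclideanreal E) (\<lambda>y. (-1, g2 y))"
      using c12 by (simp add: continuous_map_pairedI)
    from continuous_map_compose[OF this scale]
    have "continuous_map L E (\<lambda>y. (-1) *\<^sub>R g2 y)" by (simp add: o_def)
    then have "continuous_map L (prod_topology E E) (\<lambda>y. (g1 y, (-1) *\<^sub>R g2 y))"
      using c12(1) by (rule continuous_map_pairedI[rotated])
    from continuous_map_compose[OF this add]
    have cd: "continuous_map L E d" by (simp add: o_def d_def)
    have ld: "linear_on_set (topspace L) d"
      using l12 by (simp add: linear_on_set_def d_def algebra_simps)
    let ?D = "d ` topspace L"
    have Dsub: "subspace ?D"
      unfolding subspace_def
    proof (intro conjI ballI allI)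
      show "0 \<in> ?D"
        using linear_on_set_0[OF ld] subspace_0[OF Lsub] by (metis imageI)
      fix x y assume "x \<in> ?D" "y \<in> ?D"
      then obtain x' y' where "x' \<in> topspace L" "y' \<in> topspace L" "x = d x'" "y = d y'" by blast
      then show "x + y \<in> ?D"
        using ld Lsub unfolding linear_on_set_def by (metis imageI subspace_add)
    next
      fix k :: real and x assume "x \<in> ?D"
      then obtain x' where "x' \<in> topspace L" "x = d x'" by blast
      then show "k *\<^sub>R x \<in> ?D"
        using ld Lsub unfolding linear_on_set_def by (metis imageI subspace_scale)
    qed
    have DE: "?D \<subseteq> topspace E" using cd continuous_map_image_subset_topspace by blast
    obtain B where B: "B \<subseteq> ?D" "independent B" "?D \<subseteq> span B"
      using maximal_independent_subset by blast
    have DB: "?D = span B" using B Dsub by (metis span_minimal subset_antisym)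
    define s where "s = construct B (inv_into (topspace L) d)"
    have ls: "linear s" unfolding s_def by (rule linear_construct[OF B(2)])
    have ds: "s x \<in> topspace L \<and> d (s x) = x" if "x \<in> span B" for x
      using that
    proof (induction rule: span_induct_alt)
      case base
      show ?case
        using linear_on_set_0[OF ld] subspace_0[OF Lsub] linear_0[OF ls] by simp
    next
      case (step a y z)
      have "s y = inv_into (topspace L) d y"
        unfolding s_def using B(2) step(1) by (rule construct_basis)
      then have sy: "s y \<in> topspace L" "d (s y) = y"
        using B(1) step(1) by (auto simp: inv_into_into f_inv_into_f)
      have "a *\<^sub>R s y \<in> topspace L" using sy(1) by (simp add: Lsub subspace_scale)
      then show ?case
        using sy step ld Lsub unfolding linear_on_set_def
        by (simp add: linear_add[OF ls] linear_scale[OF ls] subspace_add)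
    qed
    have inj: "inj_on s ?D" unfolding DB using ds by (metis inj_onI)
    let ?ED = "subtopology E ?D"
    have tD: "topspace ?ED = ?D" using DE by (simp add: Int_absorb1)
    have ED: "locally_convex_space ?ED"
      using Ef Dsub DE by (intro locally_convex_space_subtopology) auto
    obtain E' where E': "locally_convex_space E'" "topspace E' = s ` ?D" "continuous_map ?ED E' s"
      by (rule locally_convex_space_transport[OF ED ls, unfolded tD, OF inj])
    have "continuous_map L ?ED d" using cd by (auto simp: continuous_map_in_subtopology)
    then have csd: "continuous_map L E' (s \<circ> d)"
      using E'(3) by (rule continuous_map_compose)
    have z: "0 \<in> topspace E'" using E'(1) by (simp add: locally_convex_space_def subspace_0)
    have p1: "restrict (s \<circ> d) (topspace L) \<in> continuous_linear_maps L E'"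
    proof -
      have "continuous_map L E' (restrict (s \<circ> d) (topspace L))"
        using csd by (rule continuous_map_eq) simp
      moreover have "linear_on_set (topspace L) (restrict (s \<circ> d) (topspace L))"
        using ld Lsub unfolding linear_on_set_def
        by (simp add: subspace_add subspace_scale linear_add[OF ls] linear_scale[OF ls])
      ultimately show ?thesis by (simp add: continuous_linear_maps_def)
    qed
    have p2: "restrict (\<lambda>_. 0) (topspace L) \<in> continuous_linear_maps L E'"
    proof -
      have "continuous_map L E' (\<lambda>_. 0)" using z by simp
      then have "continuous_map L E' (restrict (\<lambda>_. 0) (topspace L))"
        by (rule continuous_map_eq) simp
      then show ?thesis
        using Lsub by (simp add: continuous_linear_maps_def linear_on_set_def subspace_add subspace_scale)
    qed
    have iL: "i x \<in> topspace L" if "x \<in> topspace X" for x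
      using i that continuous_map_image_subset_topspace by blast
    have q1: "\<forall>x\<in>topspace X. restrict (s \<circ> d) (topspace L) (i x) = 0"
      using g1 g2 by (simp add: iL d_def linear_0[OF ls])
    have q2: "\<forall>x\<in>topspace X. restrict (\<lambda>_. 0) (topspace L) (i x) = 0"
      by (simp add: iL)
    have "continuous_map X E' (\<lambda>_. 0)" using z by simp
    then have "restrict (s \<circ> d) (topspace L) = restrict (\<lambda>_. 0) (topspace L)"
      using univ1 E'(1) p1 p2 q1 q2 unfolding lcs_universal_property_def by blast
    then have "s (d y) = 0" if "y \<in> topspace L" for y
      using that by (metis comp_apply restrict_apply')
    then have "d y = 0" if "y \<in> topspace L" for y
      using that inj linear_0[OF ls] subspace_0[OF Dsub] by (metis imageI inj_onD)
    then have "g1 y = g2 y" if "y \<in> topspace L" for y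
      using that by (simp add: d_def)
    then show "g1 = g2"
      using g1 g2 by (auto simp: continuous_linear_maps_def intro: extensionalityI)
  qed
qed

end

theory Submission
  imports Defs
begin

text \<open>A character of a real topological vector space is \<open>exp (i l)\<close> for a unique continuous linear
  functional \<open>l\<close>, so the dual group of \<open>L(X)\<close> is \<open>C(X)\<close>, carrying the topology of uniform convergence
  on the compact subsets of \<open>L(X)\<close>.

  Let \<open>L(X)\<close> be reflexive. A gliding hump argument shows that a locally finite sequence of open sets meets
  the support of a compact \<open>A \<subseteq> L(X)\<close> only finitely often; hence that support is totally bounded in the
  universal uniformity and, by completeness, has compact closure \<open>K\<close>. If \<open>K\<close> contained distinct
  points \<open>x\<^sub>n\<close>, then \<open>f \<mapsto> \<Sum>\<^sub>n 2\<^sup>-\<^sup>n f(x\<^sub>n)\<close> would give a character of the dual that is not evaluation at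
  an element of \<open>L(X)\<close>. So compact sets have finite support, the dual is \<open>C(X)\<close> with pointwise
  convergence, and every point-finite family of functions together with \<open>0\<close> is compact in it; continuity
  of the canonical homomorphism makes such a family equicontinuous. Dyadic bumps of a function
  \<open>f\<close> with \<open>f(x) = 0\<close> show that \<open>f\<close> vanishes near \<open>x\<close>, and the indicators of a maximal disjoint family
  of clopen sets missing \<open>x\<close> then show that \<open>x\<close> is isolated.

  If \<open>X\<close> is discrete, then \<open>L(X)\<close> carries the finest locally convex topology on \<open>\<real>\<^sup>(\<^sup>X\<^sup>)\<close>, its compact sets
  have finite support, and the dual is the product \<open>\<real>\<^sup>X\<close>, whose dual is \<open>\<real>\<^sup>(\<^sup>X\<^sup>)\<close> again.\<close>

section \<open>Characters of the real line\<close>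

text \<open>A point of the circle determines a real number only modulo \<open>2 * pi\<close>, so
  closeness of two characters at single vectors does not bound the difference of their lifts. Lifts
  are therefore compared along whole segments from 0 or at all real multiples; compact sets enlarged
  by the factors in \<open>[0,1]\<close> and convex neighbourhoods of 0 provide the segments.

  The dyadic bumps are tents over \<open>2^k f\<close>: every value of \<open>f\<close> in
  \<open>(0,1]\<close> is caught at height at least 1/2 by some scale, yet only finitely many scales
  see it. This turns cozero sets into clopen sets, and that supply of clopen sets is what makes the
  maximality of a disjoint clopen family effective.

  In the discrete case continuity and openness rest on one polarity: compact subsets of the product
  lie in boxes \<open>|f x| <= m x\<close>, and the polar of such a box is the unit ball of the
  weighted norm \<open>\<Sum> m x |c x|\<close>, a basic neighbourhood of 0 in the free
  topology.\<close>

lemma norm_cis_minus_1: "norm (cis t - 1) = 2 * \<bar>sin (t / 2)\<bar>"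
  using dist_exp_i_1[of t] by (simp add: cis_conv_exp)

lemma norm_cis_minus_1_le: "norm (cis t - 1) \<le> \<bar>t\<bar>"
  using abs_sin_x_le_abs_x[of "t / 2"] by (simp add: norm_cis_minus_1)

lemma norm_cis_diff: "norm (cis s - cis t) = norm (cis (s - t) - 1)"
proof -
  have "cis s - cis t = cis t * (cis (s - t) - 1)"
    by (simp add: cis_mult right_diff_distrib)
  then show ?thesis by (simp add: norm_mult)
qed

lemma norm_cis_minus_1_pos:
  assumes "0 < e" "e < 2 * pi"
  shows "0 < norm (cis e - 1)"
  using assms sin_gt_zero[of "e / 2"] by (simp add: norm_cis_minus_1)

text \<open>A single value of \<open>cis\<close> determines \<open>a\<close> only modulo \<open>2 pi\<close>; control along the whole arc removes the ambiguity.\<close>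

lemma abs_less_if_cis_arc_near_1:
  assumes e: "0 < e"
    and near: "\<And>t. 0 \<le> t \<Longrightarrow> t \<le> 1 \<Longrightarrow> norm (cis (t * a) - 1) < norm (cis e - 1)"
  shows "\<bar>a\<bar> < e"
proof (rule ccontr)
  assume "\<not> \<bar>a\<bar> < e"
  then have a: "e \<le> \<bar>a\<bar>" by simp
  have "norm (cis (e / \<bar>a\<bar> * a) - 1) = norm (cis e - 1)"
    using a e by (cases "a \<ge> 0") (auto simp: norm_cis_minus_1)
  moreover have "e / \<bar>a\<bar> \<le> 1" using a e by simp
  ultimately show False using near[of "e / \<bar>a\<bar>"] a e by simp
qed

text \<open>Real lifts are identified through this: \<open>cis\<close> at one scale leaves a
  multiple of \<open>2 * pi\<close> open, but agreement at all scales \<open>t\<close> lets the arc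
  criterion be applied to \<open>a - b\<close>.\<close>

lemma cis_scale_inject:
  assumes "\<And>t::real. cis (t * a) = cis (t * b)"
  shows "a = b"
proof (rule ccontr)
  assume ne: "a \<noteq> b"
  \<comment> \<open>The cap at 1 keeps \<open>e\<close> below \<open>2 * pi\<close>, where the chord
    \<open>norm (cis e - 1)\<close> is positive; \<open>e \<le> |a - b|\<close> makes the resulting
    strict bound absurd.\<close>
  define e where "e = min 1 \<bar>a - b\<bar>"
  have e: "0 < e" "e < 2 * pi" using ne pi_gt3 by (auto simp: e_def min_def)
  have "\<bar>a - b\<bar> < e"
  proof (rule abs_less_if_cis_arc_near_1[OF e(1)])
    fix t :: real
    have "norm (cis (t * (a - b)) - 1) = norm (cis (t * a) - cis (t * b))"
      by (subst norm_cis_diff) (simp add: right_diff_distrib)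
    then show "norm (cis (t * (a - b)) - 1) < norm (cis e - 1)"
      using assms norm_cis_minus_1_pos[OF e] by simp
  qed
  then show False by (simp add: e_def)
qed

lemma additive_continuous_real:
  fixes g :: "real \<Rightarrow> real"
  assumes add: "\<And>s t. g (s + t) = g s + g t" and cont: "continuous_on UNIV g"
  shows "g t = t * g 1"
proof -
  have g0: "g 0 = 0" using add[of 0 0] by simp
  have gn: "g (of_nat n * x) = of_nat n * g x" for n x
    by (induction n) (auto simp: g0 add distrib_right)
  have gm: "g (- x) = - g x" for x using add[of x "- x"] g0 by simp
  have gz: "g (of_int z * x) = of_int z * g x" for z x
  proof (cases "z \<ge> 0")
    case True then show ?thesis using gn[of "nat z" x] by simp
  next
    case False
    then show ?thesis using gn[of "nat (- z)" x] gm[of "of_int (- z) * x"] by simp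
  qed
  have gq: "g q = q * g 1" if "q \<in> \<rat>" for q
  proof -
    from that obtain a b where ab: "b > 0" "q = of_int a / of_int b"
      by (metis Rats_cases')
    have "of_int b * g q = of_int a * g 1"
      using gz[of b q] gz[of a 1] ab by simp
    then have "g q = of_int a / of_int b * g 1" using ab(1) by (simp add: field_simps)
    then show ?thesis using ab(2) by simp
  qed
  have "closed {t. g t = t * g 1}"
    using cont by (intro closed_Collect_eq continuous_intros)
  moreover have "\<rat> \<subseteq> {t. g t = t * g 1}" using gq by blast
  ultimately have "closure \<rat> \<subseteq> {t. g t = t * g 1}" by (rule closure_minimal[rotated])
  then show ?thesis by (auto simp: Rats_closure_real)
qed

text \<open>A continuous argument \<open>k\<close> of \<open>h\<close> exists because the line is
  contractible. For fixed \<open>t\<close> the increment \<open>k (s + t) - k s\<close> is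
  continuous in \<open>s\<close> and fixed modulo \<open>2 * pi\<close> by \<open>h t\<close>, hence
  constant, so \<open>k - k 0\<close> solves Cauchy's functional equation.\<close>

lemma continuous_hom_real_circle:
  fixes h :: "real \<Rightarrow> complex"
  assumes cont: "continuous_on UNIV h" and hom: "\<And>s t. h (s + t) = h s * h t"
    and unit: "\<And>t. norm (h t) = 1"
  obtains a where "\<And>t. h t = cis (t * a)"
proof -
  obtain g where g: "continuous_on UNIV g" "\<And>x. h x = exp (g x)"
    using continuous_logarithm_on_contractible[OF cont contractible_UNIV] unit
    by (metis UNIV_I norm_zero zero_neq_one)
  define k where "k = (\<lambda>t. Im (g t))"
  have hk: "h t = cis (k t)" for t
  proof -
    have "Re (g t) = 0" using unit[of t] by (simp add: g(2))
    then show ?thesis by (simp add: g(2) k_def exp_eq_polar)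
  qed
  have ck: "continuous_on UNIV k" unfolding k_def by (intro continuous_intros g(1))
  have const: "k (s + t) - k s = k t - k 0" for s t
  proof -
    define D where "D = (\<lambda>s. k (s + t) - k s)"
    have cD: "continuous_on UNIV D"
      unfolding D_def by (intro continuous_intros continuous_on_compose2[OF ck]) auto
    have cisD: "cis (D s) = h t" for s
      using hom[of s t] by (simp add: D_def hk cis_divide[symmetric])
    have "D constant_on UNIV"
    proof (rule continuous_discrete_range_constant[OF connected_UNIV cD])
      fix x
      have "pi \<le> norm (D y - D x)" if "D y \<noteq> D x" for y
      proof -
        have "cis (D y - D x) = 1"
          by (simp add: cis_divide[symmetric] cisD) (metis norm_zero unit zero_neq_one)
        then have "norm (cis (D y - D x) - 1) = 0" by simp
        then have "sin ((D y - D x) / 2) = 0" by (simp add: norm_cis_minus_1)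
        then obtain z :: int where "(D y - D x) / 2 = of_int z * pi" using sin_zero_iff_int2 by auto
        moreover from this that have "z \<noteq> 0" by auto
        then have "\<bar>of_int z :: real\<bar> \<ge> 1" by linarith
        ultimately have "\<bar>(D y - D x) / 2\<bar> \<ge> pi"
          by (simp only: abs_mult) (simp add: mult_le_cancel_right1)
        then show ?thesis by simp
      qed
      then show "\<exists>e>0. \<forall>y. y \<in> UNIV \<and> D y \<noteq> D x \<longrightarrow> e \<le> norm (D y - D x)"
        using pi_gt_zero by blast
    qed
    then have "D s = D 0" unfolding constant_on_def by (metis UNIV_I)
    then show ?thesis by (simp add: D_def)
  qed
  define g0 where "g0 = (\<lambda>t. k t - k 0)"
  have "g0 (s + t) = g0 s + g0 t" for s t using const[of s t] by (simp add: g0_def)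
  moreover have "continuous_on UNIV g0" unfolding g0_def by (intro continuous_intros ck)
  ultimately have lin: "g0 t = t * g0 1" for t by (rule additive_continuous_real)
  have "h 0 = 1" using hom[of 0 0] unit[of 0] by (metis add_0 mult_cancel_right1 norm_zero zero_neq_one)
  then have k0: "cis (k 0) = 1" by (simp add: hk)
  have "h t = cis (t * g0 1)" for t
  proof -
    have "h t = cis (g0 t) * cis (k 0)" by (simp add: hk g0_def cis_mult)
    then show ?thesis using lin[of t] k0 by simp
  qed
  then show thesis using that by blast
qed

section \<open>The compact-open topology on the dual\<close>

lemma character_in_sphere:
  assumes "\<phi> \<in> characters G T" "x \<in> topspace T"
  shows "norm (\<phi> x) = 1"
proof -
  have "\<phi> x \<in> sphere 0 1"
    using assms continuous_map_image_subset_topspace unfolding characters_def by fastforce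
  then show ?thesis by simp
qed

text \<open>The generating sets confine the whole image of a compact set, not the value at each
  point. So \<open>K\<close> is cut into finitely many compact pieces on each of which
  \<open>\<phi>\<close> is nearly constant; confining each piece near its constant gives pointwise
  closeness.\<close>

lemma dual_topology_neighbourhood:
  assumes \<phi>: "\<phi> \<in> characters G T" and K: "compactin T K" and \<epsilon>: "0 < \<epsilon>"
  obtains W where "openin (dual_topology G T) W" "\<phi> \<in> W"
    "\<And>\<psi> x. \<psi> \<in> W \<Longrightarrow> x \<in> K \<Longrightarrow> dist (\<psi> x) (\<phi> x) < \<epsilon>"
proof -
  have KT: "K \<subseteq> topspace T" using K by (rule compactin_subset_topspace)
  have cont: "continuous_map T circle_topology \<phi>" using \<phi> by (simp add: characters_def)
  then have conte: "continuous_map T euclidean \<phi>" by (simp add: continuous_map_in_subtopology)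
  have "sphere 0 1 \<subseteq> (\<Union>z\<in>sphere 0 1. ball z (\<epsilon> / 3) :: complex set)" using \<epsilon> by auto
  then obtain Z :: "complex set" where Z: "finite Z" "sphere 0 1 \<subseteq> (\<Union>z\<in>Z. ball z (\<epsilon> / 3))"
    using compactE_image[OF compact_sphere, of "sphere 0 1" "\<lambda>z. ball z (\<epsilon> / 3)" 0 1]
    by (metis open_ball)
  define KZ where "KZ z = {x \<in> topspace T. \<phi> x \<in> cball z (\<epsilon> / 3)} \<inter> K" for z
  have KZ: "compactin T (KZ z)" for z
    unfolding KZ_def using conte K
    by (intro closed_Int_compactin closedin_continuous_map_preimage[of T euclidean]) auto
  \<comment> \<open>The radius \<open>\<epsilon> / 2\<close> exceeds the
    \<open>\<epsilon> / 3\<close> of the closed balls, so \<open>\<phi>\<close> itself qualifies,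
    and the two radii add up to less than \<open>\<epsilon>\<close>.\<close>
  define W where "W = (\<Inter>z\<in>Z. {\<psi> \<in> characters G T. \<psi> ` KZ z \<subseteq> sphere 0 1 \<inter> ball z (\<epsilon> / 2)})
    \<inter> topspace (dual_topology G T)"
  have "openin (dual_topology G T) W"
    unfolding W_def
  proof (rule openin_INT[OF Z(1)])
    fix z
    have "openin circle_topology (sphere 0 1 \<inter> ball z (\<epsilon> / 2))"
      by (rule openin_open_Int) simp
    then show "openin (dual_topology G T) {\<psi> \<in> characters G T. \<psi> ` KZ z \<subseteq> sphere 0 1 \<inter> ball z (\<epsilon> / 2)}"
      unfolding dual_topology_def using KZ[of z]
      by (intro topology_generated_by_Basis) blast
  qed
  moreover have "\<phi> \<in> W"
    unfolding W_def topspace_dual_topology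
    using \<phi> \<epsilon> character_in_sphere[OF \<phi>] by (auto simp: KZ_def)
  moreover have "dist (\<psi> x) (\<phi> x) < \<epsilon>" if "\<psi> \<in> W" "x \<in> K" for \<psi> x
  proof -
    have x: "x \<in> topspace T" using that(2) KT by blast
    have "\<phi> x \<in> sphere 0 1" using character_in_sphere[OF \<phi> x] by simp
    then obtain z where z: "z \<in> Z" "\<phi> x \<in> ball z (\<epsilon> / 3)" using Z(2) by blast
    then have "x \<in> KZ z" using that(2) x by (simp add: KZ_def)
    then have "\<psi> x \<in> ball z (\<epsilon> / 2)" using that(1) z(1) unfolding W_def by blast
    then have "dist (\<psi> x) z < \<epsilon> / 2" by (simp add: dist_commute)
    moreover have "dist z (\<phi> x) < \<epsilon> / 3" using z(2) by simp
    ultimately have "dist (\<psi> x) (\<phi> x) < \<epsilon> / 2 + \<epsilon> / 3" by (metis add_strict_mono dist_triangle le_less_trans)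
    then show ?thesis using \<epsilon> by simp
  qed
  ultimately show thesis by (rule that)
qed

text \<open>The compact-open topology on the dual is that of uniform convergence on compact sets.
  Continuity into and out of the dual is checked in this form.\<close>

lemma openin_dual_topology:
  "openin (dual_topology G T) W \<longleftrightarrow>
     W \<subseteq> characters G T \<and>
     (\<forall>\<phi>\<in>W. \<exists>K \<epsilon>. compactin T K \<and> 0 < \<epsilon> \<and>
        (\<forall>\<psi>\<in>characters G T. (\<forall>x\<in>K. dist (\<psi> x) (\<phi> x) < \<epsilon>) \<longrightarrow> \<psi> \<in> W))"
  (is "_ \<longleftrightarrow> ?P W")
proof
  assume "openin (dual_topology G T) W"
  then have "generate_topology_on {{\<phi> \<in> characters G T. \<phi> ` K \<subseteq> V} | K V.
      compactin T K \<and> openin circle_topology V} W"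
    unfolding dual_topology_def by (simp add: openin_topology_generated_by_iff)
  then show "?P W"
  proof induction
    case Empty
    show ?case by simp
  next
    case (Int A B)
    show ?case
    proof (intro conjI ballI)
      show "A \<inter> B \<subseteq> characters G T" using Int by blast
      fix \<phi> assume "\<phi> \<in> A \<inter> B"
      then have "\<phi> \<in> A" "\<phi> \<in> B" by auto
      then obtain K \<epsilon> L \<delta> where K: "compactin T K" "0 < \<epsilon>"
        "\<forall>\<psi>\<in>characters G T. (\<forall>x\<in>K. dist (\<psi> x) (\<phi> x) < \<epsilon>) \<longrightarrow> \<psi> \<in> A"
        and L: "compactin T L" "0 < \<delta>"
        "\<forall>\<psi>\<in>characters G T. (\<forall>x\<in>L. dist (\<psi> x) (\<phi> x) < \<delta>) \<longrightarrow> \<psi> \<in> B"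
        using bspec[OF conjunct2[OF Int.IH(1)]] bspec[OF conjunct2[OF Int.IH(2)]] by metis
      show "\<exists>K \<epsilon>. compactin T K \<and> 0 < \<epsilon> \<and>
        (\<forall>\<psi>\<in>characters G T. (\<forall>x\<in>K. dist (\<psi> x) (\<phi> x) < \<epsilon>) \<longrightarrow> \<psi> \<in> A \<inter> B)"
        using K L by (intro exI[of _ "K \<union> L"] exI[of _ "min \<epsilon> \<delta>"]) (auto simp: compactin_Un)
    qed
  next
    case (UN \<U>)
    show ?case
    proof (intro conjI ballI)
      show "\<Union>\<U> \<subseteq> characters G T" using UN by blast
      fix \<phi> assume "\<phi> \<in> \<Union>\<U>"
      then obtain A where "A \<in> \<U>" "\<phi> \<in> A" by blast
      then show "\<exists>K \<epsilon>. compactin T K \<and> 0 < \<epsilon> \<and>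
        (\<forall>\<psi>\<in>characters G T. (\<forall>x\<in>K. dist (\<psi> x) (\<phi> x) < \<epsilon>) \<longrightarrow> \<psi> \<in> \<Union>\<U>)"
        using UN.IH[of A] by (meson Union_iff)
    qed
  next
    case (Basis A)
    then obtain K V where A: "A = {\<phi> \<in> characters G T. \<phi> ` K \<subseteq> V}" and K: "compactin T K"
      and V: "openin circle_topology V" by blast
    obtain V' where V': "open V'" "V = sphere 0 1 \<inter> V'" using V by (auto simp: openin_open)
    show ?case
    proof (intro conjI ballI)
      show "A \<subseteq> characters G T" using A by blast
      fix \<phi> assume "\<phi> \<in> A"
      then have \<phi>: "continuous_map T euclidean \<phi>" "\<phi> ` K \<subseteq> V'"
        using A V'(2) by (auto simp: characters_def continuous_map_in_subtopology)
      have "compact (\<phi> ` K)"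
        using image_compactin[OF K \<phi>(1)] by (simp add: compactin_euclidean_iff)
      then obtain \<epsilon> where \<epsilon>: "0 < \<epsilon>" "(\<Union>x\<in>\<phi> ` K. ball x \<epsilon>) \<subseteq> V'"
        using compact_subset_open_imp_ball_epsilon_subset \<phi>(2) V'(1) by metis
      have "\<psi> \<in> A" if \<psi>: "\<psi> \<in> characters G T" "\<forall>x\<in>K. dist (\<psi> x) (\<phi> x) < \<epsilon>" for \<psi>
      proof -
        have "\<psi> x \<in> V" if "x \<in> K" for x
        proof -
          have nrm: "\<psi> x \<in> sphere 0 1"
            using character_in_sphere[OF \<psi>(1)] compactin_subset_topspace[OF K] that by auto
          have "\<psi> x \<in> ball (\<phi> x) \<epsilon>" using \<psi>(2) that by (simp add: dist_commute)
          then show ?thesis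
            using \<epsilon>(2) that V'(2) nrm by force
        qed
        then show ?thesis using A \<psi>(1) by blast
      qed
      then show "\<exists>K \<epsilon>. compactin T K \<and> 0 < \<epsilon> \<and>
        (\<forall>\<psi>\<in>characters G T. (\<forall>x\<in>K. dist (\<psi> x) (\<phi> x) < \<epsilon>) \<longrightarrow> \<psi> \<in> A)"
        using K \<epsilon>(1) by blast
    qed
  qed
next
  assume P: "?P W"
  show "openin (dual_topology G T) W"
  proof (subst openin_subopen, intro ballI)
    fix \<phi> assume "\<phi> \<in> W"
    then obtain K \<epsilon> where K: "\<phi> \<in> characters G T" "compactin T K" "0 < \<epsilon>"
      "\<And>\<psi>. \<psi> \<in> characters G T \<Longrightarrow> (\<forall>x\<in>K. dist (\<psi> x) (\<phi> x) < \<epsilon>) \<Longrightarrow> \<psi> \<in> W"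
      using P by blast
    obtain N where N: "openin (dual_topology G T) N" "\<phi> \<in> N"
      "\<And>\<psi> x. \<psi> \<in> N \<Longrightarrow> x \<in> K \<Longrightarrow> dist (\<psi> x) (\<phi> x) < \<epsilon>"
      using dual_topology_neighbourhood[OF K(1-3)] by blast
    have "N \<subseteq> W"
      using openin_subset[OF N(1)] N(3) K(4) by (force simp: topspace_dual_topology)
    then show "\<exists>N. openin (dual_topology G T) N \<and> \<phi> \<in> N \<and> N \<subseteq> W" using N by blast
  qed
qed

lemma continuous_map_into_dual_topology:
  assumes chars: "\<And>s. s \<in> topspace S \<Longrightarrow> h s \<in> characters G T"
    and near: "\<And>s K \<epsilon>. s \<in> topspace S \<Longrightarrow> compactin T K \<Longrightarrow> 0 < \<epsilon> \<Longrightarrow>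
      \<exists>N. openin S N \<and> s \<in> N \<and> (\<forall>s'\<in>N. \<forall>x\<in>K. dist (h s' x) (h s x) < \<epsilon>)"
  shows "continuous_map S (dual_topology G T) h"
  unfolding continuous_map
proof (intro conjI allI impI)
  show "h ` topspace S \<subseteq> topspace (dual_topology G T)"
    using chars by (auto simp: topspace_dual_topology)
  fix W assume W: "openin (dual_topology G T) W"
  show "openin S {s \<in> topspace S. h s \<in> W}"
  proof (subst openin_subopen, intro ballI)
    fix s assume "s \<in> {s \<in> topspace S. h s \<in> W}"
    then have s: "s \<in> topspace S" "h s \<in> W" by auto
    then obtain K \<epsilon> where K: "compactin T K" "0 < \<epsilon>"
      "\<And>\<psi>. \<psi> \<in> characters G T \<Longrightarrow> (\<forall>x\<in>K. dist (\<psi> x) (h s x) < \<epsilon>) \<Longrightarrow> \<psi> \<in> W"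
      using W unfolding openin_dual_topology by meson
    obtain N where N: "openin S N" "s \<in> N" "\<forall>s'\<in>N. \<forall>x\<in>K. dist (h s' x) (h s x) < \<epsilon>"
      using near[OF s(1) K(1,2)] by blast
    have "N \<subseteq> {s \<in> topspace S. h s \<in> W}"
      using N(3) openin_subset[OF N(1)] chars K(3) by blast
    then show "\<exists>N. openin S N \<and> s \<in> N \<and> N \<subseteq> {s \<in> topspace S. h s \<in> W}" using N by blast
  qed
qed

lemma continuous_map_from_dual_topology:
  fixes \<Phi> :: "('g \<Rightarrow> complex) \<Rightarrow> 'm::metric_space"
  assumes "\<And>\<phi> \<epsilon>. \<phi> \<in> characters G T \<Longrightarrow> 0 < \<epsilon> \<Longrightarrow>
      \<exists>K \<delta>. compactin T K \<and> 0 < \<delta> \<and>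
        (\<forall>\<psi>\<in>characters G T. (\<forall>x\<in>K. dist (\<psi> x) (\<phi> x) < \<delta>) \<longrightarrow> dist (\<Phi> \<psi>) (\<Phi> \<phi>) < \<epsilon>)"
  shows "continuous_map (dual_topology G T) euclidean \<Phi>"
  unfolding continuous_map
proof (intro conjI allI impI)
  show "\<Phi> ` topspace (dual_topology G T) \<subseteq> topspace euclidean" by simp
  fix V :: "'m set" assume "openin euclidean V"
  then have V: "open V" by simp
  show "openin (dual_topology G T) {\<phi> \<in> topspace (dual_topology G T). \<Phi> \<phi> \<in> V}"
    unfolding openin_dual_topology topspace_dual_topology
  proof (intro conjI ballI)
    fix \<phi> assume \<phi>: "\<phi> \<in> {\<phi> \<in> characters G T. \<Phi> \<phi> \<in> V}"
    then obtain \<epsilon> where \<epsilon>: "0 < \<epsilon>" "\<forall>y. dist y (\<Phi> \<phi>) < \<epsilon> \<longrightarrow> y \<in> V"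
      using V unfolding open_dist by blast
    with assms[of \<phi> \<epsilon>] \<phi> obtain K \<delta> where "compactin T K" "0 < \<delta>"
      "\<forall>\<psi>\<in>characters G T. (\<forall>x\<in>K. dist (\<psi> x) (\<phi> x) < \<delta>) \<longrightarrow> dist (\<Phi> \<psi>) (\<Phi> \<phi>) < \<epsilon>"
      by auto
    then show "\<exists>K \<epsilon>. compactin T K \<and> 0 < \<epsilon> \<and> (\<forall>\<psi>\<in>characters G T.
        (\<forall>x\<in>K. dist (\<psi> x) (\<phi> x) < \<epsilon>) \<longrightarrow> \<psi> \<in> {\<phi> \<in> characters G T. \<Phi> \<phi> \<in> V})"
      using \<epsilon>(2) by (intro exI[of _ K] exI[of _ \<delta>]) auto
  qed auto
qed

section \<open>Complete uniformities\<close>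

text \<open>Zorn's lemma, with the order reversed, gives a minimal proper filter \<open>G\<close>
  below \<open>F\<close>. If \<open>\<not> P\<close> is not eventual in \<open>G\<close>, then
  \<open>G\<close> restricted to \<open>P\<close> is still proper, hence equal to \<open>G\<close>
  by minimality.\<close>

lemma ultrafilter_exists:
  assumes "F \<noteq> bot"
  obtains G where "G \<le> F" "G \<noteq> bot" "\<And>P. eventually P G \<or> eventually (\<lambda>x. \<not> P x) G"
proof -
  define A where "A = {G. G \<le> F \<and> G \<noteq> bot}"
  have "\<exists>m\<in>A. \<forall>G\<in>A. G \<le> m \<longrightarrow> G = m"
  proof (rule predicate_Zorn)
    show "partial_order_on A (relation_of (\<lambda>G H. H \<le> G) A)"
      by (rule partial_order_on_relation_ofI) auto
  next
    fix C assume C: "C \<in> Chains (relation_of (\<lambda>G H. H \<le> G) A)"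
    then have CA: "C \<subseteq> A" unfolding Chains_def relation_of_def by blast
    have lin: "G \<le> H \<or> H \<le> G" if "G \<in> C" "H \<in> C" for G H
      using C that unfolding Chains_def relation_of_def by blast
    show "\<exists>u\<in>A. \<forall>a\<in>C. u \<le> a"
    proof (cases "C = {}")
      case True
      then show ?thesis using assms by (auto simp: A_def)
    next
      case False
      have base: "\<exists>x\<in>C. x \<le> inf G H" if "G \<in> C" "H \<in> C" for G H
        using lin[OF that] that by (metis inf.absorb1 inf.absorb2 order_refl)
      have "\<not> eventually (\<lambda>_. False) (Inf C)"
        using eventually_Inf_base[OF False base] CA by (auto simp: A_def trivial_limit_def)
      then have "Inf C \<noteq> bot" by (simp add: trivial_limit_def)
      moreover have "Inf C \<le> F" using False CA by (auto simp: A_def intro: Inf_lower2)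
      ultimately show ?thesis by (intro bexI[of _ "Inf C"]) (auto simp: A_def Inf_lower)
    qed
  qed
  then obtain G where G: "G \<le> F" "G \<noteq> bot" "\<And>H. H \<le> F \<Longrightarrow> H \<noteq> bot \<Longrightarrow> H \<le> G \<Longrightarrow> H = G"
    by (auto simp: A_def)
  have "eventually P G" if "\<not> eventually (\<lambda>x. \<not> P x) G" for P
  proof -
    have "inf G (principal {x. P x}) \<noteq> bot"
      using that by (auto simp: trivial_limit_def eventually_inf_principal)
    then have "inf G (principal {x. P x}) = G"
      using G(1) by (intro G(3)) (auto intro: le_infI1)
    moreover have "eventually P (inf G (principal {x. P x}))"
      by (simp add: eventually_inf_principal)
    ultimately show ?thesis by simp
  qed
  then show thesis using that G by blast
qed

lemma is_uniformity_onD: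
  assumes "is_uniformity_on S U"
  shows "eventually (\<lambda>p. p \<in> S \<times> S) U"
    and "eventually E U \<Longrightarrow> x \<in> S \<Longrightarrow> E (x, x)"
    and "eventually E U \<Longrightarrow> eventually (\<lambda>(x, y). E (y, x)) U"
    and "eventually E U \<Longrightarrow>
      \<exists>D. eventually D U \<and> (\<forall>x y z. D (x, y) \<longrightarrow> D (y, z) \<longrightarrow> E (x, z))"
proof -
  note U = assms[unfolded is_uniformity_on_def le_principal]
  show "eventually (\<lambda>p. p \<in> S \<times> S) U" by (rule conjunct1[OF U])
  show "E (x, x)" if "eventually E U" "x \<in> S"
    using conjunct1[OF conjunct2[OF U]] that by blast
  show "eventually (\<lambda>(x, y). E (y, x)) U" if "eventually E U"
    using conjunct1[OF conjunct2[OF conjunct2[OF U]]] that by blast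
  show "\<exists>D. eventually D U \<and> (\<forall>x y z. D (x, y) \<longrightarrow> D (y, z) \<longrightarrow> E (x, z))" if "eventually E U"
    using conjunct2[OF conjunct2[OF conjunct2[OF U]]] that by blast
qed

text \<open>Sections of an entourage need not be open. The points for which some entourage has its
  section inside that of \<open>E\<close> at \<open>x\<close> form an open set: halving that
  entourage shows that nearby points inherit the property.\<close>

lemma uniformity_neighbourhood:
  assumes U: "is_uniformity_on S U" and E: "eventually E U" and x: "x \<in> S"
  shows "x \<in> topology_of_uniformity S U interior_of {y \<in> S. E (x, y)}"
proof -
  define W where "W = {y \<in> S. \<exists>D. eventually D U \<and> (\<forall>z. D (y, z) \<longrightarrow> E (x, z))}"
  have "openin (topology_of_uniformity S U) W"
    unfolding openin_topology_of_uniformity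
  proof (intro conjI ballI)
    show "W \<subseteq> S" by (auto simp: W_def)
    fix y assume "y \<in> W"
    then obtain D where D: "eventually D U" "\<And>z. D (y, z) \<Longrightarrow> E (x, z)" by (auto simp: W_def)
    obtain D' where D': "eventually D' U" "\<And>a b c. D' (a, b) \<Longrightarrow> D' (b, c) \<Longrightarrow> D (a, c)"
      using is_uniformity_onD(4)[OF U D(1)] by blast
    have "eventually (\<lambda>p. p \<in> S \<times> S) U"
      by (rule is_uniformity_onD(1)[OF U])
    then show "eventually (\<lambda>(x', z). x' = y \<longrightarrow> z \<in> W) U"
      using D'(1)
    proof eventually_elim
      case (elim p)
      then show ?case
        using D' D(2) by (cases p) (auto simp: W_def)
    qed
  qed
  moreover have "x \<in> W" using x E by (auto simp: W_def)
  moreover have "W \<subseteq> {y \<in> S. E (x, y)}" using is_uniformity_onD(2)[OF U] by (auto simp: W_def)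
  ultimately show ?thesis unfolding interior_of_def by blast
qed

lemma topspace_topology_of_uniformity:
  assumes "is_uniformity_on S U"
  shows "topspace (topology_of_uniformity S U) = S"
proof -
  have "eventually (\<lambda>p. p \<in> S \<times> S) U"
    by (rule is_uniformity_onD(1)[OF assms])
  then have "eventually (\<lambda>(x', y). x' = x \<longrightarrow> y \<in> S) U" for x
    by (rule eventually_mono) auto
  then have "openin (topology_of_uniformity S U) S"
    by (simp add: openin_topology_of_uniformity)
  moreover have "topspace (topology_of_uniformity S U) \<subseteq> S"
    using openin_topspace[of "topology_of_uniformity S U"] unfolding openin_topology_of_uniformity by blast
  ultimately show ?thesis by (meson openin_subset subset_antisym)
qed

lemma uniformity_symmetric_half:
  assumes "is_uniformity_on S U" "eventually E U"
  obtains D where "eventually D U" "\<And>x y. D (x, y) \<Longrightarrow> D (y, x)"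
    "\<And>x y z. D (x, y) \<Longrightarrow> D (y, z) \<Longrightarrow> E (x, z)"
proof -
  obtain D where D: "eventually D U" "\<And>x y z. D (x, y) \<Longrightarrow> D (y, z) \<Longrightarrow> E (x, z)"
    using is_uniformity_onD(4)[OF assms] by blast
  have "eventually (\<lambda>(x, y). D (y, x)) U"
    by (rule is_uniformity_onD(3)[OF assms(1) D(1)])
  then have "eventually (\<lambda>p. D p \<and> (case p of (x, y) \<Rightarrow> D (y, x))) U"
    using D(1) by eventually_elim simp
  then show thesis by (rule that) (auto intro: D(2))
qed

definition totally_bounded_on :: "('a \<times> 'a) filter \<Rightarrow> 'a set \<Rightarrow> bool" where
  "totally_bounded_on U A \<longleftrightarrow>
     (\<forall>E. eventually E U \<longrightarrow> (\<exists>F. finite F \<and> F \<subseteq> A \<and> (\<forall>y\<in>A. \<exists>x\<in>F. E (x, y))))"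

lemma totally_bounded_on_closure_of:
  assumes U: "is_uniformity_on S U" and A: "A \<subseteq> S" "totally_bounded_on U A"
  shows "totally_bounded_on U (topology_of_uniformity S U closure_of A)"
  unfolding totally_bounded_on_def
proof (intro allI impI)
  let ?T = "topology_of_uniformity S U"
  fix E assume "eventually E U"
  then obtain D where D: "eventually D U" "\<And>x y. D (x, y) \<Longrightarrow> D (y, x)"
    "\<And>x y z. D (x, y) \<Longrightarrow> D (y, z) \<Longrightarrow> E (x, z)"
    using uniformity_symmetric_half[OF U] by metis
  obtain F where F: "finite F" "F \<subseteq> A" "\<forall>y\<in>A. \<exists>x\<in>F. D (x, y)"
    using A(2) D(1) unfolding totally_bounded_on_def by meson
  have sub: "A \<subseteq> ?T closure_of A"
    using A(1) by (simp add: closure_of_subset topspace_topology_of_uniformity[OF U])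
  have "\<exists>x\<in>F. E (x, y)" if y: "y \<in> ?T closure_of A" for y
  proof -
    have "y \<in> S" using y in_closure_of topspace_topology_of_uniformity[OF U] by fastforce
    then have "y \<in> ?T interior_of {z \<in> S. D (y, z)}" by (rule uniformity_neighbourhood[OF U D(1)])
    then obtain z where "z \<in> A" "z \<in> ?T interior_of {z \<in> S. D (y, z)}"
      using y openin_interior_of[of ?T "{z \<in> S. D (y, z)}"] unfolding in_closure_of by blast
    then have "z \<in> A" "D (y, z)" using interior_of_subset by fastforce+
    then show ?thesis using F(3) D(2,3) by blast
  qed
  then show "\<exists>F. finite F \<and> F \<subseteq> ?T closure_of A \<and> (\<forall>y\<in>?T closure_of A. \<exists>x\<in>F. E (x, y))"
    using F sub by blast
qed

lemma eventually_ultrafilter_finite_Union: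
  assumes ultra: "\<And>P. eventually P G \<or> eventually (\<lambda>x. \<not> P x) G" and ne: "G \<noteq> bot"
    and F: "finite F" and ev: "eventually (\<lambda>y. \<exists>x\<in>F. Q x y) G"
  obtains x where "x \<in> F" "eventually (Q x) G"
proof -
  have "\<exists>x\<in>F. eventually (Q x) G"
  proof (rule ccontr)
    assume "\<not> (\<exists>x\<in>F. eventually (Q x) G)"
    then have "\<forall>x\<in>F. eventually (\<lambda>y. \<not> Q x y) G" using ultra by blast
    then have "eventually (\<lambda>y. \<forall>x\<in>F. \<not> Q x y) G" by (rule eventually_ball_finite[OF F])
    then have "eventually (\<lambda>y. False) G" using ev by eventually_elim blast
    then show False using ne by (simp add: trivial_limit_def)
  qed
  then show thesis using that by blast
qed

text \<open>Without a finite subcover the sets \<open>K - \<Union>\<F>\<close> generate a proper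
  filter. An ultrafilter finer than it is Cauchy by total boundedness and converges by completeness;
  the limit lies in the closed set \<open>K\<close>, hence in some member of the cover, which the
  ultrafilter avoids.\<close>

lemma compactin_complete_totally_bounded:
  assumes U: "is_uniformity_on S U" "complete_uniformity_on S U"
    and K: "closedin (topology_of_uniformity S U) K" "totally_bounded_on U K"
  shows "compactin (topology_of_uniformity S U) K"
  unfolding compactin_def
proof (intro conjI allI impI)
  let ?T = "topology_of_uniformity S U"
  have TS: "topspace ?T = S" by (rule topspace_topology_of_uniformity[OF U(1)])
  show KT: "K \<subseteq> topspace ?T" using K(1) by (rule closedin_subset)
  fix \<C> assume C: "Ball \<C> (openin ?T) \<and> K \<subseteq> \<Union>\<C>"
  show "\<exists>\<F>. finite \<F> \<and> \<F> \<subseteq> \<C> \<and> K \<subseteq> \<Union>\<F>"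
  proof (rule ccontr)
    assume no: "\<not> ?thesis"
    define B where "B = {principal (K - \<Union>\<F>) | \<F>. finite \<F> \<and> \<F> \<subseteq> \<C>}"
    have "B \<noteq> {}" by (auto simp: B_def)
    have base: "\<exists>x\<in>B. x \<le> inf F G" if FG: "F \<in> B" "G \<in> B" for F G
    proof -
      obtain \<F> \<G> where "finite \<F>" "\<F> \<subseteq> \<C>" "finite \<G>" "\<G> \<subseteq> \<C>"
        "F = principal (K - \<Union>\<F>)" "G = principal (K - \<Union>\<G>)"
        using FG by (auto simp: B_def)
      moreover from this have "principal (K - \<Union>(\<F> \<union> \<G>)) \<in> B"
        unfolding B_def by (intro CollectI exI[of _ "\<F> \<union> \<G>"]) simp
      ultimately show ?thesis
        by (intro bexI[of _ "principal (K - \<Union>(\<F> \<union> \<G>))"]) auto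
    qed
    have inf_iff: "eventually P (Inf B) \<longleftrightarrow> (\<exists>b\<in>B. eventually P b)" for P
      by (rule eventually_Inf_base[OF \<open>B \<noteq> {}\<close>]) (rule base)
    have "\<not> eventually (\<lambda>_. False) (Inf B)"
    proof (rule notI)
      assume "eventually (\<lambda>_. False) (Inf B)"
      then obtain b where "b \<in> B" "eventually (\<lambda>_. False) b"
        using inf_iff[of "\<lambda>_. False"] by blast
      then obtain \<F> where \<F>: "finite \<F>" "\<F> \<subseteq> \<C>" "eventually (\<lambda>_. False) (principal (K - \<Union>\<F>))"
        unfolding B_def by blast
      then have "K \<subseteq> \<Union>\<F>" unfolding eventually_principal by blast
      then show False using no \<F>(1,2) by blast
    qed
    then have "Inf B \<noteq> bot" by (simp add: trivial_limit_def)
    then obtain G where G: "G \<le> Inf B" "G \<noteq> bot"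
      "\<And>P. eventually P G \<or> eventually (\<lambda>x. \<not> P x) G"
      using ultrafilter_exists by metis
    have GB: "eventually (\<lambda>x. x \<in> K - \<Union>\<F>) G" if "finite \<F>" "\<F> \<subseteq> \<C>" for \<F>
    proof -
      have "principal (K - \<Union>\<F>) \<in> B" using that unfolding B_def by blast
      then have "G \<le> principal (K - \<Union>\<F>)" using G(1) by (meson Inf_lower order_trans)
      then show ?thesis by (simp add: le_principal)
    qed
    have GK: "eventually (\<lambda>x. x \<in> K) G" using GB[of "{}"] by simp
    have "G \<le> principal S"
      using GK KT TS unfolding le_principal by (auto elim: eventually_mono)
    moreover have "G \<times>\<^sub>F G \<le> U"
    proof (rule filter_leI)
      fix E assume "eventually E U"
      then obtain D where D: "eventually D U" "\<And>x y. D (x, y) \<Longrightarrow> D (y, x)"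
        "\<And>x y z. D (x, y) \<Longrightarrow> D (y, z) \<Longrightarrow> E (x, z)"
        using uniformity_symmetric_half[OF U(1)] by metis
      obtain F where F: "finite F" "\<forall>y\<in>K. \<exists>x\<in>F. D (x, y)"
        using K(2) D(1) unfolding totally_bounded_on_def by meson
      have "eventually (\<lambda>y. \<exists>x\<in>F. D (x, y)) G" using GK by eventually_elim (use F(2) in blast)
      \<comment> \<open>Finitely many sections cover \<open>K\<close>, and the ultrafilter picks one
        of them; the points of one section are pairwise \<open>E\<close>-close.\<close>
      then obtain x where x: "eventually (\<lambda>y. D (x, y)) G"
        by (rule eventually_ultrafilter_finite_Union[OF G(3) G(2) F(1), of "\<lambda>x y. D (x, y)"]) blast
      have "E (y, z)" if "D (x, y)" "D (x, z)" for y z using that D(2,3) by blast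
      then show "eventually E (G \<times>\<^sub>F G)"
        unfolding eventually_prod_filter using x by (intro exI[of _ "\<lambda>y. D (x, y)"]) simp
    qed
    ultimately obtain x where x: "x \<in> S" "G \<le> nhdsin ?T x"
      using U(2)[unfolded complete_uniformity_on_def, rule_format, of G] G(2) by blast
    have nh: "eventually (\<lambda>y. y \<in> V) G" if "openin ?T V" "x \<in> V" for V
      using x that TS by (intro filter_leD[OF x(2)]) (auto simp: eventually_nhdsin)
    have "x \<in> K"
    proof (rule ccontr)
      assume "x \<notin> K"
      then have "eventually (\<lambda>y. y \<in> topspace ?T - K) G"
        using K(1) x(1) TS by (intro nh openin_diff openin_topspace) auto
      then have "eventually (\<lambda>y. False) G" using GK by eventually_elim simp
      then show False using G(2) by (simp add: trivial_limit_def)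
    qed
    then obtain V where V: "V \<in> \<C>" "x \<in> V" using C by blast
    then have "eventually (\<lambda>y. y \<in> V) G" using C by (intro nh) auto
    moreover have "eventually (\<lambda>y. y \<in> K - \<Union>{V}) G" using V by (intro GB) auto
    ultimately have "eventually (\<lambda>y. False) G" by eventually_elim simp
    then show False using G(2) by (simp add: trivial_limit_def)
  qed
qed

section \<open>Characters of locally convex spaces\<close>

lemma continuous_map_to_metric_space:
  fixes f :: "'a \<Rightarrow> 'm::metric_space"
  shows "continuous_map X euclidean f \<longleftrightarrow>
    (\<forall>x\<in>topspace X. \<forall>\<epsilon>>0. \<exists>U. openin X U \<and> x \<in> U \<and> (\<forall>y\<in>U. dist (f y) (f x) < \<epsilon>))"
  using Met_TC.continuous_map_to_metric[of X f] by (simp add: dist_commute)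

lemma locally_convex_spaceD:
  assumes "locally_convex_space T"
  shows "subspace (topspace T)"
    and "continuous_map (prod_topology T T) T (\<lambda>(x, y). x + y)"
    and "continuous_map (prod_topology euclideanreal T) T (\<lambda>(c, x). c *\<^sub>R x)"
    and "Hausdorff_space T"
    and "neighbourhood_base_at 0 convex T"
  using assms unfolding locally_convex_space_def by blast+

lemma continuous_map_lcs_add:
  assumes "locally_convex_space T" "continuous_map X T f" "continuous_map X T g"
  shows "continuous_map X T (\<lambda>x. f x + g x)"
proof -
  have "continuous_map X (prod_topology T T) (\<lambda>x. (f x, g x))"
    using assms(2,3) by (rule continuous_map_pairedI)
  from continuous_map_compose[OF this locally_convex_spaceD(2)[OF assms(1)]]
  show ?thesis by (simp add: o_def)
qed

lemma continuous_map_lcs_scale: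
  assumes "locally_convex_space T" "continuous_map X euclideanreal c" "continuous_map X T f"
  shows "continuous_map X T (\<lambda>x. c x *\<^sub>R f x)"
proof -
  have "continuous_map X (prod_topology euclideanreal T) (\<lambda>x. (c x, f x))"
    using assms(2,3) by (rule continuous_map_pairedI)
  from continuous_map_compose[OF this locally_convex_spaceD(3)[OF assms(1)]]
  show ?thesis by (simp add: o_def)
qed

lemma lcs_convex_neighbourhood:
  assumes "locally_convex_space T" "openin T S" "0 \<in> S"
  obtains U V where "openin T U" "convex V" "0 \<in> U" "U \<subseteq> V" "V \<subseteq> S"
  using locally_convex_spaceD(5)[OF assms(1)] assms(2,3)
  unfolding neighbourhood_base_at_def by metis

lemma linear_on_setD:
  assumes "linear_on_set S g"
  shows "x \<in> S \<Longrightarrow> y \<in> S \<Longrightarrow> g (x + y) = g x + g y"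
    and "x \<in> S \<Longrightarrow> g (c *\<^sub>R x) = c *\<^sub>R g x"
  using assms unfolding linear_on_set_def by blast+

lemma linear_on_set_sum:
  assumes S: "subspace S" and g: "linear_on_set S g" and F: "finite F" "\<And>x. x \<in> F \<Longrightarrow> u x \<in> S"
  shows "g (\<Sum>x\<in>F. c x *\<^sub>R u x) = (\<Sum>x\<in>F. c x *\<^sub>R g (u x))"
  using F
proof (induction F rule: finite_induct)
  case empty
  show ?case using linear_on_set_0[OF g subspace_0[OF S]] by simp
next
  case (insert x F)
  then have "(\<Sum>x\<in>F. c x *\<^sub>R u x) \<in> S" "c x *\<^sub>R u x \<in> S"
    by (auto intro!: subspace_sum[OF S] subspace_scale[OF S])
  then show ?case
    using insert by (simp add: linear_on_setD[OF g])
qed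

lemma linear_on_set_diff:
  fixes g :: "'v::real_vector \<Rightarrow> 'w::real_vector"
  assumes S: "subspace S" and g: "linear_on_set S g" and xy: "x \<in> S" "y \<in> S"
  shows "g (x - y) = g x - g y"
proof -
  have "g (x + (-1) *\<^sub>R y) = g x + (-1) *\<^sub>R g y"
    using xy linear_on_setD[OF g] subspace_scale[OF S xy(2), of "-1"] by metis
  then show ?thesis by simp
qed

lemma linear_continuous_if_bounded_near_0:
  assumes T: "locally_convex_space T" and l: "linear_on_set (topspace T) l"
    and U: "openin T U" "0 \<in> U" "\<And>v. v \<in> U \<Longrightarrow> \<bar>l v\<bar> \<le> B"
  shows "continuous_map T euclideanreal l"
  unfolding continuous_map_to_metric_space
proof (intro ballI allI impI)
  fix v \<epsilon> assume v: "v \<in> topspace T" and \<epsilon>: "(0::real) < \<epsilon>"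
  note sub = locally_convex_spaceD(1)[OF T]
  have B: "0 \<le> B" using U(3)[OF U(2)] by linarith
  \<comment> \<open>If \<open>c *\<^sub>R (w - v)\<close> lies in \<open>U\<close>, then
    \<open>l w\<close> and \<open>l v\<close> differ by at most \<open>B / c\<close>; taking
    \<open>B + 1\<close> makes \<open>c\<close> positive and the estimate strict even for
    \<open>B = 0\<close>.\<close>
  define c where "c = (B + 1) / \<epsilon>"
  have c: "c > 0" using B \<epsilon> by (simp add: c_def)
  have "continuous_map T T (\<lambda>w. c *\<^sub>R (w + (-1) *\<^sub>R v))"
    using v subspace_neg[OF sub v]
    by (intro continuous_map_lcs_scale[OF T] continuous_map_lcs_add[OF T]) auto
  then have o: "openin T {w \<in> topspace T. c *\<^sub>R (w + (-1) *\<^sub>R v) \<in> U}"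
    using U(1) by (rule openin_continuous_map_preimage)
  have "dist (l w) (l v) < \<epsilon>" if w: "w \<in> topspace T" "c *\<^sub>R (w + (-1) *\<^sub>R v) \<in> U" for w
  proof -
    have "l (c *\<^sub>R (w - v)) = c * (l w - l v)"
      using w(1) v linear_on_setD(2)[OF l subspace_diff[OF sub w(1) v]]
      by (simp add: linear_on_set_diff[OF sub l])
    then have "\<bar>c * (l w - l v)\<bar> \<le> B" using U(3)[OF w(2)] by simp
    then have "c * \<bar>l w - l v\<bar> < B + 1" using c by (simp add: abs_mult)
    then have "\<bar>l w - l v\<bar> < (B + 1) / c" using c by (simp add: pos_less_divide_eq mult.commute)
    also have "(B + 1) / c = \<epsilon>" using B \<epsilon> by (simp add: c_def)
    finally show ?thesis by (simp add: dist_real_def)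
  qed
  moreover have "v \<in> {w \<in> topspace T. c *\<^sub>R (w + (-1) *\<^sub>R v) \<in> U}" using v U(2) by simp
  ultimately show "\<exists>W. openin T W \<and> v \<in> W \<and> (\<forall>w\<in>W. dist (l w) (l v) < \<epsilon>)"
    using o by (intro exI[of _ "{w \<in> topspace T. c *\<^sub>R (w + (-1) *\<^sub>R v) \<in> U}"]) blast
qed

lemma characters_additive_group:
  "\<xi> \<in> characters (additive_group T) T \<longleftrightarrow>
     \<xi> \<in> extensional (topspace T) \<and> continuous_map T circle_topology \<xi> \<and>
     (\<forall>x\<in>topspace T. \<forall>y\<in>topspace T. \<xi> (x + y) = \<xi> x * \<xi> y)"
proof -
  have "\<xi> x \<in> sphere 0 1" if "continuous_map T circle_topology \<xi>" "x \<in> topspace T" for x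
    using that continuous_map_image_subset_topspace by fastforce
  then show ?thesis
    unfolding characters_def hom_def additive_group_def circle_group_def by auto
qed

lemma character_of_functional:
  assumes l: "linear_on_set (topspace T) l" "continuous_map T euclideanreal l"
    and T: "subspace (topspace T)"
  shows "(\<lambda>v\<in>topspace T. cis (l v)) \<in> characters (additive_group T) T"
  unfolding characters_additive_group
proof (intro conjI ballI)
  show "continuous_map T circle_topology (\<lambda>v\<in>topspace T. cis (l v))"
  proof (rule continuous_map_eq)
    have "continuous_map euclideanreal euclidean cis"
      by (simp add: continuous_on_cis)
    from continuous_map_compose[OF l(2) this]
    show "continuous_map T circle_topology (\<lambda>v. cis (l v))"
      by (simp add: continuous_map_in_subtopology o_def)
  qed auto
qed (use l(1) in \<open>auto simp: linear_on_setD(1) subspace_add[OF T] cis_mult\<close>)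

text \<open>On each line through 0 the character is one of the reals, with slope \<open>l v\<close>;
  comparing \<open>cis\<close> at all scales makes \<open>l\<close> linear. For continuity, a convex
  neighbourhood of 0 contains the segment to each of its points, and along it the arc criterion
  bounds \<open>l\<close>.\<close>

lemma character_lift:
  assumes T: "locally_convex_space T" and \<xi>: "\<xi> \<in> characters (additive_group T) T"
  obtains l where "linear_on_set (topspace T) l" "continuous_map T euclideanreal l"
    "\<And>v. v \<in> topspace T \<Longrightarrow> \<xi> v = cis (l v)"
proof -
  note sub = locally_convex_spaceD(1)[OF T]
  have cont: "continuous_map T euclidean \<xi>"
    and hom: "\<And>x y. x \<in> topspace T \<Longrightarrow> y \<in> topspace T \<Longrightarrow> \<xi> (x + y) = \<xi> x * \<xi> y"
    using \<xi> by (auto simp: characters_additive_group continuous_map_in_subtopology)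
  have "\<exists>a. \<forall>t. \<xi> (t *\<^sub>R v) = cis (t * a)" if v: "v \<in> topspace T" for v
  proof -
    have "continuous_map euclideanreal T (\<lambda>t. t *\<^sub>R v)"
      using v by (intro continuous_map_lcs_scale[OF T]) auto
    from continuous_map_compose[OF this cont]
    have "continuous_on UNIV (\<lambda>t. \<xi> (t *\<^sub>R v))" by (simp add: o_def)
    moreover have "\<xi> ((s + t) *\<^sub>R v) = \<xi> (s *\<^sub>R v) * \<xi> (t *\<^sub>R v)" for s t
      using v by (simp add: scaleR_add_left hom subspace_scale[OF sub])
    moreover have "norm (\<xi> (t *\<^sub>R v)) = 1" for t
      using v by (intro character_in_sphere[OF \<xi>] subspace_scale[OF sub])
    ultimately obtain a where "\<And>t. \<xi> (t *\<^sub>R v) = cis (t * a)"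
      using continuous_hom_real_circle[of "\<lambda>t. \<xi> (t *\<^sub>R v)"] by blast
    then show ?thesis by blast
  qed
  then obtain l where l: "\<And>v t. v \<in> topspace T \<Longrightarrow> \<xi> (t *\<^sub>R v) = cis (t * l v)" by metis
  have lin: "linear_on_set (topspace T) l"
    unfolding linear_on_set_def
  proof (intro conjI ballI allI)
    fix v w assume vw: "v \<in> topspace T" "w \<in> topspace T"
    have "cis (t * l (v + w)) = cis (t * (l v + l w))" for t
    proof -
      have "cis (t * l (v + w)) = \<xi> (t *\<^sub>R v + t *\<^sub>R w)"
        using l[OF subspace_add[OF sub vw]] by (simp add: scaleR_add_right)
      also have "\<dots> = \<xi> (t *\<^sub>R v) * \<xi> (t *\<^sub>R w)" using vw by (intro hom subspace_scale[OF sub])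
      finally show ?thesis using vw by (simp add: l cis_mult distrib_left)
    qed
    then show "l (v + w) = l v + l w" by (rule cis_scale_inject)
  next
    fix c v assume v: "v \<in> topspace T"
    have "cis (t * l (c *\<^sub>R v)) = cis (t * (c * l v))" for t
      using l[OF subspace_scale[OF sub v], of t c] l[OF v, of "t * c"] by (simp add: mult.assoc)
    then show "l (c *\<^sub>R v) = c *\<^sub>R l v" unfolding real_scaleR_def by (rule cis_scale_inject)
  qed
  have l1: "\<xi> v = cis (l v)" if "v \<in> topspace T" for v using l[OF that, of 1] by simp
  have \<delta>: "0 < norm (cis 1 - 1)" using pi_gt3 by (intro norm_cis_minus_1_pos) auto
  have "openin T {v \<in> topspace T. \<xi> v \<in> ball 1 (norm (cis 1 - 1))}"
    using cont by (rule openin_continuous_map_preimage) simp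
  moreover have "0 \<in> {v \<in> topspace T. \<xi> v \<in> ball 1 (norm (cis 1 - 1))}"
    using l1[OF subspace_0[OF sub]] linear_on_set_0[OF lin subspace_0[OF sub]] subspace_0[OF sub] \<delta>
    by simp
  ultimately obtain U V where UV: "openin T U" "convex V" "0 \<in> U" "U \<subseteq> V"
    "V \<subseteq> {v \<in> topspace T. \<xi> v \<in> ball 1 (norm (cis 1 - 1))}"
    by (rule lcs_convex_neighbourhood[OF T])
  have "\<bar>l v\<bar> \<le> 1" if "v \<in> U" for v
  proof -
    have v: "v \<in> V" "v \<in> topspace T" using that UV by auto
    have "\<bar>l v\<bar> < 1"
    proof (rule abs_less_if_cis_arc_near_1)
      fix t :: real assume t: "0 \<le> t" "t \<le> 1"
      have "(1 - t) *\<^sub>R 0 + t *\<^sub>R v \<in> V"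
        using UV v t by (intro convexD) auto
      then have "\<xi> (t *\<^sub>R v) \<in> ball 1 (norm (cis 1 - 1))" using UV(5) by auto
      then show "norm (cis (t * l v) - 1) < norm (cis 1 - 1)"
        by (simp add: l[OF v(2)] dist_norm norm_minus_commute)
    qed simp
    then show ?thesis by simp
  qed
  then have "continuous_map T euclideanreal l"
    by (rule linear_continuous_if_bounded_near_0[OF T lin UV(1,3)])
  then show thesis using that lin l1 by blast
qed

lemma locally_convex_space_real: "locally_convex_space euclideanreal"
  unfolding locally_convex_space_def
proof (intro conjI)
  have "continuous_on UNIV (\<lambda>p::real \<times> real. fst p + snd p)"
    by (intro continuous_intros)
  then show "continuous_map (prod_topology euclideanreal euclideanreal) euclideanreal (\<lambda>(x, y). x + y)"
    by (simp add: case_prod_unfold)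
  have "continuous_on UNIV (\<lambda>p::real \<times> real. fst p *\<^sub>R snd p)"
    by (intro continuous_intros)
  then show "continuous_map (prod_topology euclideanreal euclideanreal) euclideanreal (\<lambda>(c, x). c *\<^sub>R x)"
    by (simp add: case_prod_unfold)
  show "neighbourhood_base_at 0 convex euclideanreal"
    unfolding neighbourhood_base_at_def
  proof (intro allI impI)
    fix S :: "real set" assume "openin euclideanreal S \<and> 0 \<in> S"
    then obtain e where "e > 0" "ball 0 e \<subseteq> S"
      by (auto simp: open_contains_ball)
    then show "\<exists>U V. openin euclideanreal U \<and> convex V \<and> 0 \<in> U \<and> U \<subseteq> V \<and> V \<subseteq> S"
      by (intro exI[of _ "ball 0 e"]) auto
  qed
qed auto

section \<open>Compact sets in the free locally convex space\<close>

locale free_lcs_over =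
  fixes X :: "'a topology" and L :: "'v::real_vector topology" and i :: "'a \<Rightarrow> 'v"
  assumes Tychonoff: "Tychonoff_space X" and free: "free_lcs X L i"
begin

lemma L: "locally_convex_space L"
  and i_continuous: "continuous_map X L i"
  using free by (auto simp: free_lcs_def)

lemmas L_subspace = locally_convex_spaceD(1)[OF L]

lemma i_in_L: "x \<in> topspace X \<Longrightarrow> i x \<in> topspace L"
  using i_continuous continuous_map_image_subset_topspace by fastforce

lemma extension_unique:
  fixes E :: "'e::real_vector topology"
  assumes "locally_convex_space E" "continuous_map X E f"
  shows "\<exists>!g. g \<in> continuous_linear_maps L E \<and> (\<forall>x\<in>topspace X. g (i x) = f x)"
  using free_lcs_universal_property[OF free, where 'e='e] assms
  unfolding lcs_universal_property_def by blast

text \<open>Complete regularity is applied to the complement of \<open>U\<close> together with the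
  finite set \<open>F - {x}\<close>. With a support as \<open>F\<close>, the bump singles out one of
  its points, or a point outside it.\<close>

lemma bump_function:
  assumes "openin X U" "x \<in> U" "finite F"
  obtains f :: "'a \<Rightarrow> real" where "continuous_map X euclideanreal f"
    "\<And>y. y \<in> topspace X \<Longrightarrow> 0 \<le> f y \<and> f y \<le> 1" "f x = 1"
    "\<And>y. y \<in> topspace X \<Longrightarrow> y \<notin> U \<or> y \<in> F - {x} \<Longrightarrow> f y = 0"
proof -
  have cr: "completely_regular_space X" and H: "Hausdorff_space X"
    using Tychonoff by (auto simp: Tychonoff_space_def)
  define C where "C = (topspace X - U) \<union> (F - {x}) \<inter> topspace X"
  have "closedin X ((F - {x}) \<inter> topspace X)"
    using H assms(3) by (intro closedin_Hausdorff_finite) auto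
  then have C: "closedin X C" unfolding C_def using assms(1) by (intro closedin_Un closedin_diff) auto
  have "x \<in> topspace X - C" using assms(1,2) openin_subset unfolding C_def by fastforce
  then obtain g :: "'a \<Rightarrow> real" where g: "continuous_map X (top_of_set {0..1}) g" "g x = 0" "g ` C \<subseteq> {1}"
    using cr C unfolding completely_regular_space_def by metis
  have gc: "continuous_map X euclideanreal g"
    using g(1) by (simp add: continuous_map_in_subtopology)
  show thesis
  proof (rule that)
    show "continuous_map X euclideanreal (\<lambda>y. 1 - g y)" by (intro continuous_intros gc) simp
    show "0 \<le> 1 - g y \<and> 1 - g y \<le> 1" if "y \<in> topspace X" for y
      using continuous_map_image_subset_topspace[OF g(1)] that by auto
    show "1 - g x = 1" using g(2) by simp
    show "1 - g y = 0" if "y \<in> topspace X" "y \<notin> U \<or> y \<in> F - {x}" for y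
      using that g(3) by (auto simp: C_def)
  qed
qed

definition ext :: "('a \<Rightarrow> real) \<Rightarrow> 'v \<Rightarrow> real" where
  "ext f = (SOME g. g \<in> continuous_linear_maps L euclideanreal \<and> (\<forall>x\<in>topspace X. g (i x) = f x))"

lemma ext:
  assumes "continuous_map X euclideanreal f"
  shows ext_continuous: "continuous_map L euclideanreal (ext f)"
    and ext_linear: "linear_on_set (topspace L) (ext f)"
    and ext_i: "x \<in> topspace X \<Longrightarrow> ext f (i x) = f x"
proof -
  have "\<exists>g. g \<in> continuous_linear_maps L euclideanreal \<and> (\<forall>x\<in>topspace X. g (i x) = f x)"
    using extension_unique[OF locally_convex_space_real assms] by blast
  then have "ext f \<in> continuous_linear_maps L euclideanreal \<and> (\<forall>x\<in>topspace X. ext f (i x) = f x)"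
    unfolding ext_def by (rule someI_ex)
  then show "continuous_map L euclideanreal (ext f)" "linear_on_set (topspace L) (ext f)"
    "x \<in> topspace X \<Longrightarrow> ext f (i x) = f x"
    by (auto simp: continuous_linear_maps_def)
qed

text \<open>\<open>i\<close> also maps into the span, a locally convex subspace. The extension of
  this map, viewed as an operator on \<open>L\<close>, agrees with the identity on the generators,
  so uniqueness makes it the identity, and its image is all of \<open>L\<close>.\<close>

lemma L_eq_span: "topspace L = span (i ` topspace X)"
proof
  let ?W = "span (i ` topspace X)"
  show WL: "?W \<subseteq> topspace L" using i_in_L by (intro span_minimal L_subspace) auto
  let ?E = "subtopology L ?W"
  have E: "locally_convex_space ?E" using WL by (intro locally_convex_space_subtopology[OF L]) auto
  have "continuous_map X ?E i"
    unfolding continuous_map_in_subtopology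
    using i_continuous span_superset[of "i ` topspace X"] by blast
  then obtain g where g: "g \<in> continuous_linear_maps L ?E" "\<forall>x\<in>topspace X. g (i x) = i x"
    using extension_unique[OF E] by blast
  have gL: "g \<in> continuous_linear_maps L L" and gW: "g ` topspace L \<subseteq> ?W"
    using g(1) by (auto simp: continuous_linear_maps_def continuous_map_in_subtopology)
  have "restrict (\<lambda>v. v) (topspace L) \<in> continuous_linear_maps L L"
  proof -
    have "continuous_map L L (restrict (\<lambda>v. v) (topspace L))"
      by (rule continuous_map_eq[OF continuous_map_id]) simp
    then show ?thesis
      by (simp add: continuous_linear_maps_def linear_on_set_def subspace_add[OF L_subspace]
          subspace_scale[OF L_subspace])
  qed
  moreover have "\<forall>x\<in>topspace X. restrict (\<lambda>v. v) (topspace L) (i x) = i x" using i_in_L by simp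
  ultimately have "g = restrict (\<lambda>v. v) (topspace L)"
    using extension_unique[OF L i_continuous] gL g(2) by blast
  then show "topspace L \<subseteq> ?W" using gW by auto
qed

text \<open>Junk outside \<open>topspace L\<close>, as no such coefficients need exist there.\<close>

definition cf :: "'v \<Rightarrow> 'a \<Rightarrow> real" where
  "cf v = (SOME c. finite {x. c x \<noteq> 0} \<and> {x. c x \<noteq> 0} \<subseteq> topspace X \<and>
     v = (\<Sum>x | c x \<noteq> 0. c x *\<^sub>R i x))"

definition supp :: "'v \<Rightarrow> 'a set" where
  "supp v = {x. cf v x \<noteq> 0}"

lemma
  assumes "v \<in> topspace L"
  shows finite_supp: "finite (supp v)"
    and supp_subset: "supp v \<subseteq> topspace X"
    and cf_sum: "v = (\<Sum>x\<in>supp v. cf v x *\<^sub>R i x)"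
proof -
  have "\<exists>c. finite {x. c x \<noteq> 0} \<and> {x. c x \<noteq> 0} \<subseteq> topspace X \<and> v = (\<Sum>x | c x \<noteq> 0. c x *\<^sub>R i x)"
    using assms unfolding L_eq_span
  proof (induction rule: span_induct_alt)
    case base
    show ?case by (intro exI[of _ "\<lambda>_. 0"]) simp
  next
    case (step a y z)
    then obtain c where c: "finite {x. c x \<noteq> 0}" "{x. c x \<noteq> 0} \<subseteq> topspace X"
      "z = (\<Sum>x | c x \<noteq> 0. c x *\<^sub>R i x)" by blast
    obtain u where u: "u \<in> topspace X" "y = i u" using step(1) by blast
    define d where "d x = c x + (if x = u then a else 0)" for x
    \<comment> \<open>The coefficient at \<open>u\<close> may cancel, so all sums are first taken
      over this finite superset of the support of \<open>d\<close>.\<close>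
    let ?G = "insert u {x. c x \<noteq> 0}"
    have sub: "{x. d x \<noteq> 0} \<subseteq> ?G" by (auto simp: d_def split: if_splits)
    have G: "finite ?G" using c(1) by simp
    have "a *\<^sub>R y + z = (\<Sum>x\<in>?G. (if x = u then a else 0) *\<^sub>R i x) + (\<Sum>x\<in>?G. c x *\<^sub>R i x)"
    proof -
      have "(\<Sum>x\<in>?G. (if x = u then a else 0) *\<^sub>R i x) = (\<Sum>x\<in>?G. if x = u then a *\<^sub>R i x else 0)"
        by (intro sum.cong) auto
      also have "\<dots> = a *\<^sub>R y" using G by (simp add: sum.delta u(2))
      finally have 1: "(\<Sum>x\<in>?G. (if x = u then a else 0) *\<^sub>R i x) = a *\<^sub>R y" .
      have "z = (\<Sum>x\<in>?G. c x *\<^sub>R i x)"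
        unfolding c(3) using G by (intro sum.mono_neutral_left) auto
      with 1 show ?thesis by simp
    qed
    also have "\<dots> = (\<Sum>x\<in>?G. d x *\<^sub>R i x)"
      unfolding d_def by (simp only: scaleR_add_left sum.distrib add.commute)
    also have "\<dots> = (\<Sum>x | d x \<noteq> 0. d x *\<^sub>R i x)"
      using G sub by (intro sum.mono_neutral_right) auto
    finally show ?case
      using finite_subset[OF sub G] sub c(2) u(1) by (intro exI[of _ d] conjI) auto
  qed
  then have "finite {x. cf v x \<noteq> 0} \<and> {x. cf v x \<noteq> 0} \<subseteq> topspace X \<and>
      v = (\<Sum>x | cf v x \<noteq> 0. cf v x *\<^sub>R i x)"
    unfolding cf_def by (rule someI_ex)
  then show "finite (supp v)" "supp v \<subseteq> topspace X" "v = (\<Sum>x\<in>supp v. cf v x *\<^sub>R i x)"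
    unfolding supp_def by blast+
qed

lemma linear_eq_sum_cf:
  assumes g: "linear_on_set (topspace L) g" and v: "v \<in> topspace L"
  shows "g v = (\<Sum>x\<in>supp v. cf v x *\<^sub>R g (i x))"
proof -
  have "g (\<Sum>x\<in>supp v. cf v x *\<^sub>R i x) = (\<Sum>x\<in>supp v. cf v x *\<^sub>R g (i x))"
    using finite_supp[OF v] supp_subset[OF v] i_in_L
    by (intro linear_on_set_sum[OF L_subspace g]) auto
  then show ?thesis using cf_sum[OF v] by simp
qed

text \<open>An element of \<open>L\<close> acts on continuous functions as a finitely supported
  measure: values off \<open>supp v\<close> do not affect \<open>ext f v\<close>.\<close>

lemma ext_eq_sum_cf:
  assumes f: "continuous_map X euclideanreal f" and v: "v \<in> topspace L"
  shows "ext f v = (\<Sum>x\<in>supp v. cf v x * f x)"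
proof -
  have "ext f v = (\<Sum>x\<in>supp v. cf v x *\<^sub>R ext f (i x))"
    by (rule linear_eq_sum_cf[OF ext_linear[OF f] v])
  also have "\<dots> = (\<Sum>x\<in>supp v. cf v x * f x)"
    using supp_subset[OF v] by (intro sum.cong) (auto simp: ext_i[OF f])
  finally show ?thesis .
qed

end

section \<open>Gliding humps along a locally finite sequence\<close>

text \<open>Coefficients for the gliding hump below: forward substitution in a lower triangular system.\<close>

fun solve_triangular :: "(nat \<Rightarrow> real) \<Rightarrow> (nat \<Rightarrow> nat \<Rightarrow> real) \<Rightarrow> nat \<Rightarrow> real" where
  "solve_triangular r m k = (r k - (\<Sum>j<k. solve_triangular r m j * m k j)) / m k k"

declare solve_triangular.simps [simp del]

lemma solve_triangular:
  assumes "m k k \<noteq> 0"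
  shows "(\<Sum>j\<le>k. solve_triangular r m j * m k j) = r k"
proof -
  have "(\<Sum>j\<le>k. solve_triangular r m j * m k j) =
      (\<Sum>j<k. solve_triangular r m j * m k j) + solve_triangular r m k * m k k"
    by (simp add: lessThan_Suc_atMost[symmetric])
  moreover have "solve_triangular r m k * m k k = r k - (\<Sum>j<k. solve_triangular r m j * m k j)"
    using assms by (subst solve_triangular.simps) simp
  ultimately show ?thesis by simp
qed

definition locally_finite_seq :: "'a topology \<Rightarrow> (nat \<Rightarrow> 'a set) \<Rightarrow> bool" where
  "locally_finite_seq X U \<longleftrightarrow>
     (\<forall>x\<in>topspace X. \<exists>W. openin X W \<and> x \<in> W \<and> finite {n. U n \<inter> W \<noteq> {}})"

text \<open>On a neighbourhood that meets finitely many \<open>U k\<close> the sum reduces to a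
  fixed finite one. Summing over \<open>{k. h k x \<noteq> 0}\<close> replaces an infinite series,
  since this set is finite at each point of the space.\<close>

lemma continuous_map_locally_finite_sum:
  fixes h :: "nat \<Rightarrow> 'a \<Rightarrow> real"
  assumes U: "locally_finite_seq X U" and h: "\<And>k. continuous_map X euclideanreal (h k)"
    and zero: "\<And>k x. x \<in> topspace X \<Longrightarrow> x \<notin> U k \<Longrightarrow> h k x = 0"
  shows "continuous_map X euclideanreal (\<lambda>x. \<Sum>k | h k x \<noteq> 0. h k x)"
  unfolding continuous_map_to_metric_space
proof (intro ballI allI impI)
  fix x \<epsilon> assume x: "x \<in> topspace X" and \<epsilon>: "(0::real) < \<epsilon>"
  let ?g = "\<lambda>x. \<Sum>k | h k x \<noteq> 0. h k x"
  obtain W where W: "openin X W" "x \<in> W" "finite {n. U n \<inter> W \<noteq> {}}"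
    using U x unfolding locally_finite_seq_def by blast
  let ?M = "{n. U n \<inter> W \<noteq> {}}"
  have g: "?g y = (\<Sum>k\<in>?M. h k y)" if "y \<in> W" for y
    using that zero openin_subset[OF W(1)] W(3) by (intro sum.mono_neutral_left) auto
  have "continuous_map X euclideanreal (\<lambda>y. \<Sum>k\<in>?M. h k y)"
    using W(3) h by (intro continuous_map_sum) auto
  then obtain N where N: "openin X N" "x \<in> N"
    "\<forall>y\<in>N. dist (\<Sum>k\<in>?M. h k y) (\<Sum>k\<in>?M. h k x) < \<epsilon>"
    using x \<epsilon> unfolding continuous_map_to_metric_space by blast
  have "\<forall>y\<in>N \<inter> W. dist (?g y) (?g x) < \<epsilon>"
    using N(3) W(2) by (auto simp: g simp del: sum.cong)
  then show "\<exists>N. openin X N \<and> x \<in> N \<and> (\<forall>y\<in>N. dist (?g y) (?g x) < \<epsilon>)"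
    using N W by (intro exI[of _ "N \<inter> W"]) (auto intro: openin_Int)
qed

context free_lcs_over
begin

text \<open>Suppose infinitely many \<open>U n\<close> are hit. Vectors \<open>a k\<close> in
  \<open>A\<close> and indices \<open>n k\<close> are chosen so that \<open>U (n k)\<close> meets
  \<open>supp (a k)\<close> but avoids all earlier supports. Bumps \<open>h j\<close> inside
  \<open>U (n j)\<close> give a lower triangular matrix \<open>ext (h j) (a k)\<close>, so a
  combination \<open>g\<close> of them can be found with \<open>ext g (a k) = k\<close>, impossible
  for a continuous functional on a compact set.\<close>

lemma compactin_meets_locally_finite_seq:
  assumes A: "compactin L A" and U: "\<And>n. openin X (U n)" "locally_finite_seq X U"
  shows "finite {n. U n \<inter> (\<Union>a\<in>A. supp a) \<noteq> {}}" (is "finite ?N")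
proof (rule ccontr)
  assume inf: "infinite ?N"
  have AL: "A \<subseteq> topspace L" using A by (rule compactin_subset_topspace)
  have point: "finite {n. x \<in> U n}" if x: "x \<in> topspace X" for x
  proof -
    obtain W where "x \<in> W" "finite {n. U n \<inter> W \<noteq> {}}"
      using U(2) x unfolding locally_finite_seq_def by blast
    then show ?thesis by (elim rev_finite_subset) auto
  qed
  \<comment> \<open>Each point lies in finitely many \<open>U n\<close>, so all but finitely many
    \<open>U n\<close> avoid the finite set \<open>F\<close>, and some of these still hit a
    support.\<close>
  have next_step: "\<exists>n a x. m < n \<and> a \<in> A \<and> x \<in> supp a \<inter> U n \<and> U n \<inter> F = {}"
    if F: "finite F" "F \<subseteq> topspace X" for F m
  proof -
    have "finite ((\<Union>x\<in>F. {n. x \<in> U n}) \<union> {..m})" using F point by auto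
    then obtain n where "n \<in> ?N" "n \<notin> (\<Union>x\<in>F. {n. x \<in> U n}) \<union> {..m}"
      using inf by (meson finite_subset subsetI)
    then show ?thesis by (intro exI[of _ n]) auto
  qed
  \<comment> \<open>\<open>F\<close> collects all supports chosen so far, so the requirement on the
    next index depends on the current state alone.\<close>
  define P where "P = (\<lambda>(F, n, a, x). finite F \<and> F \<subseteq> topspace X \<and> a \<in> A \<and> supp a \<subseteq> F \<and> x \<in> supp a \<inter> U n)"
  define Q where "Q = (\<lambda>(F, n, a :: 'v, x :: 'a) (F', n', a' :: 'v, x' :: 'a). F \<subseteq> F' \<and> n < n' \<and> U n' \<inter> F = {})"
  have "\<exists>s. \<forall>k. P (s k) \<and> Q (s k) (s (Suc k))"
  proof -
    have "\<exists>s. P s"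
    proof -
      obtain n a x where "a \<in> A" "x \<in> supp a \<inter> U n" using next_step[of "{}" 0] by auto
      then show ?thesis using AL finite_supp supp_subset
        by (intro exI[of _ "(supp a, n, a, x)"]) (auto simp: P_def)
    qed
    moreover have "\<exists>s'. P s' \<and> Q s s'" if s: "P s" for s
    proof -
      obtain F n a x where s_eq: "s = (F, n, a, x)" by (metis prod_cases4)
      have F: "finite F" "F \<subseteq> topspace X" using s by (auto simp: P_def s_eq)
      obtain n' a' x' where "n < n'" "a' \<in> A" "x' \<in> supp a' \<inter> U n'" "U n' \<inter> F = {}"
        using next_step[OF F] by blast
      then show ?thesis using F AL finite_supp[of a'] supp_subset[of a']
        by (intro exI[of _ "(F \<union> supp a', n', a', x')"]) (auto simp: P_def Q_def s_eq)
    qed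
    ultimately show ?thesis by (metis dependent_nat_choice[of "\<lambda>_. P" "\<lambda>_. Q"])
  qed
  then obtain s where s: "\<And>k. P (s k)" "\<And>k. Q (s k) (s (Suc k))" by blast
  define F n a x where "F k = fst (s k)" and "n k = fst (snd (s k))"
    and "a k = fst (snd (snd (s k)))" and "x k = snd (snd (snd (s k)))" for k
  have P: "finite (F k)" "F k \<subseteq> topspace X" "a k \<in> A" "supp (a k) \<subseteq> F k" "x k \<in> supp (a k)" "x k \<in> U (n k)" for k
    using s(1)[of k] by (auto simp: P_def F_def n_def a_def x_def split: prod.splits)
  have Q: "F k \<subseteq> F (Suc k)" "n k < n (Suc k)" "U (n (Suc k)) \<inter> F k = {}" for k
    using s(2)[of k] by (auto simp: Q_def F_def n_def split: prod.splits)
  have F_mono: "F j \<subseteq> F k" if "j \<le> k" for j k using Q(1) that by (rule lift_Suc_mono_le)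
  have n_mono: "strict_mono n" using Q(2) by (simp add: strict_mono_Suc_iff)
  have avoid: "U (n k) \<inter> supp (a j) = {}" if "j < k" for j k
  proof -
    obtain k' where k': "k = Suc k'" "j \<le> k'" using \<open>j < k\<close> by (cases k) auto
    show ?thesis using Q(3)[of k'] F_mono[OF k'(2)] P(4)[of j] k'(1) by blast
  qed
  have aL: "a k \<in> topspace L" for k using P(3) AL by blast
  have "\<exists>f. continuous_map X euclideanreal f \<and> f (x k) = 1 \<and>
      (\<forall>y\<in>topspace X. y \<notin> U (n k) \<or> y \<in> supp (a k) - {x k} \<longrightarrow> f y = 0)" for k
  proof -
    obtain f :: "'a \<Rightarrow> real" where "continuous_map X euclideanreal f" "f (x k) = 1"
      "\<And>y. y \<in> topspace X \<Longrightarrow> y \<notin> U (n k) \<or> y \<in> supp (a k) - {x k} \<Longrightarrow> f y = 0"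
      by (rule bump_function[OF U(1)[of "n k"] P(6)[of k] finite_supp[OF aL[of k]]]) blast
    then show ?thesis by (intro exI[of _ f]) simp
  qed
  then obtain h where h: "\<And>k. continuous_map X euclideanreal (h k)" "\<And>k. h k (x k) = 1"
    "\<And>k y. y \<in> topspace X \<Longrightarrow> y \<notin> U (n k) \<or> y \<in> supp (a k) - {x k} \<Longrightarrow> h k y = (0::real)"
    by metis
  define c where "c = solve_triangular real (\<lambda>k j. ext (h j) (a k))"
  \<comment> \<open>The bump vanishes on the rest of \<open>supp (a k)\<close>, so the diagonal
    entry is the single coefficient \<open>cf (a k) (x k)\<close>.\<close>
  have diag: "ext (h k) (a k) \<noteq> 0" for k
  proof -
    have off: "h k y = 0" if "y \<in> supp (a k) - {x k}" for y
      using h(3)[of y k] supp_subset[OF aL[of k]] that by blast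
    have "ext (h k) (a k) = (\<Sum>y\<in>supp (a k). cf (a k) y * h k y)"
      by (rule ext_eq_sum_cf[OF h(1) aL])
    also have "\<dots> = (\<Sum>y\<in>{x k}. cf (a k) y * h k y)"
      using P(5)[of k] off by (intro sum.mono_neutral_right finite_supp aL) auto
    also have "\<dots> = cf (a k) (x k)" by (simp add: h(2))
    finally show ?thesis using P(5) by (simp add: supp_def)
  qed
  define hc where "hc k y = c k * h k y" for k y
  define g where "g y = (\<Sum>k | hc k y \<noteq> 0. hc k y)" for y
  have lf: "locally_finite_seq X (\<lambda>k. U (n k))"
    unfolding locally_finite_seq_def
  proof
    fix y assume "y \<in> topspace X"
    then obtain W where W: "openin X W" "y \<in> W" "finite {m. U m \<inter> W \<noteq> {}}"
      using U(2) unfolding locally_finite_seq_def by blast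
    have "finite (n -` {m. U m \<inter> W \<noteq> {}})"
      using W(3) n_mono by (intro finite_vimageI strict_mono_imp_inj_on)
    then show "\<exists>W. openin X W \<and> y \<in> W \<and> finite {k. U (n k) \<inter> W \<noteq> {}}"
      using W by (auto simp: vimage_def)
  qed
  have gc: "continuous_map X euclideanreal g"
    unfolding g_def
  proof (rule continuous_map_locally_finite_sum[OF lf])
    show "continuous_map X euclideanreal (hc k)" for k
      unfolding hc_def by (intro continuous_intros h(1)) simp
  qed (use h(3) in \<open>auto simp: hc_def\<close>)
  have "ext g (a k) = real k" for k
  proof -
    have "ext g (a k) = (\<Sum>y\<in>supp (a k). cf (a k) y * g y)" by (rule ext_eq_sum_cf[OF gc aL])
    also have "\<dots> = (\<Sum>y\<in>supp (a k). \<Sum>j\<le>k. c j * (cf (a k) y * h j y))"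
    proof (rule sum.cong[OF refl])
      fix y assume y: "y \<in> supp (a k)"
      then have "y \<in> topspace X" using supp_subset[OF aL] by blast
      \<comment> \<open>This is the triangular shape: for \<open>j > k\<close> the set
        \<open>U (n j)\<close> avoids \<open>supp (a k)\<close>, so later bumps are invisible to
        \<open>a k\<close>.\<close>
      then have "hc j y = 0" if "\<not> j \<le> k" for j
        using avoid[of k j] that y h(3)[of y j] by (auto simp: hc_def)
      then have "g y = (\<Sum>j\<le>k. hc j y)"
        unfolding g_def by (intro sum.mono_neutral_left) auto
      then show "cf (a k) y * g y = (\<Sum>j\<le>k. c j * (cf (a k) y * h j y))"
        by (simp add: hc_def sum_distrib_left mult.left_commute)
    qed
    also have "\<dots> = (\<Sum>j\<le>k. \<Sum>y\<in>supp (a k). c j * (cf (a k) y * h j y))" by (rule sum.swap)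
    also have "\<dots> = (\<Sum>j\<le>k. c j * ext (h j) (a k))"
      by (simp add: ext_eq_sum_cf[OF h(1) aL] sum_distrib_left)
    also have "\<dots> = real k" unfolding c_def by (rule solve_triangular[OF diag])
    finally show ?thesis .
  qed
  moreover have "compact (ext g ` A)"
    using image_compactin[OF A ext_continuous[OF gc]] by simp
  then obtain B where "\<forall>y\<in>ext g ` A. norm y \<le> B"
    using compact_imp_bounded bounded_iff by blast
  ultimately have "real k \<le> B" for k using P(3)[of k] by force
  then show False using reals_Archimedean2[of B] by (meson not_le)
qed

end

lemma half_powers_sum_bound:
  fixes f :: "nat \<Rightarrow> real"
  assumes "\<And>n. \<bar>f n\<bar> \<le> B"
  shows "summable (\<lambda>n. (1 / 2) ^ n * f n)" and "\<bar>suminf (\<lambda>n. (1 / 2) ^ n * f n)\<bar> \<le> 2 * B"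
proof -
  have geo: "summable (\<lambda>n. (1 / 2 :: real) ^ n)" by (rule summable_geometric) simp
  have le: "norm ((1 / 2) ^ n * f n) \<le> (1 / 2) ^ n * B" for n
    using assms[of n] by (simp add: abs_mult mult_left_mono)
  have sB: "summable (\<lambda>n. (1 / 2) ^ n * B)" using geo by (rule summable_mult2)
  show "summable (\<lambda>n. (1 / 2) ^ n * f n)"
    using le sB by (rule summable_comparison_test'[of _ 0, rotated])
  have "norm (suminf (\<lambda>n. (1 / 2) ^ n * f n)) \<le> (suminf (\<lambda>n. (1 / 2) ^ n * B))"
    using le sB by (rule norm_suminf_le)
  also have "\<dots> = (suminf (\<lambda>n. (1 / 2) ^ n)) * B" by (rule suminf_mult2[OF geo, symmetric])
  also have "\<dots> = 2 * B" by (simp add: suminf_geometric)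
  finally show "\<bar>suminf (\<lambda>n. (1 / 2) ^ n * f n)\<bar> \<le> 2 * B" by simp
qed

section \<open>Total boundedness of the support of a compact set\<close>

context free_lcs_over
begin

abbreviation support_of :: "'v set \<Rightarrow> 'a set" where
  "support_of A \<equiv> \<Union>a\<in>A. supp a"

lemma support_of_subset: "A \<subseteq> topspace L \<Longrightarrow> support_of A \<subseteq> topspace X"
  using supp_subset by blast

text \<open>Otherwise a greedy choice yields a sequence in the support in which no earlier term is
  \<open>E\<close>-related to a later one. Small neighbourhoods of its terms are locally finite, yet
  each of them meets the support, against the gliding hump result.\<close>

lemma totally_bounded_support_of:
  assumes U: "is_uniformity_on (topspace X) U" "topology_of_uniformity (topspace X) U = X"
    and A: "compactin L A"
  shows "totally_bounded_on U (support_of A)"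
proof (rule ccontr)
  let ?S = "support_of A"
  have SX: "?S \<subseteq> topspace X" using compactin_subset_topspace[OF A] by (rule support_of_subset)
  assume "\<not> totally_bounded_on U ?S"
  then obtain E where E: "eventually E U"
    and no: "\<not> (\<exists>F. finite F \<and> F \<subseteq> ?S \<and> (\<forall>y\<in>?S. \<exists>x\<in>F. E (x, y)))"
    unfolding totally_bounded_on_def by (simp only: not_all not_imp) (elim exE conjE)
  have separated: "\<exists>y\<in>?S. \<forall>x\<in>F. \<not> E (x, y)" if "finite F" "F \<subseteq> ?S" for F
  proof (rule ccontr)
    assume "\<not> (\<exists>y\<in>?S. \<forall>x\<in>F. \<not> E (x, y))"
    then have "\<forall>y\<in>?S. \<exists>x\<in>F. E (x, y)" by simp
    with that have "\<exists>F. finite F \<and> F \<subseteq> ?S \<and> (\<forall>y\<in>?S. \<exists>x\<in>F. E (x, y))"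
      by (intro exI[of _ F] conjI)
    with no show False by (rule notE)
  qed
  obtain D where D: "eventually D U" "\<And>x y. D (x, y) \<Longrightarrow> D (y, x)"
    "\<And>x y z. D (x, y) \<Longrightarrow> D (y, z) \<Longrightarrow> E (x, z)"
    by (rule uniformity_symmetric_half[OF U(1) E]) blast
  \<comment> \<open>Two halvings of \<open>E\<close>: a common point of \<open>N (x n)\<close> and
    \<open>N z\<close> puts \<open>z\<close> within \<open>D\<close> of \<open>x n\<close>, and two
    such indices would make their terms \<open>E\<close>-close.\<close>
  obtain D' where D': "eventually D' U" "\<And>x y. D' (x, y) \<Longrightarrow> D' (y, x)"
    "\<And>x y z. D' (x, y) \<Longrightarrow> D' (y, z) \<Longrightarrow> D (x, z)"
    by (rule uniformity_symmetric_half[OF U(1) D(1)]) blast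
  have "\<exists>x. \<forall>n::nat. x n \<in> ?S \<and> (\<forall>m<n. \<not> E (x m, x n))"
  proof (rule dependent_wellorder_choice)
    fix n :: nat and f :: "nat \<Rightarrow> 'a"
    assume f: "\<And>m. m < n \<Longrightarrow> f m \<in> ?S \<and> (\<forall>k<m. \<not> E (f k, f m))"
    have "f ` {..<n} \<subseteq> ?S"
      by (rule image_subsetI) (use f in \<open>simp only: lessThan_iff\<close>)
    then obtain r where "r \<in> ?S" "\<forall>y\<in>f ` {..<n}. \<not> E (y, r)"
      using separated[of "f ` {..<n}"] by blast
    then show "\<exists>r. r \<in> ?S \<and> (\<forall>m<n. \<not> E (f m, r))"
      by (intro exI[of _ r]) simp
  qed auto
  then obtain x where xE: "\<forall>n::nat. x n \<in> ?S \<and> (\<forall>m<n. \<not> E (x m, x n))" ..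
  have x: "x n \<in> ?S" for n by (rule conjunct1[OF spec[OF xE]])
  have xs: "\<not> E (x m, x n)" if "m < n" for m n
    using conjunct2[OF spec[OF xE]] that by blast
  define N where "N y = X interior_of {z \<in> topspace X. D' (y, z)}" for y
  have N: "y \<in> N y" if "y \<in> topspace X" for y
    using uniformity_neighbourhood[OF U(1) D'(1) that] by (simp add: N_def U(2))
  have ND: "D' (y, z)" if "z \<in> N y" for y z
    using that interior_of_subset[of X "{z \<in> topspace X. D' (y, z)}"] by (auto simp: N_def)
  have lf: "locally_finite_seq X (\<lambda>n. N (x n))"
    unfolding locally_finite_seq_def
  proof
    fix z assume z: "z \<in> topspace X"
    have near: "D (x n, z)" if "N (x n) \<inter> N z \<noteq> {}" for n
      using that ND D'(2,3) by blast
    have not_less: "\<not> m < n" if "N (x m) \<inter> N z \<noteq> {}" "N (x n) \<inter> N z \<noteq> {}" for m n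
      using near[OF that(1)] near[OF that(2)] D(2,3) xs by blast
    have "finite {n. N (x n) \<inter> N z \<noteq> {}}"
    proof (cases "{n. N (x n) \<inter> N z \<noteq> {}} = {}")
      case False
      then obtain m where m: "N (x m) \<inter> N z \<noteq> {}" by blast
      have "{n. N (x n) \<inter> N z \<noteq> {}} \<subseteq> {m}"
      proof
        fix n assume "n \<in> {n. N (x n) \<inter> N z \<noteq> {}}"
        then have n: "N (x n) \<inter> N z \<noteq> {}" by simp
        show "n \<in> {m}" using not_less[OF m n] not_less[OF n m] by simp
      qed
      then show ?thesis using finite_subset by blast
    qed simp
    then show "\<exists>W. openin X W \<and> z \<in> W \<and> finite {n. N (x n) \<inter> W \<noteq> {}}"
      using N[OF z] by (intro exI[of _ "N z"]) (simp add: N_def)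
  qed
  have "finite {n. N (x n) \<inter> ?S \<noteq> {}}"
    using lf by (intro compactin_meets_locally_finite_seq[OF A]) (simp add: N_def)
  moreover have "N (x n) \<inter> ?S \<noteq> {}" for n
    using IntI[OF N[OF subsetD[OF SX x]] x, of n] by (metis empty_iff)
  then have "{n. N (x n) \<inter> ?S \<noteq> {}} = UNIV"
    by (simp only: simp_thms Collect_const if_True)
  ultimately show False by simp
qed

lemma compactin_closure_of_support_of:
  assumes "Dieudonne_complete X" and A: "compactin L A"
  shows "compactin X (X closure_of support_of A)"
proof -
  obtain U where "is_universal_uniformity X U" and comp: "complete_uniformity_on (topspace X) U"
    using assms(1) unfolding Dieudonne_complete_def by blast
  then have U: "is_uniformity_on (topspace X) U" "topology_of_uniformity (topspace X) U = X"
    by (auto simp: is_universal_uniformity_def)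
  have "totally_bounded_on U (X closure_of support_of A)"
    using totally_bounded_on_closure_of[OF U(1)] totally_bounded_support_of[OF U A]
      support_of_subset[OF compactin_subset_topspace[OF A]] by (simp add: U(2))
  then show ?thesis
    using compactin_complete_totally_bounded[OF U(1) comp] by (simp add: U(2))
qed

section \<open>The dual group as the space of continuous functions\<close>

abbreviation G :: "'v monoid" where
  "G \<equiv> additive_group L"

lemma carrier_G: "carrier G = topspace L"
  by (simp add: additive_group_def)

text \<open>\<open>chr\<close> and \<open>\<xi> \<mapsto> lam \<xi> \<circ> i\<close> are the mutually inverse identifications of \<open>C(X)\<close> with the dual group.\<close>

definition chr :: "('a \<Rightarrow> real) \<Rightarrow> 'v \<Rightarrow> complex" where
  "chr f = (\<lambda>v\<in>topspace L. cis (ext f v))"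

definition lam :: "('v \<Rightarrow> complex) \<Rightarrow> 'v \<Rightarrow> real" where
  "lam \<xi> = (SOME l. linear_on_set (topspace L) l \<and> continuous_map L euclideanreal l \<and>
     (\<forall>v\<in>topspace L. \<xi> v = cis (l v)))"

lemma
  assumes "\<xi> \<in> characters G L"
  shows lam_linear: "linear_on_set (topspace L) (lam \<xi>)"
    and lam_continuous: "continuous_map L euclideanreal (lam \<xi>)"
    and cis_lam: "v \<in> topspace L \<Longrightarrow> \<xi> v = cis (lam \<xi> v)"
proof -
  have "\<exists>l. linear_on_set (topspace L) l \<and> continuous_map L euclideanreal l \<and>
     (\<forall>v\<in>topspace L. \<xi> v = cis (l v))"
    by (rule character_lift[OF L assms]) blast
  then have "linear_on_set (topspace L) (lam \<xi>) \<and> continuous_map L euclideanreal (lam \<xi>) \<and>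
     (\<forall>v\<in>topspace L. \<xi> v = cis (lam \<xi> v))"
    unfolding lam_def by (rule someI_ex)
  then show "linear_on_set (topspace L) (lam \<xi>)" "continuous_map L euclideanreal (lam \<xi>)"
    "v \<in> topspace L \<Longrightarrow> \<xi> v = cis (lam \<xi> v)" by blast+
qed

lemma lam_unique:
  assumes \<xi>: "\<xi> \<in> characters G L" and l: "linear_on_set (topspace L) l"
    and eq: "\<And>v. v \<in> topspace L \<Longrightarrow> \<xi> v = cis (l v)" and v: "v \<in> topspace L"
  shows "lam \<xi> v = l v"
proof (rule cis_scale_inject)
  fix t :: real
  have tv: "t *\<^sub>R v \<in> topspace L" using v by (rule subspace_scale[OF L_subspace])
  have "cis (t * lam \<xi> v) = \<xi> (t *\<^sub>R v)"
    using cis_lam[OF \<xi> tv] linear_on_setD(2)[OF lam_linear[OF \<xi>] v] by simp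
  also have "\<dots> = cis (t * l v)" using eq[OF tv] linear_on_setD(2)[OF l v] by simp
  finally show "cis (t * lam \<xi> v) = cis (t * l v)" .
qed

lemma chr_character:
  assumes "continuous_map X euclideanreal f"
  shows "chr f \<in> characters G L"
  unfolding chr_def by (intro character_of_functional ext_linear ext_continuous assms L_subspace)

lemma lam_chr:
  assumes "continuous_map X euclideanreal f" "v \<in> topspace L"
  shows "lam (chr f) v = ext f v"
  using assms by (intro lam_unique chr_character ext_linear) (auto simp: chr_def)

lemma character_mult:
  assumes "\<xi> \<in> characters G L" "\<zeta> \<in> characters G L"
  shows "(\<lambda>v\<in>topspace L. \<xi> v * \<zeta> v) \<in> characters G L"
proof -
  have "linear_on_set (topspace L) (\<lambda>v. lam \<xi> v + lam \<zeta> v)"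
    using lam_linear[OF assms(1)] lam_linear[OF assms(2)]
    by (simp add: linear_on_set_def distrib_left)
  moreover have "continuous_map L euclideanreal (\<lambda>v. lam \<xi> v + lam \<zeta> v)"
    by (intro continuous_intros lam_continuous assms)
  ultimately have "(\<lambda>v\<in>topspace L. cis (lam \<xi> v + lam \<zeta> v)) \<in> characters G L"
    by (rule character_of_functional[OF _ _ L_subspace])
  moreover have "(\<lambda>v\<in>topspace L. cis (lam \<xi> v + lam \<zeta> v)) = (\<lambda>v\<in>topspace L. \<xi> v * \<zeta> v)"
    using assms by (intro restrict_ext) (simp add: cis_lam[of \<xi>] cis_lam[of \<zeta>] cis_mult)
  ultimately show ?thesis by simp
qed

lemma lam_mult:
  assumes \<xi>: "\<xi> \<in> characters G L" and \<zeta>: "\<zeta> \<in> characters G L" and v: "v \<in> topspace L"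
  shows "lam (\<lambda>v\<in>topspace L. \<xi> v * \<zeta> v) v = lam \<xi> v + lam \<zeta> v"
proof (rule lam_unique[OF character_mult[OF \<xi> \<zeta>] _ _ v])
  show "linear_on_set (topspace L) (\<lambda>v. lam \<xi> v + lam \<zeta> v)"
    using lam_linear[OF \<xi>] lam_linear[OF \<zeta>] by (simp add: linear_on_set_def distrib_left)
qed (simp add: cis_lam[OF \<xi>] cis_lam[OF \<zeta>] cis_mult)

text \<open>The compact test set consists of the segments from 0 to \<open>i x\<close> for
  \<open>x\<close> in \<open>K\<close>, a continuous image of \<open>{0..1} \<times> K\<close>. On
  whole segments closeness in the circle bounds the lifts themselves, not only modulo
  \<open>2 * pi\<close>.\<close>

lemma lam_uniformly_near:
  assumes K: "compactin X K" and e: "0 < e" "e < 2 * pi"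
  obtains K' \<delta> where "compactin L K'" "0 < \<delta>"
    "\<And>\<xi> \<zeta> x. \<xi> \<in> characters G L \<Longrightarrow> \<zeta> \<in> characters G L \<Longrightarrow>
       \<forall>v\<in>K'. dist (\<xi> v) (\<zeta> v) < \<delta> \<Longrightarrow> x \<in> K \<Longrightarrow> \<bar>lam \<xi> (i x) - lam \<zeta> (i x)\<bar> < e"
proof -
  define K' where "K' = (\<lambda>p. fst p *\<^sub>R i (snd p)) ` ({0..1} \<times> K)"
  have "continuous_map (prod_topology euclideanreal X) L (\<lambda>p. fst p *\<^sub>R i (snd p))"
    by (intro continuous_map_lcs_scale[OF L] continuous_map_fst
        continuous_map_compose[OF continuous_map_snd i_continuous, unfolded o_def])
  moreover have "compactin (prod_topology euclideanreal X) ({0..1} \<times> K)"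
    using K by (simp add: compactin_Times)
  ultimately have "compactin L K'" unfolding K'_def by (rule image_compactin[rotated])
  moreover have "0 < norm (cis e - 1)" using e by (rule norm_cis_minus_1_pos)
  moreover have "\<bar>lam \<xi> (i x) - lam \<zeta> (i x)\<bar> < e"
    if \<xi>: "\<xi> \<in> characters G L" and \<zeta>: "\<zeta> \<in> characters G L"
      and near: "\<forall>v\<in>K'. dist (\<xi> v) (\<zeta> v) < norm (cis e - 1)" and x: "x \<in> K" for \<xi> \<zeta> x
  proof (rule abs_less_if_cis_arc_near_1[OF e(1)])
    fix t :: real assume t: "0 \<le> t" "t \<le> 1"
    have ix: "i x \<in> topspace L" using x compactin_subset_topspace[OF K] i_in_L by blast
    have tx: "t *\<^sub>R i x \<in> topspace L" using ix by (rule subspace_scale[OF L_subspace])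
    have "t *\<^sub>R i x \<in> K'" using t x by (force simp: K'_def)
    then have "dist (\<xi> (t *\<^sub>R i x)) (\<zeta> (t *\<^sub>R i x)) < norm (cis e - 1)" using near by blast
    moreover have "\<xi> (t *\<^sub>R i x) = cis (t * lam \<xi> (i x))"
      using cis_lam[OF \<xi> tx] linear_on_setD(2)[OF lam_linear[OF \<xi>] ix] by simp
    moreover have "\<zeta> (t *\<^sub>R i x) = cis (t * lam \<zeta> (i x))"
      using cis_lam[OF \<zeta> tx] linear_on_setD(2)[OF lam_linear[OF \<zeta>] ix] by simp
    ultimately show "norm (cis (t * (lam \<xi> (i x) - lam \<zeta> (i x))) - 1) < norm (cis e - 1)"
      by (simp add: dist_norm norm_cis_diff right_diff_distrib)
  qed
  ultimately show thesis by (rule that)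
qed

lemma bicharactersI:
  assumes ext: "\<Phi> \<in> extensional (characters G L)"
    and unit: "\<And>\<xi>. \<xi> \<in> characters G L \<Longrightarrow> norm (\<Phi> \<xi>) = 1"
    and hom: "\<And>\<xi> \<zeta>. \<xi> \<in> characters G L \<Longrightarrow> \<zeta> \<in> characters G L \<Longrightarrow>
      \<Phi> (\<lambda>v\<in>topspace L. \<xi> v * \<zeta> v) = \<Phi> \<xi> * \<Phi> \<zeta>"
    and cont: "continuous_map (dual_topology G L) euclidean \<Phi>"
  shows "\<Phi> \<in> characters (dual_group G L) (dual_topology G L)"
proof -
  have "\<Phi> \<in> hom (dual_group G L) circle_group"
    using unit hom by (simp add: hom_def dual_group_def circle_group_def carrier_G Pi_def)
  moreover have "continuous_map (dual_topology G L) circle_topology \<Phi>"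
    using cont unit by (auto simp: continuous_map_in_subtopology topspace_dual_topology)
  ultimately show ?thesis using ext by (simp add: characters_def dual_group_def)
qed

lemma bicharacter_mult:
  assumes "\<Phi> \<in> characters (dual_group G L) (dual_topology G L)"
    "\<xi> \<in> characters G L" "\<zeta> \<in> characters G L"
  shows "\<Phi> (\<lambda>v\<in>topspace L. \<xi> v * \<zeta> v) = \<Phi> \<xi> * \<Phi> \<zeta>"
  using assms unfolding characters_def[of "dual_group G L"]
  by (simp add: hom_def dual_group_def circle_group_def carrier_G)

text \<open>The weighted sum involves all the \<open>x n\<close>, but evaluation at \<open>v\<close>
  depends on the finitely many points of \<open>supp v\<close>. A bump at some \<open>x m\<close>
  outside \<open>supp v\<close>, vanishing on \<open>supp v\<close>, tells the two apart. The sum is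
  continuous on the dual because lifts are uniformly controlled over the compact set
  \<open>K\<close>.\<close>

lemma compactin_finite_if_canonical_hom_surj:
  assumes surj: "characters (dual_group G L) (dual_topology G L) \<subseteq> canonical_hom G L ` topspace L"
    and K: "compactin X K"
  shows "finite K"
proof (rule ccontr)
  assume "infinite K"
  then obtain x :: "nat \<Rightarrow> 'a" where x: "inj x" "range x \<subseteq> K"
    using infinite_countable_subset by blast
  have KX: "K \<subseteq> topspace X" using K by (rule compactin_subset_topspace)
  have xX: "x n \<in> topspace X" for n using x(2) KX by blast
  have iK: "compactin L (i ` K)" using K i_continuous by (rule image_compactin)
  define s where "s \<xi> = (suminf (\<lambda>n. (1 / 2) ^ n * lam \<xi> (i (x n))))" for \<xi>
  have bdd: "\<exists>B. \<forall>n. \<bar>lam \<xi> (i (x n))\<bar> \<le> B" if \<xi>: "\<xi> \<in> characters G L" for \<xi>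
  proof -
    have "compact (lam \<xi> ` i ` K)" using image_compactin[OF iK lam_continuous[OF \<xi>]] by simp
    then obtain B where "\<forall>y\<in>lam \<xi> ` i ` K. norm y \<le> B"
      using compact_imp_bounded bounded_iff by blast
    then show ?thesis using x(2) by (intro exI[of _ B]) auto
  qed
  have sums: "summable (\<lambda>n. (1 / 2) ^ n * lam \<xi> (i (x n)))" if \<xi>: "\<xi> \<in> characters G L" for \<xi>
  proof -
    obtain B where "\<And>n. \<bar>lam \<xi> (i (x n))\<bar> \<le> B" using bdd[OF \<xi>] by blast
    then show ?thesis by (rule half_powers_sum_bound(1))
  qed
  define \<Phi> where "\<Phi> = (\<lambda>\<xi>\<in>characters G L. cis (s \<xi>))"
  have "\<Phi> \<in> characters (dual_group G L) (dual_topology G L)"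
  proof (rule bicharactersI)
    fix \<xi> \<zeta> assume \<xi>: "\<xi> \<in> characters G L" and \<zeta>: "\<zeta> \<in> characters G L"
    have "s (\<lambda>v\<in>topspace L. \<xi> v * \<zeta> v) =
        (suminf (\<lambda>n. (1 / 2) ^ n * lam \<xi> (i (x n)) + (1 / 2) ^ n * lam \<zeta> (i (x n))))"
      unfolding s_def using i_in_L[OF xX] by (simp add: lam_mult[OF \<xi> \<zeta>] distrib_left)
    also have "\<dots> = s \<xi> + s \<zeta>"
      unfolding s_def by (rule suminf_add[OF sums[OF \<xi>] sums[OF \<zeta>], symmetric])
    finally show "\<Phi> (\<lambda>v\<in>topspace L. \<xi> v * \<zeta> v) = \<Phi> \<xi> * \<Phi> \<zeta>"
      using \<xi> \<zeta> by (simp add: \<Phi>_def character_mult cis_mult)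
  next
    show "continuous_map (dual_topology G L) euclidean \<Phi>"
    proof (rule continuous_map_from_dual_topology)
      fix \<phi> \<epsilon> assume \<phi>: "\<phi> \<in> characters G L" and \<epsilon>: "(0::real) < \<epsilon>"
      \<comment> \<open>Below \<open>2 * pi\<close> for the arc criterion, and with
        \<open>2 * e < \<epsilon>\<close> because the weights \<open>(1 / 2) ^ n\<close> add up to
        2.\<close>
      define e where "e = min 1 (\<epsilon> / 4)"
      have e: "0 < e" "e < 2 * pi" "2 * e < \<epsilon>"
        using \<epsilon> pi_gt3 by (auto simp: e_def min_def)
      obtain K' \<delta> where K': "compactin L K'" "0 < \<delta>"
        "\<And>\<xi> \<zeta> x. \<xi> \<in> characters G L \<Longrightarrow> \<zeta> \<in> characters G L \<Longrightarrow>
          \<forall>v\<in>K'. dist (\<xi> v) (\<zeta> v) < \<delta> \<Longrightarrow> x \<in> K \<Longrightarrow> \<bar>lam \<xi> (i x) - lam \<zeta> (i x)\<bar> < e"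
        by (rule lam_uniformly_near[OF K e(1,2)]) blast
      have "dist (\<Phi> \<psi>) (\<Phi> \<phi>) < \<epsilon>"
        if \<psi>: "\<psi> \<in> characters G L" "\<forall>v\<in>K'. dist (\<psi> v) (\<phi> v) < \<delta>" for \<psi>
      proof -
        have le: "\<bar>lam \<psi> (i (x n)) - lam \<phi> (i (x n))\<bar> \<le> e" for n
          using K'(3)[OF \<psi>(1) \<phi> \<psi>(2), of "x n"] x(2) by (simp add: range_subsetD less_imp_le)
        have "s \<psi> - s \<phi> = (suminf (\<lambda>n. (1 / 2) ^ n * (lam \<psi> (i (x n)) - lam \<phi> (i (x n)))))"
          unfolding s_def by (subst suminf_diff[OF sums[OF \<psi>(1)] sums[OF \<phi>]])
            (simp add: right_diff_distrib)
        then have "\<bar>s \<psi> - s \<phi>\<bar> \<le> 2 * e" using half_powers_sum_bound(2)[OF le] by simp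
        moreover have "dist (\<Phi> \<psi>) (\<Phi> \<phi>) \<le> \<bar>s \<psi> - s \<phi>\<bar>"
          using \<psi>(1) \<phi> norm_cis_minus_1_le[of "s \<psi> - s \<phi>"] by (simp add: \<Phi>_def dist_norm norm_cis_diff)
        ultimately show ?thesis using e(3) by linarith
      qed
      then show "\<exists>K \<delta>. compactin L K \<and> 0 < \<delta> \<and>
          (\<forall>\<psi>\<in>characters G L. (\<forall>v\<in>K. dist (\<psi> v) (\<phi> v) < \<delta>) \<longrightarrow> dist (\<Phi> \<psi>) (\<Phi> \<phi>) < \<epsilon>)"
        using K'(1,2) by blast
    qed
  qed (auto simp: \<Phi>_def)
  then obtain v where v: "v \<in> topspace L" "\<Phi> = canonical_hom G L v" using surj by blast
  have "infinite (range x)" using x(1) by (simp add: finite_image_iff)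
  then obtain m where m: "x m \<notin> supp v"
    using finite_supp[OF v(1)] by (meson finite_subset image_subsetI)
  obtain f :: "'a \<Rightarrow> real" where f: "continuous_map X euclideanreal f"
    "\<And>y. y \<in> topspace X \<Longrightarrow> 0 \<le> f y \<and> f y \<le> 1" "f (x m) = 1"
    "\<And>y. y \<in> topspace X \<Longrightarrow> y \<notin> topspace X \<or> y \<in> supp v - {x m} \<Longrightarrow> f y = 0"
    by (rule bump_function[OF openin_topspace xX finite_supp[OF v(1)]]) blast
  define s0 where "s0 = (suminf (\<lambda>n. (1 / 2) ^ n * f (x n)))"
  have "\<bar>f (x n)\<bar> \<le> 1" for n using f(2)[OF xX[of n]] by simp
  then have sum0: "summable (\<lambda>n. (1 / 2) ^ n * f (x n))" by (rule half_powers_sum_bound(1))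
  \<comment> \<open>Evaluation at \<open>f\<close> alone would only give \<open>cis s0 = 1\<close>;
    the multiples \<open>t * f\<close> force the real number \<open>s0\<close> itself to vanish,
    while the term at \<open>m\<close> makes it positive.\<close>
  have "s0 = 0"
  proof (rule cis_scale_inject)
    fix t :: real
    have tf: "continuous_map X euclideanreal (\<lambda>y. t * f y)" by (intro continuous_intros f(1)) simp
    have "s (chr (\<lambda>y. t * f y)) = (suminf (\<lambda>n. t * ((1 / 2) ^ n * f (x n))))"
      unfolding s_def by (simp add: lam_chr[OF tf i_in_L[OF xX]] ext_i[OF tf xX] mult.left_commute)
    also have "\<dots> = t * s0" unfolding s0_def by (rule suminf_mult[OF sum0])
    finally have 1: "s (chr (\<lambda>y. t * f y)) = t * s0" .
    have "ext (\<lambda>y. t * f y) v = (\<Sum>y\<in>supp v. cf v y * (t * f y))" by (rule ext_eq_sum_cf[OF tf v(1)])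
    also have "\<dots> = 0" using f(4) m supp_subset[OF v(1)] by (intro sum.neutral) auto
    finally have 2: "ext (\<lambda>y. t * f y) v = 0" .
    have "\<Phi> (chr (\<lambda>y. t * f y)) = chr (\<lambda>y. t * f y) v"
      unfolding v(2) canonical_hom_def using chr_character[OF tf] by simp
    moreover have "\<Phi> (chr (\<lambda>y. t * f y)) = cis (t * s0)"
      using chr_character[OF tf] 1 by (simp add: \<Phi>_def)
    moreover have "chr (\<lambda>y. t * f y) v = cis 0"
      using v(1) by (simp add: chr_def 2)
    ultimately have "cis (t * s0) = cis 0" by metis
    then show "cis (t * s0) = cis (t * 0)" by simp
  qed
  moreover have "0 < s0"
    unfolding s0_def
  proof (rule suminf_pos2[OF sum0])
    show "0 \<le> (1 / 2) ^ n * f (x n)" for n using f(2)[OF xX[of n]] by simp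
    show "0 < (1 / 2) ^ m * f (x m)" using f(3) by simp
  qed
  ultimately show False by simp
qed

text \<open>A neighbourhood of the trivial character restricts values at finitely many points of
  \<open>X\<close> only, so by point-finiteness it contains all but finitely many
  \<open>chr f\<close>. This makes \<open>C\<close> compact, and a neighbourhood of evaluation at
  \<open>i x0\<close> in the bidual controls all members of \<open>C\<close> at once.\<close>

lemma point_finite_family_equicontinuous:
  assumes cont: "continuous_map L (bidual_topology G L) (canonical_hom G L)"
    and fin: "\<forall>A. compactin L A \<longrightarrow> finite (support_of A)"
    and family: "\<forall>f\<in>\<F>. continuous_map X euclideanreal f \<and> f x0 = 0 \<and> (\<forall>x\<in>topspace X. 0 \<le> f x \<and> f x \<le> 1)"
    and point_finite: "\<forall>x\<in>topspace X. finite {f \<in> \<F>. f x \<noteq> 0}"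
    and x0: "x0 \<in> topspace X"
  shows "\<exists>W. openin X W \<and> x0 \<in> W \<and> (\<forall>f\<in>\<F>. \<forall>x\<in>W. f x < 1 / 2)"
proof -
  have \<F>: "f \<in> \<F> \<Longrightarrow> continuous_map X euclideanreal f"
      "f \<in> \<F> \<Longrightarrow> x \<in> topspace X \<Longrightarrow> 0 \<le> f x \<and> f x \<le> 1"
      "x \<in> topspace X \<Longrightarrow> finite {f \<in> \<F>. f x \<noteq> 0}"
      "f \<in> \<F> \<Longrightarrow> f x0 = 0" for f x
    using family point_finite by blast+
  have c0: "continuous_map X euclideanreal (\<lambda>_. 0)" by simp
  have ext0: "ext (\<lambda>_. 0) v = 0" if "v \<in> topspace L" for v
    using ext_eq_sum_cf[OF c0 that] by simp
  define C where "C = insert (chr (\<lambda>_. 0)) (chr ` \<F>)"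
  have C_chars: "C \<subseteq> characters G L" using chr_character \<F>(1) c0 by (auto simp: C_def)
  have cofinite: "finite {f \<in> \<F>. chr f \<notin> U}"
    if U: "openin (dual_topology G L) U" "chr (\<lambda>_. 0) \<in> U" for U
  proof -
    obtain K \<epsilon> where K: "compactin L K" "0 < \<epsilon>"
      "\<forall>\<psi>\<in>characters G L. (\<forall>x\<in>K. dist (\<psi> x) (chr (\<lambda>_. 0) x) < \<epsilon>) \<longrightarrow> \<psi> \<in> U"
      using U unfolding openin_dual_topology by blast
    have KL: "K \<subseteq> topspace L" using K(1) by (rule compactin_subset_topspace)
    have "chr f \<in> U" if f: "f \<in> \<F>" "\<forall>x\<in>support_of K. f x = 0" for f
    proof -
      have "chr f v = chr (\<lambda>_. 0) v" if v: "v \<in> K" for v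
      proof -
        have vL: "v \<in> topspace L" using v KL by blast
        have "ext f v = 0"
          using f(2) v by (subst ext_eq_sum_cf[OF \<F>(1)[OF f(1)] vL]) (auto intro!: sum.neutral)
        then show ?thesis using ext0[OF vL] by (simp add: chr_def)
      qed
      then show ?thesis using K(2,3) chr_character[OF \<F>(1)[OF f(1)]] by simp
    qed
    then have "{f \<in> \<F>. chr f \<notin> U} \<subseteq> (\<Union>x\<in>support_of K. {f \<in> \<F>. f x \<noteq> 0})" by blast
    moreover have "finite (\<Union>x\<in>support_of K. {f \<in> \<F>. f x \<noteq> 0})"
    proof (rule finite_UN_I[OF fin[rule_format, OF K(1)]])
      fix x assume "x \<in> support_of K"
      then have "x \<in> topspace X" using support_of_subset[OF KL] by blast
      then show "finite {f \<in> \<F>. f x \<noteq> 0}" by (rule \<F>(3))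
    qed
    ultimately show ?thesis by (rule finite_subset)
  qed
  have "compactin (dual_topology G L) C"
    unfolding compactin_def
  proof (intro conjI allI impI)
    show "C \<subseteq> topspace (dual_topology G L)" using C_chars by (simp add: topspace_dual_topology)
    fix \<U> assume \<U>: "Ball \<U> (openin (dual_topology G L)) \<and> C \<subseteq> \<Union>\<U>"
    then obtain U where U: "U \<in> \<U>" "chr (\<lambda>_. 0) \<in> U" by (auto simp: C_def)
    then have finB: "finite {f \<in> \<F>. chr f \<notin> U}" using \<U> by (intro cofinite) auto
    have "\<forall>f\<in>\<F>. \<exists>V\<in>\<U>. chr f \<in> V" using \<U> by (auto simp: C_def)
    then obtain V where V: "\<And>f. f \<in> \<F> \<Longrightarrow> V f \<in> \<U> \<and> chr f \<in> V f" by metis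
    show "\<exists>\<V>. finite \<V> \<and> \<V> \<subseteq> \<U> \<and> C \<subseteq> \<Union>\<V>"
      using finB U V by (intro exI[of _ "insert U (V ` {f \<in> \<F>. chr f \<notin> U})"]) (auto simp: C_def)
  qed
  note C = this
  let ?T = "bidual_topology G L"
  have "canonical_hom G L (i x0) \<in> topspace ?T"
    using cont i_in_L[OF x0] continuous_map_image_subset_topspace by blast
  then have bichar: "canonical_hom G L (i x0) \<in> characters (dual_group G L) (dual_topology G L)"
    by (simp add: bidual_topology_def topspace_dual_topology)
  have half: "0 < norm (cis (1 / 2) - 1)" using pi_gt3 by (intro norm_cis_minus_1_pos) auto
  obtain N where N: "openin ?T N" "canonical_hom G L (i x0) \<in> N"
    "\<And>\<psi> \<xi>. \<psi> \<in> N \<Longrightarrow> \<xi> \<in> C \<Longrightarrow> dist (\<psi> \<xi>) (canonical_hom G L (i x0) \<xi>) < norm (cis (1 / 2) - 1)"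
    unfolding bidual_topology_def by (rule dual_topology_neighbourhood[OF bichar C half]) blast
  have "continuous_map X ?T (canonical_hom G L \<circ> i)"
    using i_continuous cont by (rule continuous_map_compose)
  then have "openin X {x \<in> topspace X. (canonical_hom G L \<circ> i) x \<in> N}"
    using N(1) by (rule openin_continuous_map_preimage)
  moreover have "x0 \<in> {x \<in> topspace X. (canonical_hom G L \<circ> i) x \<in> N}"
    using x0 N(2) by simp
  moreover have "f x < 1 / 2"
    if f: "f \<in> \<F>" and x: "x \<in> {x \<in> topspace X. (canonical_hom G L \<circ> i) x \<in> N}" for f x
  proof (rule ccontr)
    assume "\<not> f x < 1 / 2"
    then have fx: "1 / 2 \<le> f x" "f x \<le> 1" using \<F>(2)[OF f, of x] x by auto
    have "chr f \<in> C" using f by (simp add: C_def)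
    then have "dist (canonical_hom G L (i x) (chr f)) (canonical_hom G L (i x0) (chr f)) < norm (cis (1 / 2) - 1)"
      using N(3) x by simp
    then have "norm (cis (f x) - 1) < norm (cis (1 / 2) - 1)"
      using chr_character[OF \<F>(1)[OF f]] x x0 i_in_L f
      by (simp add: canonical_hom_def chr_def ext_i[OF \<F>(1)[OF f]] dist_norm \<F>(4)[OF f])
    \<comment> \<open>For values in \<open>[0, 1]\<close> the chord length
      \<open>2 * sin (f x / 2)\<close> increases with \<open>f x\<close>, so closeness in the circle
      bounds \<open>f x\<close> without ambiguity.\<close>
    moreover have "sin (1 / 4) \<le> sin (f x / 2)"
      using fx pi_gt3 by (intro sin_monotone_2pi_le) auto
    moreover have "0 \<le> sin (1 / 4 :: real)" using pi_gt3 by (intro sin_ge_zero) auto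
    ultimately show False by (simp add: norm_cis_minus_1)
  qed
  ultimately show ?thesis by (intro exI[of _ "{x \<in> topspace X. (canonical_hom G L \<circ> i) x \<in> N}"]) blast
qed

end

section \<open>Reflexivity implies discreteness\<close>

lemma continuous_map_indicator_clopen:
  assumes "openin X U" "closedin X U"
  shows "continuous_map X euclideanreal (indicat_real U)"
  unfolding continuous_map_to_metric_space
proof (intro ballI allI impI)
  fix x and \<epsilon> :: real assume x: "x \<in> topspace X" and \<epsilon>: "0 < \<epsilon>"
  show "\<exists>N. openin X N \<and> x \<in> N \<and> (\<forall>y\<in>N. dist (indicat_real U y) (indicat_real U x) < \<epsilon>)"
  proof (cases "x \<in> U")
    case True
    then show ?thesis using assms(1) \<epsilon> by (intro exI[of _ U]) simp
  next
    case False
    then show ?thesis using assms(2) \<epsilon> x by (intro exI[of _ "topspace X - U"]) auto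
  qed
qed

text \<open>\<open>k\<close> is the last exponent before repeated doubling of \<open>s\<close>
  passes 1; one more doubling exceeds 1, so \<open>2 ^ k * s\<close> is above 1/2.\<close>

lemma dyadic_scaling:
  assumes "0 < s" "s \<le> (1::real)"
  obtains k where "1 / 2 \<le> 2 ^ k * s" "2 ^ k * s \<le> 1"
proof -
  obtain n where n: "1 / s < 2 ^ n" using real_arch_pow[of 2 "1 / s"] by auto
  have ex: "1 < 2 ^ n * s" using n assms(1) by (simp add: field_simps)
  define m where "m = (LEAST n. 1 < 2 ^ n * s)"
  have m: "1 < 2 ^ m * s" unfolding m_def using ex by (rule LeastI)
  have "m \<noteq> 0" using m assms(2) by (auto intro: Nat.gr0I)
  then obtain k where k: "m = Suc k" by (cases m) auto
  have "\<not> 1 < 2 ^ k * s"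
    using not_less_Least[of k "\<lambda>n. 1 < 2 ^ n * s"] k unfolding m_def by simp
  then show thesis using m k by (intro that[of k]) auto
qed

context free_lcs_over
begin

text \<open>The family consists of tents of height 1 over \<open>2 ^ k * f\<close>. Where
  \<open>f x > 0\<close>, only finitely many are nonzero, since \<open>2 ^ k * f x\<close> must stay
  below 2, but one of them is at least 1/2. So a neighbourhood of \<open>x0\<close> on which all
  tents are below 1/2 contains no such point.\<close>

lemma locally_zero:
  assumes cont: "continuous_map L (bidual_topology G L) (canonical_hom G L)"
    and fin: "\<forall>A. compactin L A \<longrightarrow> finite (support_of A)"
    and f: "continuous_map X euclideanreal f" "\<And>x. x \<in> topspace X \<Longrightarrow> 0 \<le> f x \<and> f x \<le> 1"
    and x0: "x0 \<in> topspace X" "f x0 = 0"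
  obtains W where "openin X W" "x0 \<in> W" "\<And>x. x \<in> W \<Longrightarrow> f x = 0"
proof -
  define g where "g k x = max 0 (1 - \<bar>2 ^ k * f x - 1\<bar>)" for k x
  have "continuous_map X euclideanreal (g k)" for k
    unfolding g_def by (intro continuous_intros f(1)) auto
  then have 1: "continuous_map X euclideanreal h" if "h \<in> range g" for h using that by blast
  have 2: "0 \<le> h x \<and> h x \<le> 1" if "h \<in> range g" for h x
    using that by (auto simp: g_def)
  have 3: "finite {h \<in> range g. h x \<noteq> 0}" if x: "x \<in> topspace X" for x
  proof (cases "f x = 0")
    case True
    then have "{h \<in> range g. h x \<noteq> 0} = {}" by (auto simp: g_def)
    then show ?thesis by (simp only: finite.emptyI)
  next
    case False
    then have pos: "0 < f x" using f(2)[OF x] by simp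
    have "{k. g k x \<noteq> 0} \<subseteq> {.. nat \<lceil>2 / f x\<rceil>}"
    proof
      fix k assume "k \<in> {k. g k x \<noteq> 0}"
      then have "\<not> 1 \<le> \<bar>2 ^ k * f x - 1\<bar>" by (auto simp: g_def)
      then have "2 ^ k * f x < 2" by linarith
      moreover have "real k * f x \<le> 2 ^ k * f x"
        using pos of_nat_less_two_power[of k, where 'a=real] by (intro mult_right_mono) auto
      ultimately have "real k * f x < 2" by linarith
      then have "real k < 2 / f x" using pos by (simp add: pos_less_divide_eq)
      then show "k \<in> {.. nat \<lceil>2 / f x\<rceil>}" by simp linarith
    qed
    then have "finite {k. g k x \<noteq> 0}" by (rule finite_subset) simp
    then have "finite (g ` {k. g k x \<noteq> 0})" by (rule finite_imageI)
    then show ?thesis by (rule rev_finite_subset) auto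
  qed
  have 4: "h x0 = 0" if "h \<in> range g" for h using that x0(2) by (auto simp: g_def)
  have "\<forall>h\<in>range g. continuous_map X euclideanreal h \<and> h x0 = 0 \<and> (\<forall>x\<in>topspace X. 0 \<le> h x \<and> h x \<le> 1)"
    using 1 2 4 by blast
  moreover have "\<forall>x\<in>topspace X. finite {h \<in> range g. h x \<noteq> 0}" using 3 by blast
  ultimately have "\<exists>W. openin X W \<and> x0 \<in> W \<and> (\<forall>h\<in>range g. \<forall>x\<in>W. h x < 1 / 2)"
    using x0(1) by (rule point_finite_family_equicontinuous[OF cont fin])
  then obtain W where W: "openin X W" "x0 \<in> W" "\<And>h x. h \<in> range g \<Longrightarrow> x \<in> W \<Longrightarrow> h x < 1 / 2"
    by blast
  have "f x = 0" if x: "x \<in> W" for x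
  proof (rule ccontr)
    assume "f x \<noteq> 0"
    moreover have "0 \<le> f x \<and> f x \<le> 1" using f(2) x openin_subset[OF W(1)] by blast
    ultimately have fx: "0 < f x" "f x \<le> 1" by auto
    obtain k where "1 / 2 \<le> 2 ^ k * f x" "2 ^ k * f x \<le> 1" by (rule dyadic_scaling[OF fx])
    then have "1 / 2 \<le> g k x" by (simp add: g_def)
    then show False using W(3)[OF rangeI x, of k] by simp
  qed
  then show thesis by (rule that[OF W(1,2)])
qed

text \<open>Local vanishing makes the cozero set of every bump clopen. One neighbourhood
  \<open>W\<close> of \<open>x0\<close> misses all members of a maximal disjoint family
  \<open>Z\<close>, since an indicator below 1/2 is 0. A second point of \<open>W\<close> would have
  a clopen cozero neighbourhood inside \<open>W\<close> missing \<open>x0\<close>, which could be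
  added to \<open>Z\<close>.\<close>

lemma isolated_points:
  assumes cont: "continuous_map L (bidual_topology G L) (canonical_hom G L)"
    and fin: "\<forall>A. compactin L A \<longrightarrow> finite (support_of A)"
    and x0: "x0 \<in> topspace X"
  shows "openin X {x0}"
proof -
  define P where "P U \<longleftrightarrow> openin X U \<and> closedin X U \<and> x0 \<notin> U \<and> U \<noteq> {}" for U
  define \<A> where "\<A> = {\<U>. (\<forall>U\<in>\<U>. P U) \<and> pairwise disjnt \<U>}"
  have "\<exists>Z\<in>\<A>. \<forall>\<U>\<in>\<A>. Z \<subseteq> \<U> \<longrightarrow> \<U> = Z"
  proof (rule subset_Zorn_nonempty)
    have "{} \<in> \<A>" by (simp add: \<A>_def)
    then show "\<A> \<noteq> {}" by blast
    fix \<C> assume \<C>: "\<C> \<noteq> {}" "subset.chain \<A> \<C>"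
    then have "pairwise disjnt (\<Union>\<C>)"
      by (intro pairwise_chain_Union) (auto simp: subset_chain_def chain_subset_def \<A>_def)
    moreover have "\<forall>U\<in>\<Union>\<C>. P U" using \<C>(2) unfolding subset_chain_def \<A>_def by blast
    ultimately show "\<Union>\<C> \<in> \<A>" by (simp add: \<A>_def)
  qed
  then obtain Z where Z: "Z \<in> \<A>" "\<And>\<U>. \<U> \<in> \<A> \<Longrightarrow> Z \<subseteq> \<U> \<Longrightarrow> \<U> = Z" by blast
  have ZP: "P U" if "U \<in> Z" for U using Z(1) that by (simp add: \<A>_def)
  have Zd: "disjnt U U'" if "U \<in> Z" "U' \<in> Z" "U \<noteq> U'" for U U'
    using Z(1) that by (simp add: \<A>_def pairwise_def)
  have 1: "continuous_map X euclideanreal h" if "h \<in> indicat_real ` Z" for h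
    using that ZP continuous_map_indicator_clopen by (auto simp: P_def)
  have 2: "0 \<le> h x \<and> h x \<le> 1" if "h \<in> indicat_real ` Z" for h x
    using that by (auto simp: indicator_def)
  have 3: "finite {h \<in> indicat_real ` Z. h x \<noteq> 0}" for x
  proof -
    have "finite {U \<in> Z. x \<in> U}"
    proof (cases "\<exists>U\<in>Z. x \<in> U")
      case True
      then obtain U where U: "U \<in> Z" "x \<in> U" by blast
      have "{U \<in> Z. x \<in> U} \<subseteq> {U}" using Zd U unfolding disjnt_def by blast
      then show ?thesis by (rule finite_subset) simp
    next
      case False
      then have "{U \<in> Z. x \<in> U} = {}" by blast
      then show ?thesis by (simp only: finite.emptyI)
    qed
    then have "finite (indicat_real ` {U \<in> Z. x \<in> U})" by (rule finite_imageI)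
    then show ?thesis by (rule rev_finite_subset) (auto simp: indicator_def)
  qed
  have 4: "h x0 = 0" if "h \<in> indicat_real ` Z" for h
    using that ZP by (auto simp: P_def)
  have "\<forall>h\<in>indicat_real ` Z. continuous_map X euclideanreal h \<and> h x0 = 0 \<and>
      (\<forall>x\<in>topspace X. 0 \<le> h x \<and> h x \<le> 1)"
    using 1 2 4 by blast
  moreover have "\<forall>x\<in>topspace X. finite {h \<in> indicat_real ` Z. h x \<noteq> 0}" using 3 by blast
  ultimately have "\<exists>W. openin X W \<and> x0 \<in> W \<and> (\<forall>h\<in>indicat_real ` Z. \<forall>x\<in>W. h x < 1 / 2)"
    using x0 by (rule point_finite_family_equicontinuous[OF cont fin])
  then obtain W where W: "openin X W" "x0 \<in> W" "\<And>h x. h \<in> indicat_real ` Z \<Longrightarrow> x \<in> W \<Longrightarrow> h x < 1 / 2"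
    by blast
  have WZ: "U \<inter> W = {}" if U: "U \<in> Z" for U
  proof -
    have "x \<notin> U" if "x \<in> W" for x
      using W(3)[OF imageI[OF U] that] by (auto simp: indicator_def split: if_splits)
    then show ?thesis by blast
  qed
  have "W = {x0}"
  proof (rule ccontr)
    assume "W \<noteq> {x0}"
    then obtain y where y: "y \<in> W" "y \<noteq> x0" using W(2) by blast
    obtain f :: "'a \<Rightarrow> real" where f: "continuous_map X euclideanreal f"
      "\<And>z. z \<in> topspace X \<Longrightarrow> 0 \<le> f z \<and> f z \<le> 1" "f y = 1"
      "\<And>z. z \<in> topspace X \<Longrightarrow> z \<notin> W \<or> z \<in> {x0} - {y} \<Longrightarrow> f z = 0"
      by (rule bump_function[OF W(1) y(1), of "{x0}"]) auto
    define C where "C = {z \<in> topspace X. f z \<in> - {0}}"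
    have "openin X C"
      unfolding C_def using f(1) by (rule openin_continuous_map_preimage) (simp add: open_Compl)
    moreover have "openin X (topspace X - C)"
    proof (subst openin_subopen, intro ballI)
      fix z assume "z \<in> topspace X - C"
      then have z: "z \<in> topspace X" "f z = 0" by (auto simp: C_def)
      obtain N where "openin X N" "z \<in> N" "\<And>x. x \<in> N \<Longrightarrow> f x = 0"
        by (rule locally_zero[OF cont fin f(1,2) z]) blast+
      then show "\<exists>N. openin X N \<and> z \<in> N \<and> N \<subseteq> topspace X - C"
        using openin_subset[of X N] by (intro exI[of _ N]) (auto simp: C_def)
    qed
    moreover have "C \<subseteq> topspace X" by (auto simp: C_def)
    moreover have x0C: "x0 \<notin> C" using f(4)[OF x0] y(2) by (simp add: C_def)
    moreover have yC: "y \<in> C" using f(3) y(1) openin_subset[OF W(1)] by (auto simp: C_def)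
    ultimately have PC: "P C" by (auto simp: P_def closedin_def)
    have CW: "C \<subseteq> W" using f(4) by (auto simp: C_def)
    have "disjnt C U" if "U \<in> Z" for U using WZ[OF that] CW by (auto simp: disjnt_def)
    then have "pairwise disjnt (insert C Z)"
      using Z(1) by (auto simp: pairwise_insert \<A>_def disjnt_sym)
    then have "insert C Z \<in> \<A>" using PC ZP by (simp add: \<A>_def)
    \<comment> \<open>By maximality \<open>C\<close> already belongs to \<open>Z\<close>, whose
      members miss \<open>W\<close>; yet \<open>y\<close> lies in both \<open>C\<close> and
      \<open>W\<close>.\<close>
    then have "insert C Z = Z" by (rule Z(2)) blast
    then have "C \<in> Z" by blast
    then show False using WZ[of C] CW yC by blast
  qed
  then show ?thesis using W(1) by simp
qed

lemma discrete_if_reflexive: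
  assumes D: "Dieudonne_complete X" and R: "reflexive_group G L"
  shows "X = discrete_topology (topspace X)"
proof -
  have hom: "homeomorphic_map L (bidual_topology G L) (canonical_hom G L)"
    using R by (simp add: reflexive_group_def)
  have cont: "continuous_map L (bidual_topology G L) (canonical_hom G L)"
    using hom by (rule homeomorphic_imp_continuous_map)
  have "canonical_hom G L ` topspace L = topspace (bidual_topology G L)"
    using hom by (rule homeomorphic_imp_surjective_map)
  then have surj: "characters (dual_group G L) (dual_topology G L) \<subseteq> canonical_hom G L ` topspace L"
    by (simp add: bidual_topology_def topspace_dual_topology)
  have fin: "\<forall>A. compactin L A \<longrightarrow> finite (support_of A)"
  proof (intro allI impI)
    fix A assume A: "compactin L A"
    have "finite (X closure_of support_of A)"
      by (rule compactin_finite_if_canonical_hom_surj[OF surj compactin_closure_of_support_of[OF D A]])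
    moreover have "support_of A \<subseteq> X closure_of support_of A"
      using support_of_subset[OF compactin_subset_topspace[OF A]] by (rule closure_of_subset)
    ultimately show "finite (support_of A)" by (rule rev_finite_subset)
  qed
  have "\<forall>x\<in>topspace X. openin X {x}"
  proof
    fix x assume x: "x \<in> topspace X"
    show "openin X {x}" by (rule isolated_points[OF cont fin x])
  qed
  then show ?thesis using discrete_topology_unique[of "topspace X" X] by auto
qed

end

section \<open>Discreteness implies reflexivity\<close>

text \<open>Supplies normed spaces carried by a given subspace, as test objects for the universal
  property.\<close>

lemma locally_convex_space_of_norm:
  fixes W :: "'v::real_vector set"
  assumes W: "subspace W"
    and nonneg: "\<And>v. v \<in> W \<Longrightarrow> 0 \<le> q v"
    and zero: "\<And>v. v \<in> W \<Longrightarrow> q v = 0 \<longleftrightarrow> v = 0"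
    and scale: "\<And>c v. v \<in> W \<Longrightarrow> q (c *\<^sub>R v) = \<bar>c\<bar> * q v"
    and triangle: "\<And>v w. v \<in> W \<Longrightarrow> w \<in> W \<Longrightarrow> q (v + w) \<le> q v + q w"
  obtains E where "locally_convex_space E" "topspace E = W"
    "\<And>e. openin E {v \<in> W. q v < e}"
proof -
  note WD = subspace_add[OF W] subspace_diff[OF W] subspace_scale[OF W] subspace_neg[OF W]
  \<comment> \<open>\<open>Metric_space\<close> asks for nonnegativity and symmetry on the whole
    type, while \<open>q\<close> is controlled only on \<open>W\<close>; hence the value 0
    elsewhere.\<close>
  define d where "d v w = (if v \<in> W \<and> w \<in> W then q (v - w) else 0)" for v w
  have q0: "q 0 = 0" using zero[OF subspace_0[OF W]] by simp
  have minus: "q (- v) = q v" if "v \<in> W" for v using scale[OF that, of "-1"] by simp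
  have d_eq: "d v w = q (v - w)" if "v \<in> W" "w \<in> W" for v w using that by (simp add: d_def)
  interpret M: Metric_space W d
  proof
    show "0 \<le> d x y" for x y using nonneg WD by (simp add: d_def)
    show "d x y = d y x" for x y using minus[of "x - y"] WD by (simp add: d_def)
    show "d x y = 0 \<longleftrightarrow> x = y" if "x \<in> W" "y \<in> W" for x y
      using zero[of "x - y"] that WD by (simp add: d_eq)
    show "d x z \<le> d x y + d y z" if "x \<in> W" "y \<in> W" "z \<in> W" for x y z
      using triangle[of "x - y" "y - z"] that WD by (simp add: d_eq)
  qed
  let ?E = "M.mtopology"
  have ball: "openin ?E {v \<in> W. q (v - w) < e}" if w: "w \<in> W" for w e
  proof -
    have "q (w - v) = q (v - w)" if "v \<in> W" for v using minus[of "v - w"] that w WD by simp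
    then have "M.mball w e = {v \<in> W. q (v - w) < e}"
      using w by (auto simp: M.in_mball d_eq)
    then show ?thesis using M.openin_mball[of w e] by simp
  qed
  have tE: "topspace ?E = W" by simp
  have add: "continuous_map (prod_topology ?E ?E) ?E (\<lambda>(x, y). x + y)"
    unfolding M.continuous_map_to_metric
  proof (intro ballI allI impI)
    fix p and e :: real assume p: "p \<in> topspace (prod_topology ?E ?E)" and e: "0 < e"
    obtain a b where ab: "p = (a, b)" "a \<in> W" "b \<in> W" using p by auto
    let ?U = "{v \<in> W. q (v - a) < e / 2} \<times> {v \<in> W. q (v - b) < e / 2}"
    have "openin (prod_topology ?E ?E) ?U"
      unfolding openin_prod_Times_iff using ball[OF ab(2)] ball[OF ab(3)] by blast
    moreover have "p \<in> ?U" using ab e q0 by simp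
    moreover have "(case y of (x, y) \<Rightarrow> x + y) \<in> M.mball (case p of (x, y) \<Rightarrow> x + y) e" if y: "y \<in> ?U" for y
    proof -
      obtain u v where uv: "y = (u, v)" "u \<in> W" "v \<in> W" "q (u - a) < e / 2" "q (v - b) < e / 2"
        using y by auto
      have "q ((a + b) - (u + v)) = q ((u - a) + (v - b))"
        using minus[of "(u - a) + (v - b)"] uv ab WD by (simp add: algebra_simps)
      also have "\<dots> \<le> q (u - a) + q (v - b)" using uv ab WD by (intro triangle) auto
      finally show ?thesis using uv ab WD by (simp add: M.in_mball d_eq)
    qed
    ultimately show "\<exists>U. openin (prod_topology ?E ?E) U \<and> p \<in> U \<and>
        (\<forall>y\<in>U. (case y of (x, y) \<Rightarrow> x + y) \<in> M.mball (case p of (x, y) \<Rightarrow> x + y) e)"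
      by blast
  qed
  have scl: "continuous_map (prod_topology euclideanreal ?E) ?E (\<lambda>(c, x). c *\<^sub>R x)"
    unfolding M.continuous_map_to_metric
  proof (intro ballI allI impI)
    fix p and e :: real assume p: "p \<in> topspace (prod_topology euclideanreal ?E)" and e: "0 < e"
    obtain c a where ca: "p = (c, a)" "a \<in> W" using p by auto
    \<comment> \<open>The difference of the products is
      \<open>(k - c) *\<^sub>R a + k *\<^sub>R (v - a)\<close>; each summand gets
      \<open>e / 2\<close>, with \<open>|k| \<le> |c| + r\<close>. The added 1 keeps the denominator
      of \<open>r\<close> positive and the second estimate strict.\<close>
    define r where "r = e / 2 / (q a + 1)"
    define s where "s = e / 2 / (\<bar>c\<bar> + r + 1)"
    have qa: "0 \<le> q a" using nonneg ca by simp
    have r: "0 < r" using e qa by (simp add: r_def)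
    have s: "0 < s" using e r by (simp add: s_def)
    let ?U = "ball c r \<times> {v \<in> W. q (v - a) < s}"
    have "openin (prod_topology euclideanreal ?E) ?U"
      using ball[OF ca(2), of s] by (simp add: openin_prod_Times_iff)
    moreover have "p \<in> ?U" using ca r s q0 by simp
    moreover have "(case y of (c, x) \<Rightarrow> c *\<^sub>R x) \<in> M.mball (case p of (c, x) \<Rightarrow> c *\<^sub>R x) e" if y: "y \<in> ?U" for y
    proof -
      obtain k v where kv: "y = (k, v)" "\<bar>k - c\<bar> < r" "v \<in> W" "q (v - a) < s"
        using y by (auto simp: dist_real_def abs_minus_commute)
      have "q (c *\<^sub>R a - k *\<^sub>R v) = q ((k - c) *\<^sub>R a + k *\<^sub>R (v - a))"
        using minus[of "(k - c) *\<^sub>R a + k *\<^sub>R (v - a)"] kv ca WD by (simp add: algebra_simps)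
      also have "\<dots> \<le> \<bar>k - c\<bar> * q a + \<bar>k\<bar> * q (v - a)"
        using triangle[of "(k - c) *\<^sub>R a" "k *\<^sub>R (v - a)"] kv ca WD by (simp add: scale)
      also have "\<dots> < e / 2 + e / 2"
      proof (rule add_le_less_mono)
        have "\<bar>k - c\<bar> * q a \<le> r * (q a + 1)"
          using kv qa r by (intro mult_mono) auto
        also have "r * (q a + 1) = e / 2"
          unfolding r_def by (rule nonzero_eq_divide_eq[THEN iffD1, OF _ refl]) (use qa in simp)
        finally show "\<bar>k - c\<bar> * q a \<le> e / 2" .
        have "\<bar>k\<bar> * q (v - a) \<le> (\<bar>c\<bar> + r) * q (v - a)"
          using kv nonneg[of "v - a"] ca WD by (intro mult_right_mono) auto
        also have "\<dots> \<le> (\<bar>c\<bar> + r) * s" using kv r by (intro mult_left_mono) auto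
        also have "\<dots> < (\<bar>c\<bar> + r + 1) * s" using s by (intro mult_strict_right_mono) auto
        also have "(\<bar>c\<bar> + r + 1) * s = e / 2"
          unfolding s_def mult.commute[of "\<bar>c\<bar> + r + 1"]
          by (rule nonzero_eq_divide_eq[THEN iffD1, OF _ refl]) (use r in simp)
        finally show "\<bar>k\<bar> * q (v - a) < e / 2" .
      qed
      finally show ?thesis using kv ca WD by (simp add: M.in_mball d_eq)
    qed
    ultimately show "\<exists>U. openin (prod_topology euclideanreal ?E) U \<and> p \<in> U \<and>
        (\<forall>y\<in>U. (case y of (c, x) \<Rightarrow> c *\<^sub>R x) \<in> M.mball (case p of (c, x) \<Rightarrow> c *\<^sub>R x) e)"
      by blast
  qed
  have base: "neighbourhood_base_at 0 convex ?E"
    unfolding neighbourhood_base_at_def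
  proof (intro allI impI)
    fix S assume S: "openin ?E S \<and> 0 \<in> S"
    then obtain e where e: "0 < e" "M.mball 0 e \<subseteq> S" unfolding M.openin_mtopology by blast
    have mb: "M.mball 0 e = {v \<in> W. q v < e}"
      using subspace_0[OF W] minus by (auto simp: M.in_mball d_eq)
    have "convex {v \<in> W. q v < e}"
      unfolding convex_def
    proof (intro ballI allI impI)
      fix x y and u v :: real assume xy: "x \<in> {v \<in> W. q v < e}" "y \<in> {v \<in> W. q v < e}"
        and uv: "0 \<le> u" "0 \<le> v" "u + v = 1"
      have "q (u *\<^sub>R x + v *\<^sub>R y) \<le> u * q x + v * q y"
        using triangle[of "u *\<^sub>R x" "v *\<^sub>R y"] xy uv WD by (simp add: scale)
      also have "\<dots> < e" using xy uv by (intro convex_bound_lt) auto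
      finally show "u *\<^sub>R x + v *\<^sub>R y \<in> {v \<in> W. q v < e}" using xy WD by simp
    qed
    then show "\<exists>U V. openin ?E U \<and> convex V \<and> 0 \<in> U \<and> U \<subseteq> V \<and> V \<subseteq> S"
      using e mb ball[OF subspace_0[OF W], of e] subspace_0[OF W] q0
      by (intro exI[of _ "{v \<in> W. q v < e}"]) auto
  qed
  have "locally_convex_space ?E"
    unfolding locally_convex_space_def tE
    using W add scl base M.Hausdorff_space_mtopology by simp
  moreover have "openin ?E {v \<in> W. q v < e}" for e
    using ball[OF subspace_0[OF W], of e] by simp
  ultimately show thesis using that[of ?E] tE by blast
qed

text \<open>Normalising the weights gives a point of \<open>V\<close>; since their sum
  \<open>s\<close> is at most 1, scaling back by \<open>s\<close> moves it towards 0, which also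
  lies in \<open>V\<close>.\<close>

lemma convex_contains_subconvex_combination:
  fixes V :: "'v::real_vector set"
  assumes V: "convex V" "0 \<in> V" and F: "finite F"
    and a: "\<And>x. x \<in> F \<Longrightarrow> 0 \<le> a x" "(\<Sum>x\<in>F. a x) \<le> 1"
    and y: "\<And>x. x \<in> F \<Longrightarrow> y x \<in> V"
  shows "(\<Sum>x\<in>F. a x *\<^sub>R y x) \<in> V"
proof (cases "(\<Sum>x\<in>F. a x) = 0")
  case True
  then have "\<And>x. x \<in> F \<Longrightarrow> a x = 0" using F a(1) by (simp add: sum_nonneg_eq_0_iff)
  then show ?thesis using V(2) by simp
next
  case False
  define s where "s = (\<Sum>x\<in>F. a x)"
  have s: "0 < s" "s \<le> 1" using False a sum_nonneg[of F a] by (auto simp: s_def less_le)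
  have "(\<Sum>x\<in>F. (a x / s) *\<^sub>R y x) \<in> V"
    using F V(1) a(1) y s by (intro convex_sum) (auto simp: sum_divide_distrib[symmetric] s_def[symmetric])
  then have "(1 - s) *\<^sub>R 0 + s *\<^sub>R (\<Sum>x\<in>F. (a x / s) *\<^sub>R y x) \<in> V"
    using s V by (intro convexD) auto
  then show ?thesis using s by (simp add: scaleR_sum_right)
qed

section \<open>Evaluations as characters of the dual\<close>

context free_lcs_over
begin

text \<open>Both choices are made from the same predicate, so they agree as functions, outside the
  carrier too.\<close>

lemma ext_cong:
  assumes "\<And>x. x \<in> topspace X \<Longrightarrow> f x = g x"
  shows "ext f = ext g"
proof -
  have "(\<forall>x\<in>topspace X. h (i x) = f x) \<longleftrightarrow> (\<forall>x\<in>topspace X. h (i x) = g x)" for h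
    using assms by simp
  then show ?thesis unfolding ext_def by presburger
qed

lemma canonical_hom_bicharacter:
  assumes v: "v \<in> topspace L"
  shows "canonical_hom G L v \<in> characters (dual_group G L) (dual_topology G L)"
proof (rule bicharactersI)
  show "continuous_map (dual_topology G L) euclidean (canonical_hom G L v)"
  proof (rule continuous_map_from_dual_topology)
    fix \<phi> and \<epsilon> :: real assume "\<phi> \<in> characters G L" "0 < \<epsilon>"
    then show "\<exists>K \<delta>. compactin L K \<and> 0 < \<delta> \<and> (\<forall>\<psi>\<in>characters G L.
        (\<forall>x\<in>K. dist (\<psi> x) (\<phi> x) < \<delta>) \<longrightarrow> dist (canonical_hom G L v \<psi>) (canonical_hom G L v \<phi>) < \<epsilon>)"
      using v by (intro exI[of _ "{v}"] exI[of _ \<epsilon>]) (simp add: canonical_hom_def)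
  qed
qed (use v in \<open>auto simp: canonical_hom_def character_mult intro: character_in_sphere\<close>)

lemma lam_eq_sum_cf:
  assumes "\<xi> \<in> characters G L" "v \<in> topspace L"
  shows "lam \<xi> v = (\<Sum>x\<in>supp v. cf v x * lam \<xi> (i x))"
  using linear_eq_sum_cf[OF lam_linear[OF assms(1)] assms(2)] by simp

lemma lam_at_generator_continuous:
  assumes x: "x \<in> topspace X"
  shows "continuous_map (dual_topology G L) euclideanreal (\<lambda>\<xi>. lam \<xi> (i x))"
proof (rule continuous_map_from_dual_topology)
  fix \<phi> and \<epsilon> :: real assume \<phi>: "\<phi> \<in> characters G L" and \<epsilon>: "0 < \<epsilon>"
  define e where "e = min \<epsilon> 1"
  have e: "0 < e" "e < 2 * pi" "e \<le> \<epsilon>" using \<epsilon> pi_gt3 by (auto simp: e_def)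
  have K: "compactin X {x}" using x by simp
  obtain K' \<delta> where K': "compactin L K'" "0 < \<delta>"
    "\<And>\<xi> \<zeta> y. \<xi> \<in> characters G L \<Longrightarrow> \<zeta> \<in> characters G L \<Longrightarrow>
      \<forall>v\<in>K'. dist (\<xi> v) (\<zeta> v) < \<delta> \<Longrightarrow> y \<in> {x} \<Longrightarrow> \<bar>lam \<xi> (i y) - lam \<zeta> (i y)\<bar> < e"
    by (rule lam_uniformly_near[OF K e(1,2)]) blast
  have "dist (lam \<psi> (i x)) (lam \<phi> (i x)) < \<epsilon>"
    if "\<psi> \<in> characters G L" "\<forall>v\<in>K'. dist (\<psi> v) (\<phi> v) < \<delta>" for \<psi>
    using K'(3)[OF that(1) \<phi> that(2), of x] e(3) by (simp add: dist_real_def)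
  then show "\<exists>K \<delta>. compactin L K \<and> 0 < \<delta> \<and> (\<forall>\<psi>\<in>characters G L.
      (\<forall>v\<in>K. dist (\<psi> v) (\<phi> v) < \<delta>) \<longrightarrow> dist (lam \<psi> (i x)) (lam \<phi> (i x)) < \<epsilon>)"
    using K'(1,2) by blast
qed

end

section \<open>Weighted norms on the free space over a discrete space\<close>

locale free_lcs_over_discrete = free_lcs_over X L i
  for X :: "'a topology" and L :: "'v::real_vector topology" and i :: "'a \<Rightarrow> 'v" +
  assumes discrete: "X = discrete_topology (topspace X)"
begin

lemma continuous_on_X [simp]: "continuous_map X euclideanreal f"
  by (subst discrete) simp

lemma openin_X: "openin X U \<longleftrightarrow> U \<subseteq> topspace X"
  by (subst discrete) simp

text \<open>Distinct points of a discrete space form a locally finite sequence of open singletons,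
  to which the gliding hump result applies.\<close>

lemma finite_support_of_compactin:
  assumes A: "compactin L A"
  shows "finite (support_of A)"
proof (rule ccontr)
  assume "infinite (support_of A)"
  then obtain x :: "nat \<Rightarrow> 'a" where x: "inj x" "range x \<subseteq> support_of A"
    using infinite_countable_subset by blast
  have sX: "support_of A \<subseteq> topspace X" by (rule support_of_subset[OF compactin_subset_topspace[OF A]])
  have "locally_finite_seq X (\<lambda>n. {x n})"
    unfolding locally_finite_seq_def
  proof
    fix y assume y: "y \<in> topspace X"
    have "finite (x -` {y})" using x(1) by (intro finite_vimageI) auto
    then have "finite {n. {x n} \<inter> {y} \<noteq> {}}" by (rule rev_finite_subset) auto
    then show "\<exists>W. openin X W \<and> y \<in> W \<and> finite {n. {x n} \<inter> W \<noteq> {}}"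
      using y by (intro exI[of _ "{y}"]) (simp add: openin_X)
  qed
  moreover have "openin X {x n}" for n using x(2) sX openin_X by blast
  ultimately have "finite {n. {x n} \<inter> support_of A \<noteq> {}}"
    by (intro compactin_meets_locally_finite_seq[OF A])
  moreover have "{x n} \<inter> support_of A \<noteq> {}" for n using x(2) by blast
  then have "{n. {x n} \<inter> support_of A \<noteq> {}} = UNIV"
    by (simp only: simp_thms Collect_const if_True)
  ultimately show False by simp
qed

text \<open>The indicator of a point is continuous here, and its extension reads off one coordinate.
  The coefficients, so far an arbitrary choice, thereby become linear in \<open>v\<close>.\<close>

lemma cf_eq_ext:
  assumes "v \<in> topspace L"
  shows "cf v x = ext (indicat_real {x}) v"
proof -
  have "ext (indicat_real {x}) v = (\<Sum>y\<in>supp v. if y = x then cf v x else 0)"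
    using ext_eq_sum_cf[OF continuous_on_X assms] by (auto intro!: sum.cong simp: indicator_def)
  also have "\<dots> = cf v x" using finite_supp[OF assms] by (simp add: supp_def)
  finally show ?thesis by simp
qed

lemma cf_add: "v \<in> topspace L \<Longrightarrow> w \<in> topspace L \<Longrightarrow> cf (v + w) x = cf v x + cf w x"
  by (simp add: cf_eq_ext subspace_add[OF L_subspace] linear_on_setD(1)[OF ext_linear])

lemma cf_scale: "v \<in> topspace L \<Longrightarrow> cf (c *\<^sub>R v) x = c * cf v x"
  by (simp add: cf_eq_ext subspace_scale[OF L_subspace] linear_on_setD(2)[OF ext_linear])

lemma eq_0_iff_cf:
  assumes "v \<in> topspace L"
  shows "v = 0 \<longleftrightarrow> (\<forall>x. cf v x = 0)"
proof
  assume "v = 0"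
  then show "\<forall>x. cf v x = 0"
    using linear_on_set_0[OF ext_linear subspace_0[OF L_subspace]] assms by (simp add: cf_eq_ext)
next
  assume "\<forall>x. cf v x = 0"
  then have "supp v = {}" by (simp add: supp_def)
  then show "v = 0" using cf_sum[OF assms] by simp
qed

text \<open>The weighted \<open>l1\<close> seminorms; over all nonnegative weights they generate the
  finest locally convex topology on finitely supported functions.\<close>

definition wnorm :: "('a \<Rightarrow> real) \<Rightarrow> 'v \<Rightarrow> real" where
  "wnorm m v = (\<Sum>x\<in>supp v. \<bar>cf v x\<bar> * m x)"

lemma wnorm_superset:
  assumes "finite F" "supp v \<subseteq> F"
  shows "wnorm m v = (\<Sum>x\<in>F. \<bar>cf v x\<bar> * m x)"
  unfolding wnorm_def using assms by (intro sum.mono_neutral_left) (auto simp: supp_def)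

text \<open>The carrier of \<open>L\<close> gets a second topology from a weighted norm. As
  \<open>X\<close> is discrete, \<open>i\<close> is continuous into it, so the universal property
  yields a continuous linear map that fixes the generators, that is, the identity. Balls of the norm
  are therefore open in \<open>L\<close>.\<close>

lemma wnorm_continuous_at_0:
  assumes m: "\<And>x. 0 \<le> m x" and e: "0 < e"
  obtains U where "openin L U" "0 \<in> U" "\<And>v. v \<in> U \<Longrightarrow> wnorm m v < e"
proof -
  \<comment> \<open>Weights may vanish; raising them by 1 gives a norm that dominates
    \<open>wnorm m\<close>, so that the target is Hausdorff.\<close>
  define q where "q = wnorm (\<lambda>x. m x + 1)"
  have m1: "0 < m x + 1" for x using m[of x] by linarith
  obtain E where E: "locally_convex_space E" "topspace E = topspace L"
    "\<And>e. openin E {v \<in> topspace L. q v < e}"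
  proof (rule locally_convex_space_of_norm[OF L_subspace, of q])
    show "0 \<le> q v" for v using m1 by (auto simp: q_def wnorm_def less_imp_le intro!: sum_nonneg)
    show "q v = 0 \<longleftrightarrow> v = 0" if v: "v \<in> topspace L" for v
    proof -
      have "q v = 0 \<longleftrightarrow> (\<forall>x\<in>supp v. \<bar>cf v x\<bar> * (m x + 1) = 0)"
        unfolding q_def wnorm_def using finite_supp[OF v] m1
        by (intro sum_nonneg_eq_0_iff) (auto simp: less_imp_le)
      also have "\<dots> \<longleftrightarrow> (\<forall>x. cf v x = 0)"
      proof -
        have "m x + 1 \<noteq> 0" for x using m1[of x] by simp
        then show ?thesis by (auto simp: supp_def)
      qed
      finally show ?thesis using eq_0_iff_cf[OF v] by simp
    qed
    show "q (c *\<^sub>R v) = \<bar>c\<bar> * q v" if v: "v \<in> topspace L" for c v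
    proof -
      have "q (c *\<^sub>R v) = (\<Sum>x\<in>supp v. \<bar>cf (c *\<^sub>R v) x\<bar> * (m x + 1))"
        unfolding q_def using v by (intro wnorm_superset finite_supp) (auto simp: supp_def cf_scale)
      then show ?thesis
        using v by (simp add: q_def wnorm_def cf_scale abs_mult sum_distrib_left mult.assoc)
    qed
    show "q (v + w) \<le> q v + q w" if vw: "v \<in> topspace L" "w \<in> topspace L" for v w
    proof -
      let ?F = "supp v \<union> supp w"
      have F: "finite ?F" using vw finite_supp by blast
      have "supp (v + w) \<subseteq> ?F" using vw by (auto simp: supp_def cf_add)
      then have "q (v + w) = (\<Sum>x\<in>?F. \<bar>cf (v + w) x\<bar> * (m x + 1))"
        unfolding q_def by (rule wnorm_superset[OF F])
      also have "\<dots> \<le> (\<Sum>x\<in>?F. \<bar>cf v x\<bar> * (m x + 1) + \<bar>cf w x\<bar> * (m x + 1))"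
        using vw m1 by (intro sum_mono)
          (simp add: cf_add distrib_right[symmetric] mult_right_mono abs_triangle_ineq less_imp_le)
      also have "\<dots> = q v + q w"
        unfolding q_def by (simp add: sum.distrib wnorm_superset[OF F, of v] wnorm_superset[OF F, of w])
      finally show ?thesis .
    qed
  qed blast
  have "continuous_map X E i" using i_in_L E(2) by (subst discrete) auto
  then obtain g where g: "g \<in> continuous_linear_maps L E" "\<forall>x\<in>topspace X. g (i x) = i x"
    using extension_unique[OF E(1)] by blast
  have gc: "continuous_map L E g" and gl: "linear_on_set (topspace L) g"
    using g(1) by (auto simp: continuous_linear_maps_def)
  have gv: "g v = v" if v: "v \<in> topspace L" for v
  proof -
    have "g v = (\<Sum>x\<in>supp v. cf v x *\<^sub>R g (i x))" by (rule linear_eq_sum_cf[OF gl v])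
    also have "\<dots> = (\<Sum>x\<in>supp v. cf v x *\<^sub>R i x)"
      using g(2) supp_subset[OF v] by (intro sum.cong) auto
    finally show ?thesis using cf_sum[OF v] by simp
  qed
  define U where "U = {v \<in> topspace L. g v \<in> {v \<in> topspace L. q v < e}}"
  have "openin L U" unfolding U_def using gc E(3) by (rule openin_continuous_map_preimage)
  moreover have "0 \<in> U"
    using gv[OF subspace_0[OF L_subspace]] subspace_0[OF L_subspace] e eq_0_iff_cf[OF subspace_0[OF L_subspace]]
    by (simp add: U_def q_def wnorm_def)
  moreover have "wnorm m v < e" if v: "v \<in> U" for v
  proof -
    have "wnorm m v \<le> q v" unfolding q_def wnorm_def by (intro sum_mono mult_left_mono) auto
    also have "q v < e"
    proof -
      have "v \<in> topspace L" "q (g v) < e" using v by (auto simp: U_def)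
      then show ?thesis using gv[of v] by simp
    qed
    finally show ?thesis .
  qed
  ultimately show thesis by (rule that)
qed

text \<open>A compact set \<open>C\<close> of characters is bounded at each generator, say by
  \<open>m x\<close>. The weighted norm with weights \<open>m\<close> then dominates the lifts of
  all members of \<open>C\<close> at once, and its balls contain neighbourhoods of 0 in
  \<open>L\<close>.\<close>

lemma canonical_hom_continuous:
  "continuous_map L (bidual_topology G L) (canonical_hom G L)"
  unfolding bidual_topology_def
proof (rule continuous_map_into_dual_topology)
  fix v C and \<epsilon> :: real
  assume v: "v \<in> topspace L" and C: "compactin (dual_topology G L) C" and \<epsilon>: "0 < \<epsilon>"
  have Cchar: "C \<subseteq> characters G L" using compactin_subset_topspace[OF C] by (simp add: topspace_dual_topology)
  have "\<exists>B\<ge>0. \<forall>\<xi>\<in>C. x \<in> topspace X \<longrightarrow> \<bar>lam \<xi> (i x)\<bar> \<le> B" for x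
  proof (cases "x \<in> topspace X")
    case True
    have "compact ((\<lambda>\<xi>. lam \<xi> (i x)) ` C)"
      using image_compactin[OF C lam_at_generator_continuous[OF True]] by simp
    then have "bounded ((\<lambda>\<xi>. lam \<xi> (i x)) ` C)" by (rule compact_imp_bounded)
    then obtain B where "0 < B" "\<forall>y\<in>(\<lambda>\<xi>. lam \<xi> (i x)) ` C. norm y \<le> B"
      unfolding bounded_pos by blast
    then show ?thesis by (intro exI[of _ B]) auto
  qed auto
  then obtain m where m: "\<And>x. 0 \<le> m x"
    "\<And>x \<xi>. \<xi> \<in> C \<Longrightarrow> x \<in> topspace X \<Longrightarrow> \<bar>lam \<xi> (i x)\<bar> \<le> m x" by metis
  obtain U where U: "openin L U" "0 \<in> U" "\<And>v. v \<in> U \<Longrightarrow> wnorm m v < \<epsilon>"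
    by (rule wnorm_continuous_at_0[of m \<epsilon>]) (use m(1) \<epsilon> in blast)+
  define N where "N = {w \<in> topspace L. w + (- v) \<in> U}"
  have "continuous_map L L (\<lambda>w. w + (- v))"
    using subspace_neg[OF L_subspace v] by (intro continuous_map_lcs_add[OF L]) auto
  then have "openin L N" unfolding N_def using U(1) by (rule openin_continuous_map_preimage)
  moreover have "v \<in> N" using v U(2) by (simp add: N_def)
  moreover have "dist (canonical_hom G L w \<xi>) (canonical_hom G L v \<xi>) < \<epsilon>"
    if w: "w \<in> N" and \<xi>: "\<xi> \<in> C" for w \<xi>
  proof -
    have wL: "w \<in> topspace L" and wU: "w - v \<in> U" using w by (auto simp: N_def)
    have \<xi>c: "\<xi> \<in> characters G L" using \<xi> Cchar by blast
    have wv: "w - v \<in> topspace L" using wL v by (rule subspace_diff[OF L_subspace])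
    have "dist (canonical_hom G L w \<xi>) (canonical_hom G L v \<xi>) \<le> \<bar>lam \<xi> w - lam \<xi> v\<bar>"
      using \<xi>c norm_cis_minus_1_le[of "lam \<xi> w - lam \<xi> v"]
      by (simp add: canonical_hom_def cis_lam[OF \<xi>c wL] cis_lam[OF \<xi>c v] dist_norm norm_cis_diff)
    also have "lam \<xi> w - lam \<xi> v = lam \<xi> (w - v)"
      using linear_on_set_diff[OF L_subspace lam_linear[OF \<xi>c] wL v] by simp
    also have "\<bar>lam \<xi> (w - v)\<bar> \<le> (\<Sum>x\<in>supp (w - v). \<bar>cf (w - v) x * lam \<xi> (i x)\<bar>)"
      unfolding lam_eq_sum_cf[OF \<xi>c wv] by (rule sum_abs)
    also have "\<dots> \<le> wnorm m (w - v)"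
      unfolding wnorm_def abs_mult using m(2)[OF \<xi>] supp_subset[OF wv]
      by (intro sum_mono mult_left_mono) auto
    also have "\<dots> < \<epsilon>" by (rule U(3)[OF wU])
    finally show ?thesis .
  qed
  ultimately show "\<exists>N. openin L N \<and> v \<in> N \<and>
      (\<forall>w\<in>N. \<forall>\<xi>\<in>C. dist (canonical_hom G L w \<xi>) (canonical_hom G L v \<xi>) < \<epsilon>)" by blast
qed (rule canonical_hom_bicharacter)

end

section \<open>The product of lines as the dual, and the bidual\<close>

context free_lcs_over_discrete
begin

abbreviation coordinate_topology :: "('a \<Rightarrow> real) topology" where
  "coordinate_topology \<equiv> product_topology (\<lambda>_. euclideanreal) (topspace X)"

text \<open>A compact \<open>K\<close> has finite support and bounded coefficients, so closeness of
  two functions at finitely many points makes their characters uniformly close on \<open>K\<close>.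
  Lines and compact boxes can thus be carried from the product into the dual.\<close>

lemma chr_continuous: "continuous_map coordinate_topology (dual_topology G L) chr"
proof (rule continuous_map_into_dual_topology)
  show "chr f \<in> characters G L" for f by (simp add: chr_character)
  fix f K and \<epsilon> :: real
  assume f: "f \<in> topspace coordinate_topology" and K: "compactin L K" and \<epsilon>: "0 < \<epsilon>"
  let ?S = "support_of K"
  have S: "finite ?S" by (rule finite_support_of_compactin[OF K])
  have KL: "K \<subseteq> topspace L" using K by (rule compactin_subset_topspace)
  have SX: "?S \<subseteq> topspace X" using KL by (rule support_of_subset)
  have "\<exists>B\<ge>0. \<forall>v\<in>K. \<bar>cf v x\<bar> \<le> B" for x
  proof -
    have "compact (ext (indicat_real {x}) ` K)"
      using image_compactin[OF K ext_continuous[OF continuous_on_X]] by simp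
    then obtain B where "0 < B" "\<forall>y\<in>ext (indicat_real {x}) ` K. norm y \<le> B"
      using compact_imp_bounded bounded_pos by blast
    then show ?thesis using KL by (intro exI[of _ B]) (auto simp: cf_eq_ext)
  qed
  then obtain B where B: "\<And>x. 0 \<le> B x" "\<And>x v. v \<in> K \<Longrightarrow> \<bar>cf v x\<bar> \<le> B x" by metis
  \<comment> \<open>A bound on the sum of the absolute coefficients of any \<open>v\<close> in
    \<open>K\<close>, raised by 1 to be positive and to make the last estimate strict.\<close>
  define M where "M = (\<Sum>x\<in>?S. B x) + 1"
  have M: "0 < M" unfolding M_def using sum_nonneg[of ?S B] B(1) by (simp add: add_nonneg_pos)
  define N where "N = (\<Inter>x\<in>?S. {g \<in> topspace coordinate_topology. g x \<in> ball (f x) (\<epsilon> / M)})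
    \<inter> topspace coordinate_topology"
  have "openin coordinate_topology N"
    unfolding N_def
  proof (rule openin_INT[OF S])
    fix x assume "x \<in> ?S"
    then have "x \<in> topspace X" using SX by blast
    then have "continuous_map coordinate_topology euclideanreal (\<lambda>g. g x)"
      by (rule continuous_map_product_projection)
    then show "openin coordinate_topology {g \<in> topspace coordinate_topology. g x \<in> ball (f x) (\<epsilon> / M)}"
      by (rule openin_continuous_map_preimage) simp
  qed
  moreover have "f \<in> N" unfolding N_def using f \<epsilon> M by simp
  moreover have "dist (chr g v) (chr f v) < \<epsilon>" if g: "g \<in> N" and v: "v \<in> K" for g v
  proof -
    have vL: "v \<in> topspace L" using v KL by blast
    have near: "\<bar>g x - f x\<bar> \<le> \<epsilon> / M" if "x \<in> supp v" for x
    proof -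
      have "g x \<in> ball (f x) (\<epsilon> / M)" using g that v unfolding N_def by blast
      then show ?thesis by (simp add: dist_real_def abs_minus_commute)
    qed
    have sub: "supp v \<subseteq> ?S" using v by blast
    have "dist (chr g v) (chr f v) \<le> \<bar>ext g v - ext f v\<bar>"
      using vL norm_cis_minus_1_le[of "ext g v - ext f v"] by (simp add: chr_def dist_norm norm_cis_diff)
    also have "ext g v - ext f v = (\<Sum>x\<in>supp v. cf v x * (g x - f x))"
      by (simp add: ext_eq_sum_cf[OF continuous_on_X vL] sum_subtractf right_diff_distrib)
    also have "\<bar>\<dots>\<bar> \<le> (\<Sum>x\<in>supp v. \<bar>cf v x * (g x - f x)\<bar>)" by (rule sum_abs)
    also have "\<dots> \<le> (\<Sum>x\<in>supp v. B x * (\<epsilon> / M))"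
      unfolding abs_mult using near B(1) B(2)[OF v] by (intro sum_mono mult_mono) auto
    also have "\<dots> \<le> (\<Sum>x\<in>?S. B x * (\<epsilon> / M))"
      using B(1) \<epsilon> M by (intro sum_mono2[OF S sub]) simp
    also have "\<dots> = (\<Sum>x\<in>?S. B x) * (\<epsilon> / M)" by (rule sum_distrib_right[symmetric])
    also have "\<dots> < M * (\<epsilon> / M)"
      using \<epsilon> M by (intro mult_strict_right_mono) (simp_all add: M_def)
    finally show ?thesis using M by simp
  qed
  ultimately show "\<exists>N. openin coordinate_topology N \<and> f \<in> N \<and>
      (\<forall>g\<in>N. \<forall>v\<in>K. dist (chr g v) (chr f v) < \<epsilon>)" by blast
qed

lemma chr_mult: "(\<lambda>v\<in>topspace L. chr f v * chr g v) = chr (\<lambda>x. f x + g x)"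
  unfolding chr_def
  by (intro restrict_ext)
    (simp add: cis_mult ext_eq_sum_cf[OF continuous_on_X] sum.distrib distrib_left)

lemma character_eq_chr:
  assumes \<xi>: "\<xi> \<in> characters G L"
  shows "\<xi> = chr (\<lambda>x. lam \<xi> (i x))"
proof (rule extensionalityI)
  show "\<xi> \<in> extensional (topspace L)" using \<xi> by (simp add: characters_additive_group)
  show "chr (\<lambda>x. lam \<xi> (i x)) \<in> extensional (topspace L)" by (simp add: chr_def)
  fix v assume v: "v \<in> topspace L"
  then show "\<xi> v = chr (\<lambda>x. lam \<xi> (i x)) v"
    by (simp add: chr_def cis_lam[OF \<xi>] lam_eq_sum_cf[OF \<xi>] ext_eq_sum_cf[OF continuous_on_X])
qed

text \<open>Along the line through \<open>f\<close> the bicharacter is \<open>cis (t * a f)\<close>,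
  which defines a linear functional \<open>a\<close> on functions. Continuity ties \<open>a\<close>
  to the finite support of one compact set, so \<open>a\<close> is a combination of point
  evaluations, and its values at indicators are the coefficients of the vector sought.\<close>

lemma canonical_hom_surj:
  assumes \<Psi>: "\<Psi> \<in> characters (dual_group G L) (dual_topology G L)"
  obtains v where "v \<in> topspace L" "\<Psi> = canonical_hom G L v"
proof -
  have \<Psi>c: "continuous_map (dual_topology G L) euclidean \<Psi>"
    using \<Psi> by (simp add: characters_def[of "dual_group G L"] continuous_map_in_subtopology)
  have chr: "chr f \<in> characters G L" for f by (simp add: chr_character)
  have mult: "\<Psi> (chr (\<lambda>x. f x + g x)) = \<Psi> (chr f) * \<Psi> (chr g)" for f g
    using bicharacter_mult[OF \<Psi> chr[of f] chr[of g]] by (simp add: chr_mult)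
  have chr_restrict: "chr (restrict f (topspace X)) = chr f" for f
    unfolding chr_def using ext_cong[of "restrict f (topspace X)" f] by simp
  have "\<exists>a. \<forall>t. \<Psi> (chr (\<lambda>x. t * f x)) = cis (t * a)" for f
  proof -
    have "continuous_map euclideanreal coordinate_topology (\<lambda>t. \<lambda>x\<in>topspace X. t * f x)"
      by (auto simp: continuous_map_componentwise intro!: continuous_intros)
    from continuous_map_compose[OF continuous_map_compose[OF this chr_continuous] \<Psi>c]
    have "continuous_on UNIV (\<lambda>t. \<Psi> (chr (\<lambda>x. t * f x)))"
      by (simp add: o_def chr_restrict)
    moreover have "\<Psi> (chr (\<lambda>x. (s + t) * f x)) = \<Psi> (chr (\<lambda>x. s * f x)) * \<Psi> (chr (\<lambda>x. t * f x))" for s t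
      by (simp add: mult[symmetric] distrib_right)
    moreover have "norm (\<Psi> (chr (\<lambda>x. t * f x))) = 1" for t
      using chr by (intro character_in_sphere[OF \<Psi>]) (simp add: topspace_dual_topology)
    ultimately obtain a where "\<And>t. \<Psi> (chr (\<lambda>x. t * f x)) = cis (t * a)"
      using continuous_hom_real_circle[of "\<lambda>t. \<Psi> (chr (\<lambda>x. t * f x))"] by blast
    then show ?thesis by blast
  qed
  then obtain a where a: "\<And>f t. \<Psi> (chr (\<lambda>x. t * f x)) = cis (t * a f)" by metis
  have a_add: "a (\<lambda>x. f x + g x) = a f + a g" for f g
  proof (rule cis_scale_inject)
    fix t :: real
    have "cis (t * a (\<lambda>x. f x + g x)) = \<Psi> (chr (\<lambda>x. t * f x + t * g x))"
      using a[of t "\<lambda>x. f x + g x"] by (simp add: distrib_left)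
    also have "\<dots> = cis (t * a f) * cis (t * a g)" by (simp add: mult a)
    finally show "cis (t * a (\<lambda>x. f x + g x)) = cis (t * (a f + a g))" by (simp add: cis_mult distrib_left)
  qed
  have a_scale: "a (\<lambda>x. c * f x) = c * a f" for c f
  proof (rule cis_scale_inject)
    fix t :: real
    show "cis (t * a (\<lambda>x. c * f x)) = cis (t * (c * a f))"
      using a[of t "\<lambda>x. c * f x"] a[of "t * c" f] by (simp add: mult.assoc)
  qed
  have a_0: "a (\<lambda>_. 0) = 0" using a_scale[of 0 "\<lambda>_. 0"] by simp
  have \<Psi>0: "\<Psi> (chr (\<lambda>_. 0)) = 1" using a[of 0 "\<lambda>_. 0"] by simp
  have \<delta>1: "0 < norm (cis 1 - 1)" using pi_gt3 by (intro norm_cis_minus_1_pos) auto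
  have "openin (dual_topology G L)
      {\<xi> \<in> topspace (dual_topology G L). \<Psi> \<xi> \<in> ball 1 (norm (cis 1 - 1))}"
    using \<Psi>c by (rule openin_continuous_map_preimage) simp
  moreover have "chr (\<lambda>_. 0) \<in> {\<xi> \<in> topspace (dual_topology G L). \<Psi> \<xi> \<in> ball 1 (norm (cis 1 - 1))}"
    using chr \<Psi>0 \<delta>1 by (simp add: topspace_dual_topology)
  ultimately obtain K \<delta> where K: "compactin L K" "0 < \<delta>"
    "\<forall>\<xi>\<in>characters G L. (\<forall>v\<in>K. dist (\<xi> v) (chr (\<lambda>_. 0) v) < \<delta>) \<longrightarrow> \<Psi> \<xi> \<in> ball 1 (norm (cis 1 - 1))"
    unfolding openin_dual_topology topspace_dual_topology by blast
  let ?S = "support_of K"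
  have KL: "K \<subseteq> topspace L" using K(1) by (rule compactin_subset_topspace)
  have S: "finite ?S" "?S \<subseteq> topspace X"
    by (rule finite_support_of_compactin[OF K(1)]) (rule support_of_subset[OF KL])
  txt \<open>The circle has no small subgroups.\<close>
  have a_vanish: "a f = 0" if f: "\<And>x. x \<in> ?S \<Longrightarrow> f x = 0" for f
  proof (rule ccontr)
    assume ne: "a f \<noteq> 0"
    have near: "norm (cis (t * a f) - 1) < norm (cis 1 - 1)" for t
    proof -
      have "chr (\<lambda>x. t * f x) v = chr (\<lambda>_. 0) v" if v: "v \<in> K" for v
      proof -
        have vL: "v \<in> topspace L" using v KL by blast
        have "ext (\<lambda>x. t * f x) v = ext (\<lambda>_. 0) v"
          unfolding ext_eq_sum_cf[OF continuous_on_X vL] using f v by (intro sum.cong) auto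
        then show ?thesis by (simp add: chr_def)
      qed
      then have "\<Psi> (chr (\<lambda>x. t * f x)) \<in> ball 1 (norm (cis 1 - 1))"
        using K(2) by (intro K(3)[rule_format] chr) simp
      then show ?thesis by (simp add: a dist_norm norm_minus_commute)
    qed
    have "\<bar>1 / a f * a f\<bar> < 1"
    proof (rule abs_less_if_cis_arc_near_1)
      show "norm (cis (t * (1 / a f * a f)) - 1) < norm (cis 1 - 1)" for t
        using near[of "t / a f"] by (simp add: ne)
    qed simp
    then show False using ne by simp
  qed
  define v where "v = (\<Sum>x\<in>?S. a (indicat_real {x}) *\<^sub>R i x)"
  have v: "v \<in> topspace L"
    unfolding v_def using S i_in_L
    by (intro subspace_sum[OF L_subspace] subspace_scale[OF L_subspace]) blast
  have ext_v: "ext f v = a f" for f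
  proof -
    have a_sum: "a (\<lambda>y. \<Sum>x\<in>F. f x * b x y) = (\<Sum>x\<in>F. f x * a (b x))"
      if "finite F" for F and b :: "'a \<Rightarrow> 'a \<Rightarrow> real"
      using that by (induction F rule: finite_induct) (simp_all add: a_0 a_add a_scale)
    \<comment> \<open>\<open>h\<close> is the part of \<open>f\<close> carried by \<open>?S\<close>;
      the remainder vanishes on \<open>?S\<close> and is killed by \<open>a\<close>.\<close>
    define h where "h y = (\<Sum>x\<in>?S. f x * indicat_real {x} y)" for y
    have h: "h y = (if y \<in> ?S then f y else 0)" for y
    proof -
      have "h y = (\<Sum>x\<in>?S. if x = y then f x else 0)"
        unfolding h_def by (intro sum.cong) (auto simp: indicator_def)
      then show ?thesis using S(1) by (simp only: sum.delta)
    qed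
    have "a f = a (\<lambda>y. h y + (f y - h y))" by simp
    also have "\<dots> = a h + a (\<lambda>y. f y - h y)" by (rule a_add)
    also have "a (\<lambda>y. f y - h y) = 0" by (rule a_vanish) (simp add: h)
    also have "a h = (\<Sum>x\<in>?S. f x * a (indicat_real {x}))" unfolding h_def by (rule a_sum[OF S(1)])
    finally have 1: "a f = (\<Sum>x\<in>?S. f x * a (indicat_real {x}))" by simp
    have "ext f v = (\<Sum>x\<in>?S. a (indicat_real {x}) *\<^sub>R ext f (i x))"
      unfolding v_def
      by (rule linear_on_set_sum[OF L_subspace ext_linear[OF continuous_on_X] S(1)]) (use S(2) i_in_L in blast)
    also have "\<dots> = (\<Sum>x\<in>?S. f x * a (indicat_real {x}))"
    proof (rule sum.cong[OF refl])
      fix x assume "x \<in> ?S"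
      then have "x \<in> topspace X" using S(2) by blast
      then show "a (indicat_real {x}) *\<^sub>R ext f (i x) = f x * a (indicat_real {x})"
        by (simp add: ext_i[OF continuous_on_X])
    qed
    finally show ?thesis using 1 by simp
  qed
  have "\<Psi> = canonical_hom G L v"
  proof (rule extensionalityI)
    show "\<Psi> \<in> extensional (characters G L)"
      using \<Psi> unfolding characters_def[of "dual_group G L"] by (simp add: dual_group_def)
    show "canonical_hom G L v \<in> extensional (characters G L)" by (simp add: canonical_hom_def)
    fix \<xi> assume \<xi>: "\<xi> \<in> characters G L"
    let ?f = "\<lambda>x. lam \<xi> (i x)"
    have "\<Psi> \<xi> = \<Psi> (chr (\<lambda>x. 1 * ?f x))" using character_eq_chr[OF \<xi>] by simp
    also have "\<dots> = cis (ext ?f v)" using a[of 1 ?f] by (simp add: ext_v)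
    also have "\<dots> = \<xi> v" using character_eq_chr[OF \<xi>] v by (metis chr_def restrict_apply')
    finally show "\<Psi> \<xi> = canonical_hom G L v \<xi>" using \<xi> by (simp add: canonical_hom_def)
  qed
  then show thesis using that v by blast
qed

text \<open>A convex neighbourhood \<open>V\<close> of 0 contains \<open>m x *\<^sub>R i x\<close>
  and its negative for suitable \<open>m x > 0\<close>. The box of functions bounded by
  \<open>1 / m x\<close> is compact by Tychonoff's theorem, and closeness on it bounds the norm of a
  difference \<open>u\<close> with weights \<open>1 / m x\<close> by 1. So \<open>u\<close> is a
  subconvex combination of those vectors and lies in \<open>V\<close>.\<close>

lemma canonical_hom_open: "open_map L (bidual_topology G L) (canonical_hom G L)"
  unfolding open_map_def
proof (intro allI impI)
  fix O' assume O: "openin L O'"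
  have OL: "O' \<subseteq> topspace L" using O by (rule openin_subset)
  show "openin (bidual_topology G L) (canonical_hom G L ` O')"
    unfolding bidual_topology_def openin_dual_topology
  proof (intro conjI ballI)
    show "canonical_hom G L ` O' \<subseteq> characters (dual_group G L) (dual_topology G L)"
      using canonical_hom_bicharacter OL by blast
    fix \<phi> assume "\<phi> \<in> canonical_hom G L ` O'"
    then obtain v where v: "v \<in> O'" "\<phi> = canonical_hom G L v" by blast
    have vL: "v \<in> topspace L" using v OL by blast
    have "continuous_map L L (\<lambda>u. v + u)"
      using vL by (intro continuous_map_lcs_add[OF L]) auto
    then have "openin L {u \<in> topspace L. v + u \<in> O'}"
      using O by (rule openin_continuous_map_preimage)
    moreover have "0 \<in> {u \<in> topspace L. v + u \<in> O'}" using v subspace_0[OF L_subspace] by simp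
    ultimately obtain U V where UV: "openin L U" "convex V" "0 \<in> U" "U \<subseteq> V"
      "V \<subseteq> {u \<in> topspace L. v + u \<in> O'}"
      by (rule lcs_convex_neighbourhood[OF L])
    have "\<exists>m>0. x \<in> topspace X \<longrightarrow> m *\<^sub>R i x \<in> V \<and> (- m) *\<^sub>R i x \<in> V" for x
    proof (cases "x \<in> topspace X")
      case True
      have "continuous_map euclideanreal L (\<lambda>c. c *\<^sub>R i x)"
        using i_in_L[OF True] by (intro continuous_map_lcs_scale[OF L]) auto
      then have "openin euclideanreal {c \<in> topspace euclideanreal. c *\<^sub>R i x \<in> U}"
        using UV(1) by (rule openin_continuous_map_preimage)
      then have "open {c. c *\<^sub>R i x \<in> U}" by simp
      moreover have "0 \<in> {c. c *\<^sub>R i x \<in> U}" using UV(3) by simp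
      ultimately obtain e where e: "0 < e" "ball 0 e \<subseteq> {c. c *\<^sub>R i x \<in> U}"
        unfolding open_contains_ball by blast
      then have "e / 2 \<in> {c. c *\<^sub>R i x \<in> U}" "- (e / 2) \<in> {c. c *\<^sub>R i x \<in> U}"
        by (auto intro!: subsetD[OF e(2)] simp del: mem_Collect_eq)
      then show ?thesis using e(1) UV(4) by (intro exI[of _ "e / 2"]) auto
    qed (auto intro: exI[of _ 1])
    then obtain m where m: "\<And>x. 0 < m x"
      "\<And>x. x \<in> topspace X \<Longrightarrow> m x *\<^sub>R i x \<in> V \<and> (- m x) *\<^sub>R i x \<in> V" by metis
    define B where "B = PiE (topspace X) (\<lambda>x. {- (1 / m x)..1 / m x})"
    have "compactin coordinate_topology B" unfolding B_def by (simp add: compactin_PiE)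
    then have C: "compactin (dual_topology G L) (chr ` B)"
      using chr_continuous by (rule image_compactin)
    have "\<psi> \<in> canonical_hom G L ` O'"
      if \<psi>: "\<psi> \<in> characters (dual_group G L) (dual_topology G L)"
        and near: "\<forall>\<xi>\<in>chr ` B. dist (\<psi> \<xi>) (\<phi> \<xi>) < norm (cis 1 - 1)" for \<psi>
    proof -
      obtain w where w: "w \<in> topspace L" "\<psi> = canonical_hom G L w" by (rule canonical_hom_surj[OF \<psi>])
      define u where "u = w - v"
      have u: "u \<in> topspace L" unfolding u_def using w(1) vL by (rule subspace_diff[OF L_subspace])
      \<comment> \<open>The box is stable under factors \<open>t\<close> in \<open>[0, 1]\<close>,
        so the whole arc is controlled and \<open>ext f u\<close> itself, not only its residue, is
        bounded.\<close>
      have small: "\<bar>ext f u\<bar> < 1" if f: "\<And>x. x \<in> topspace X \<Longrightarrow> \<bar>f x\<bar> \<le> 1 / m x" for f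
      proof (rule abs_less_if_cis_arc_near_1)
        fix t :: real assume t: "0 \<le> t" "t \<le> 1"
        let ?g = "\<lambda>x\<in>topspace X. t * f x"
        have "?g x \<in> {- (1 / m x)..1 / m x}" if x: "x \<in> topspace X" for x
        proof -
          have "\<bar>t * f x\<bar> \<le> 1 * (1 / m x)"
            unfolding abs_mult using t f[OF x] by (intro mult_mono) auto
          then show ?thesis using x by (simp add: abs_le_iff)
        qed
        then have "?g \<in> B" by (auto simp: B_def)
        then have "dist (\<psi> (chr ?g)) (\<phi> (chr ?g)) < norm (cis 1 - 1)" using near by blast
        moreover have "ext ?g z = t * ext f z" if "z \<in> topspace L" for z
          unfolding ext_eq_sum_cf[OF continuous_on_X that]
          using supp_subset[OF that] by (auto simp: sum_distrib_left intro!: sum.cong)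
        ultimately have "norm (cis (t * ext f w) - cis (t * ext f v)) < norm (cis 1 - 1)"
          using w vL v(2) chr_character[OF continuous_on_X, of ?g]
          by (simp add: canonical_hom_def chr_def dist_norm)
        then show "norm (cis (t * ext f u) - 1) < norm (cis 1 - 1)"
          using linear_on_set_diff[OF L_subspace ext_linear[OF continuous_on_X] w(1) vL]
          by (simp add: norm_cis_diff u_def right_diff_distrib)
      qed simp
      have sgn_le: "\<bar>sgn c / m x\<bar> \<le> 1 / m x" for c :: real and x
        using m(1)[of x] by (simp add: abs_div sgn_if)
      \<comment> \<open>The function in the box that has the signs of the coefficients of
        \<open>u\<close> turns the pairing into the weighted norm.\<close>
      have "ext (\<lambda>x. sgn (cf u x) / m x) u = (\<Sum>x\<in>supp u. \<bar>cf u x\<bar> / m x)"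
        unfolding ext_eq_sum_cf[OF continuous_on_X u] by (simp add: abs_sgn)
      then have le1: "(\<Sum>x\<in>supp u. \<bar>cf u x\<bar> / m x) \<le> 1"
        using small[OF sgn_le, of "\<lambda>x. cf u x"] by simp
      have "(\<Sum>x\<in>supp u. (\<bar>cf u x\<bar> / m x) *\<^sub>R ((sgn (cf u x) * m x) *\<^sub>R i x)) \<in> V"
      proof (rule convex_contains_subconvex_combination[OF UV(2) _ finite_supp[OF u] _ le1])
        show "0 \<in> V" using UV(3,4) by blast
        show "0 \<le> \<bar>cf u x\<bar> / m x" for x using m(1)[of x] by simp
        fix x assume x: "x \<in> supp u"
        then have "x \<in> topspace X" using supp_subset[OF u] by blast
        then show "(sgn (cf u x) * m x) *\<^sub>R i x \<in> V"
          using m(2)[of x] x by (cases "0 < cf u x") (auto simp: supp_def sgn_if)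
      qed
      moreover have "(\<bar>cf u x\<bar> / m x) *\<^sub>R ((sgn (cf u x) * m x) *\<^sub>R i x) = cf u x *\<^sub>R i x" for x
        using m(1)[of x] by (simp add: abs_mult_sgn mult.commute)
      ultimately have "(\<Sum>x\<in>supp u. cf u x *\<^sub>R i x) \<in> V" by (simp only:)
      then have "u \<in> V" by (simp only: cf_sum[OF u, symmetric])
      then have "v + u \<in> O'" using UV(5) by blast
      then show ?thesis using w(2) by (simp add: u_def)
    qed
    then show "\<exists>K \<epsilon>. compactin (dual_topology G L) K \<and> 0 < \<epsilon> \<and>
        (\<forall>\<psi>\<in>characters (dual_group G L) (dual_topology G L).
          (\<forall>\<xi>\<in>K. dist (\<psi> \<xi>) (\<phi> \<xi>) < \<epsilon>) \<longrightarrow> \<psi> \<in> canonical_hom G L ` O')"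
      using C norm_cis_minus_1_pos[of 1] pi_gt3 by (intro exI[of _ "chr ` B"] exI[of _ "norm (cis 1 - 1)"]) auto
  qed
qed

lemma canonical_hom_inj: "inj_on (canonical_hom G L) (topspace L)"
proof (rule inj_onI)
  fix v w assume v: "v \<in> topspace L" and w: "w \<in> topspace L"
    and eq: "canonical_hom G L v = canonical_hom G L w"
  have vw: "v - w \<in> topspace L" using v w by (rule subspace_diff[OF L_subspace])
  have "ext f v = ext f w" for f
  proof (rule cis_scale_inject)
    fix t :: real
    have "chr (\<lambda>x. t * f x) v = chr (\<lambda>x. t * f x) w"
      using fun_cong[OF eq, of "chr (\<lambda>x. t * f x)"] chr_character[OF continuous_on_X]
      by (simp add: canonical_hom_def)
    moreover have "ext (\<lambda>x. t * f x) z = t * ext f z" if "z \<in> topspace L" for z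
      unfolding ext_eq_sum_cf[OF continuous_on_X that] by (simp add: sum_distrib_left mult.left_commute)
    ultimately show "cis (t * ext f v) = cis (t * ext f w)" using v w by (simp add: chr_def)
  qed
  then have "cf (v - w) x = 0" for x
    using linear_on_set_diff[OF L_subspace ext_linear[OF continuous_on_X] v w]
    by (simp add: cf_eq_ext[OF vw])
  then show "v = w" using eq_0_iff_cf[OF vw] by simp
qed

lemma reflexive_if_discrete: "reflexive_group G L"
  unfolding reflexive_group_def
proof (intro conjI)
  let ?\<alpha> = "canonical_hom G L"
  show "abelian_topological_group G L" by (rule abelian_topological_group_additive_group[OF L])
  have img: "?\<alpha> ` topspace L = characters (dual_group G L) (dual_topology G L)"
  proof
    show "?\<alpha> ` topspace L \<subseteq> characters (dual_group G L) (dual_topology G L)"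
      using canonical_hom_bicharacter by blast
    show "characters (dual_group G L) (dual_topology G L) \<subseteq> ?\<alpha> ` topspace L"
    proof
      fix \<Psi> assume "\<Psi> \<in> characters (dual_group G L) (dual_topology G L)"
      then obtain v where "v \<in> topspace L" "\<Psi> = ?\<alpha> v" by (rule canonical_hom_surj)
      then show "\<Psi> \<in> ?\<alpha> ` topspace L" by blast
    qed
  qed
  then show "homeomorphic_map L (bidual_topology G L) ?\<alpha>"
    using canonical_hom_continuous canonical_hom_open canonical_hom_inj
    by (intro bijective_open_imp_homeomorphic_map) (simp_all add: bidual_topology_def topspace_dual_topology)
  have carriers: "carrier (bidual_group G L) = characters (dual_group G L) (dual_topology G L)"
    by (simp add: bidual_group_def dual_group_def[of "dual_group G L"])
  have "?\<alpha> (v + w) = (\<lambda>\<xi>\<in>characters G L. ?\<alpha> v \<xi> * ?\<alpha> w \<xi>)"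
    if "v \<in> topspace L" "w \<in> topspace L" for v w
    unfolding canonical_hom_def using that
    by (intro restrict_ext) (simp add: characters_additive_group)
  then have "?\<alpha> \<in> hom G (bidual_group G L)"
    using canonical_hom_bicharacter
    by (simp add: hom_def carriers carrier_G Pi_def)
      (simp add: additive_group_def bidual_group_def dual_group_def)
  moreover have "bij_betw ?\<alpha> (carrier G) (carrier (bidual_group G L))"
    using canonical_hom_inj img by (simp add: bij_betw_def carriers carrier_G)
  ultimately show "?\<alpha> \<in> iso G (bidual_group G L)" by (simp add: iso_def)
qed

end

theorem theorem1p1:
  fixes X :: "'a topology" and L :: "'v::real_vector topology" and i :: "'a \<Rightarrow> 'v"
  assumes "Tychonoff_space X" and "Dieudonne_complete X" and "free_lcs X L i"
  shows "reflexive_group (additive_group L) L \<longleftrightarrow> X = discrete_topology (topspace X)"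
proof
  interpret free_lcs_over X L i using assms(1,3) by unfold_locales
  assume "reflexive_group (additive_group L) L"
  then show "X = discrete_topology (topspace X)" by (rule discrete_if_reflexive[OF assms(2)])
next
  assume "X = discrete_topology (topspace X)"
  then interpret free_lcs_over_discrete X L i using assms(1,3) by unfold_locales
  show "reflexive_group (additive_group L) L" by (rule reflexive_if_discrete)
qed

end
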